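(* Let $R$ be a commutative pseudocompact ring, let $\Lambda$ be a pseudocompact $R$-algebra, let $M$ be a finitely generated pseudocompact left $\Lambda$-module and let $X$ be any pseudocompact left $\Lambda$-module. Then the $\mathrm{Add}(M)$-cover of $X$ exists.
   Context: A pseudocompact ring is a complete Hausdorff topological ring with a basis of neighbourhoods of $0$ of open ideals whose quotients have finite length; a pseudocompact $R$-algebra $\Lambda$ is an inverse limit of quotient algebras $\Lambda/I$ ($I$ open two-sided ideals) of finite length over $R$. Pseudocompact left $\Lambda$-modules are the inverse limits of left $\Lambda$-modules of finite length over $R$; morphisms are continuous $\Lambda$-homomorphisms. $\mathrm{Add}(M)$ is the full subcategory of pseudocompact left $\Lambda$-modules whose objects are the (continuous) direct summands of arbitrary direct products of copies of $M$. An $\mathrm{Add}(M)$-precover of $X$ is a continuous homomorphism $\rho:P\to X$ with $P\in\mathrm{Add}(M)$ such that for every continuous homomorphism $\alpha:S\to X$ with $S\in\mathrm{Add}(M)$ there is a continuous homomorphism $\gamma:S\to P$ with $\rho\gamma=\alpha$. An $\mathrm{Add}(M)$-cover is an $\mathrm{Add}(M)$-precover $\rho:P\to X$ such that every continuous homomorphism $\gamma:P\to P$ with $\rho\gamma=\rho$ is an automorphism of $P$. *)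

theory Defs
  imports "HOL-Analysis.Analysis" "HOL-Algebra.Module" "HOL-Algebra.Ideal"
begin

text \<open>
  Modules are records of type \<open>('l, 'm) module\<close> as in HOL-Algebra; the ring fields \<open>mult\<close> and \<open>one\<close>
  of such a record play no role for a module and are left \<open>undefined\<close> in the constructions below.
  The topology of a ring or module is a separate parameter whose \<open>topspace\<close> is the carrier.
  Maps are only considered on carriers.
\<close>


section \<open>Modules and finite length\<close>

text \<open>The library's locale \<^locale>\<open>module\<close> requires a commutative ring of scalars.\<close>

locale left_module = L?: ring L + M?: abelian_group M
  for L :: "('l, 'a) ring_scheme" (structure) and M :: "('l, 'm) module" (structure) +
  assumes smult_closed:
      "\<lbrakk>a \<in> carrier L; x \<in> carrier M\<rbrakk> \<Longrightarrow> a \<odot>\<^bsub>M\<^esub> x \<in> carrier M"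
    and smult_l_distr:
      "\<lbrakk>a \<in> carrier L; b \<in> carrier L; x \<in> carrier M\<rbrakk>
        \<Longrightarrow> (a \<oplus>\<^bsub>L\<^esub> b) \<odot>\<^bsub>M\<^esub> x = a \<odot>\<^bsub>M\<^esub> x \<oplus>\<^bsub>M\<^esub> b \<odot>\<^bsub>M\<^esub> x"
    and smult_r_distr:
      "\<lbrakk>a \<in> carrier L; x \<in> carrier M; y \<in> carrier M\<rbrakk>
        \<Longrightarrow> a \<odot>\<^bsub>M\<^esub> (x \<oplus>\<^bsub>M\<^esub> y) = a \<odot>\<^bsub>M\<^esub> x \<oplus>\<^bsub>M\<^esub> a \<odot>\<^bsub>M\<^esub> y"
    and smult_assoc:
      "\<lbrakk>a \<in> carrier L; b \<in> carrier L; x \<in> carrier M\<rbrakk>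
        \<Longrightarrow> (a \<otimes>\<^bsub>L\<^esub> b) \<odot>\<^bsub>M\<^esub> x = a \<odot>\<^bsub>M\<^esub> (b \<odot>\<^bsub>M\<^esub> x)"
    and smult_one:
      "x \<in> carrier M \<Longrightarrow> \<one>\<^bsub>L\<^esub> \<odot>\<^bsub>M\<^esub> x = x"

text \<open>
  An associative unital, not necessarily commutative, algebra; the library's locale
  \<^locale>\<open>algebra\<close> is restricted to commutative algebras.
\<close>

definition assoc_algebra :: "'r ring \<Rightarrow> ('r, 'l) module \<Rightarrow> bool" where
  "assoc_algebra R L \<longleftrightarrow> module R L \<and> ring L \<and>
     (\<forall>a \<in> carrier R. \<forall>x \<in> carrier L. \<forall>y \<in> carrier L.
        (a \<odot>\<^bsub>L\<^esub> x) \<otimes>\<^bsub>L\<^esub> y = a \<odot>\<^bsub>L\<^esub> (x \<otimes>\<^bsub>L\<^esub> y) \<and>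
        x \<otimes>\<^bsub>L\<^esub> (a \<odot>\<^bsub>L\<^esub> y) = a \<odot>\<^bsub>L\<^esub> (x \<otimes>\<^bsub>L\<^esub> y))"

definition quot_module :: "('l, 'm) module \<Rightarrow> 'm set \<Rightarrow> ('l, 'm set) module" where
  "quot_module M N =
     \<lparr>carrier = a_rcosets\<^bsub>M\<^esub> N, monoid.mult = undefined, monoid.one = undefined,
      ring.zero = N, ring.add = (<+>\<^bsub>M\<^esub>), module.smult = (\<lambda>a C. \<Union>x\<in>C. N +>\<^bsub>M\<^esub> (a \<odot>\<^bsub>M\<^esub> x))\<rparr>"

definition regular_module :: "'r ring \<Rightarrow> ('r, 'r) module" where
  "regular_module R =
     \<lparr>carrier = carrier R, monoid.mult = undefined, monoid.one = undefined,
      ring.zero = \<zero>\<^bsub>R\<^esub>, ring.add = (\<oplus>\<^bsub>R\<^esub>), module.smult = (\<otimes>\<^bsub>R\<^esub>)\<rparr>"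

text \<open>A module over an \<open>R\<close>-algebra \<open>L\<close>, regarded as an \<open>R\<close>-module along \<open>R \<rightarrow> L\<close>.\<close>

definition restrict_scalars :: "('r, 'l) module \<Rightarrow> ('l, 'm) module \<Rightarrow> ('r, 'm) module" where
  "restrict_scalars L M =
     \<lparr>carrier = carrier M, monoid.mult = undefined, monoid.one = undefined,
      ring.zero = \<zero>\<^bsub>M\<^esub>, ring.add = (\<oplus>\<^bsub>M\<^esub>), module.smult = (\<lambda>a x. (a \<odot>\<^bsub>L\<^esub> \<one>\<^bsub>L\<^esub>) \<odot>\<^bsub>M\<^esub> x)\<rparr>"

text \<open>Finite length: there is a composition series.\<close>

definition finite_length :: "'r ring \<Rightarrow> ('r, 'm) module \<Rightarrow> bool" where
  "finite_length R M \<longleftrightarrow>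
     (\<exists>(n::nat) F. F 0 = {\<zero>\<^bsub>M\<^esub>} \<and> F n = carrier M \<and>
        (\<forall>i\<le>n. submodule (F i) R M) \<and>
        (\<forall>i<n. F i \<subset> F (Suc i) \<and>
           \<not> (\<exists>H. submodule H R M \<and> F i \<subset> H \<and> H \<subset> F (Suc i))))"

definition finitely_generated :: "('r, 'l) module \<Rightarrow> ('l, 'm) module \<Rightarrow> bool" where
  "finitely_generated L M \<longleftrightarrow>
     (\<exists>A. finite A \<and> A \<subseteq> carrier M \<and>
        (\<forall>N. submodule N L M \<and> A \<subseteq> N \<longrightarrow> N = carrier M))"


section \<open>Pseudocompact rings, algebras and modules\<close>

definition topological_ring :: "('l, 'a) ring_scheme \<Rightarrow> 'l topology \<Rightarrow> bool" where
  "topological_ring L T \<longleftrightarrow> ring L \<and> topspace T = carrier L \<and>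
     continuous_map (prod_topology T T) T (\<lambda>(x, y). x \<oplus>\<^bsub>L\<^esub> y) \<and>
     continuous_map T T (\<lambda>x. \<ominus>\<^bsub>L\<^esub> x) \<and>
     continuous_map (prod_topology T T) T (\<lambda>(x, y). x \<otimes>\<^bsub>L\<^esub> y)"

definition topological_module ::
    "('r, 'l) module \<Rightarrow> 'l topology \<Rightarrow> ('l, 'm) module \<Rightarrow> 'm topology \<Rightarrow> bool" where
  "topological_module L TL M TM \<longleftrightarrow> left_module L M \<and> topspace TM = carrier M \<and>
     continuous_map (prod_topology TM TM) TM (\<lambda>(x, y). x \<oplus>\<^bsub>M\<^esub> y) \<and>
     continuous_map TM TM (\<lambda>x. \<ominus>\<^bsub>M\<^esub> x) \<and>
     continuous_map (prod_topology TL TM) TM (\<lambda>(a, x). a \<odot>\<^bsub>M\<^esub> x)"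

text \<open>Completeness for the additive uniformity: every Cauchy filter converges.\<close>

definition complete_topological_ring :: "('l, 'a) ring_scheme \<Rightarrow> 'l topology \<Rightarrow> bool" where
  "complete_topological_ring L T \<longleftrightarrow>
     (\<forall>F. F \<noteq> bot \<and> F \<le> principal (carrier L) \<and>
        (\<forall>U. openin T U \<and> \<zero>\<^bsub>L\<^esub> \<in> U \<longrightarrow>
           (\<exists>A \<subseteq> carrier L. eventually (\<lambda>x. x \<in> A) F \<and>
              (\<forall>x\<in>A. \<forall>y\<in>A. x \<ominus>\<^bsub>L\<^esub> y \<in> U)))
      \<longrightarrow> (\<exists>l. limitin T (\<lambda>x. x) l F))"

definition comm_pseudocompact_ring :: "'r ring \<Rightarrow> 'r topology \<Rightarrow> bool" where
  "comm_pseudocompact_ring R T \<longleftrightarrow> cring R \<and> topological_ring R T \<and>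
     Hausdorff_space T \<and> complete_topological_ring R T \<and>
     (\<forall>U. openin T U \<and> \<zero>\<^bsub>R\<^esub> \<in> U \<longrightarrow>
        (\<exists>I \<subseteq> U. ideal I R \<and> openin T I \<and> finite_length R (quot_module (regular_module R) I)))"

text \<open>
  For a family \<open>\<N>\<close> of submodules of \<open>M\<close> (directed by reverse inclusion), the limit of the quotients
  \<open>M/N\<close>, \<open>N \<in> \<N>\<close>, as a subspace of the product of the discrete quotients. The transition map
  \<open>M/N \<rightarrow> M/N'\<close> for \<open>N \<subseteq> N'\<close> sends a coset of \<open>N\<close> to the coset of \<open>N'\<close> containing it.
\<close>

definition quotient_limit :: "('l, 'm) module \<Rightarrow> 'm set set \<Rightarrow> ('m set \<Rightarrow> 'm set) set" where
  "quotient_limit M \<N> =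
     {c \<in> (\<Pi>\<^sub>E N\<in>\<N>. a_rcosets\<^bsub>M\<^esub> N). \<forall>N\<in>\<N>. \<forall>N'\<in>\<N>. N \<subseteq> N' \<longrightarrow> c N \<subseteq> c N'}"

definition is_limit_of_quotients :: "('l, 'm) module \<Rightarrow> 'm topology \<Rightarrow> 'm set set \<Rightarrow> bool" where
  "is_limit_of_quotients M T \<N> \<longleftrightarrow>
     homeomorphic_map T
       (subtopology (product_topology (\<lambda>N. discrete_topology (a_rcosets\<^bsub>M\<^esub> N)) \<N>) (quotient_limit M \<N>))
       (\<lambda>x. \<lambda>N\<in>\<N>. N +>\<^bsub>M\<^esub> x)"

definition pseudocompact_algebra :: "'r ring \<Rightarrow> ('r, 'l) module \<Rightarrow> 'l topology \<Rightarrow> bool" where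
  "pseudocompact_algebra R L TL \<longleftrightarrow> assoc_algebra R L \<and> topological_ring L TL \<and>
     is_limit_of_quotients L TL
       {I. ideal I L \<and> openin TL I \<and> finite_length R (quot_module L I)}"

text \<open>
  A topological module which is an inverse limit of modules of finite length over \<open>R\<close> is canonically
  the inverse limit of its own quotients by open submodules that have finite length over \<open>R\<close>.
\<close>

definition pseudocompact_module ::
    "'r ring \<Rightarrow> ('r, 'l) module \<Rightarrow> 'l topology \<Rightarrow> ('l, 'm) module \<Rightarrow> 'm topology \<Rightarrow> bool" where
  "pseudocompact_module R L TL M TM \<longleftrightarrow> topological_module L TL M TM \<and>
     is_limit_of_quotients M TM
       {N. submodule N L M \<and> openin TM N \<and>
           finite_length R (restrict_scalars L (quot_module M N))}"


section \<open>Morphisms, products and direct sums\<close>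

definition continuous_hom ::
    "('r, 'l) module \<Rightarrow> ('l, 'm) module \<Rightarrow> 'm topology \<Rightarrow> ('l, 'n) module \<Rightarrow> 'n topology
      \<Rightarrow> ('m \<Rightarrow> 'n) \<Rightarrow> bool" where
  "continuous_hom L M TM N TN f \<longleftrightarrow>
     f \<in> carrier M \<rightarrow> carrier N \<and>
     (\<forall>x\<in>carrier M. \<forall>y\<in>carrier M. f (x \<oplus>\<^bsub>M\<^esub> y) = f x \<oplus>\<^bsub>N\<^esub> f y) \<and>
     (\<forall>a\<in>carrier L. \<forall>x\<in>carrier M. f (a \<odot>\<^bsub>M\<^esub> x) = a \<odot>\<^bsub>N\<^esub> f x) \<and>
     continuous_map TM TN f"

definition topological_iso ::
    "('r, 'l) module \<Rightarrow> ('l, 'm) module \<Rightarrow> 'm topology \<Rightarrow> ('l, 'n) module \<Rightarrow> 'n topology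
      \<Rightarrow> ('m \<Rightarrow> 'n) \<Rightarrow> bool" where
  "topological_iso L M TM N TN f \<longleftrightarrow> continuous_hom L M TM N TN f \<and>
     (\<exists>g. continuous_hom L N TN M TM g \<and>
        (\<forall>x\<in>carrier M. g (f x) = x) \<and> (\<forall>y\<in>carrier N. f (g y) = y))"

text \<open>The product of \<open>I\<close> copies of \<open>M\<close>; its topology is \<^term>\<open>product_topology (\<lambda>_. TM) I\<close>.\<close>

definition power_module :: "'i set \<Rightarrow> ('l, 'm) module \<Rightarrow> ('l, 'i \<Rightarrow> 'm) module" where
  "power_module I M =
     \<lparr>carrier = (\<Pi>\<^sub>E i\<in>I. carrier M), monoid.mult = undefined, monoid.one = undefined,
      ring.zero = (\<lambda>i\<in>I. \<zero>\<^bsub>M\<^esub>), ring.add = (\<lambda>x y. \<lambda>i\<in>I. x i \<oplus>\<^bsub>M\<^esub> y i),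
      module.smult = (\<lambda>a x. \<lambda>i\<in>I. a \<odot>\<^bsub>M\<^esub> x i)\<rparr>"

definition module_sum :: "('l, 'm) module \<Rightarrow> ('l, 'n) module \<Rightarrow> ('l, 'm \<times> 'n) module" where
  "module_sum M N =
     \<lparr>carrier = carrier M \<times> carrier N, monoid.mult = undefined, monoid.one = undefined,
      ring.zero = (\<zero>\<^bsub>M\<^esub>, \<zero>\<^bsub>N\<^esub>), ring.add = (\<lambda>(x, y) (x', y'). (x \<oplus>\<^bsub>M\<^esub> x', y \<oplus>\<^bsub>N\<^esub> y')),
      module.smult = (\<lambda>a (x, y). (a \<odot>\<^bsub>M\<^esub> x, a \<odot>\<^bsub>N\<^esub> y))\<rparr>"


section \<open>Precovers and covers\<close>

text \<open>
  \<open>in_Add TYPE('i) R L TL M TM S TS\<close>: the pseudocompact module \<open>S\<close> is a direct summand of a product of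
  copies of \<open>M\<close>, the index set being a subset of the type \<open>'i\<close>. A complement of \<open>S\<close> is isomorphic to
  a submodule of the product, so that its elements can be taken from the type \<open>'i \<Rightarrow> 'm\<close>.
\<close>

definition in_Add ::
    "'i itself \<Rightarrow> 'r ring \<Rightarrow> ('r, 'l) module \<Rightarrow> 'l topology \<Rightarrow> ('l, 'm) module \<Rightarrow> 'm topology
      \<Rightarrow> ('l, 's) module \<Rightarrow> 's topology \<Rightarrow> bool" where
  "in_Add (ti :: 'i itself) R L TL M TM S TS \<longleftrightarrow>
     pseudocompact_module R L TL S TS \<and>
     (\<exists>(I :: 'i set) (C :: ('l, 'i \<Rightarrow> 'm) module) TC \<phi>.
        pseudocompact_module R L TL C TC \<and>
        topological_iso L (module_sum S C) (prod_topology TS TC)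
          (power_module I M) (product_topology (\<lambda>_. TM) I) \<phi>)"

text \<open>
  HOL cannot quantify over types inside a formula. The type arguments of the next two definitions are
  the type \<open>'j\<close> of the indices of the product of which \<open>P\<close> is a summand, the type \<open>'s\<close> of the elements
  of the test modules \<open>S\<close>, and the type \<open>'i\<close> of the indices of the product of which \<open>S\<close> is a summand.
\<close>

definition Add_precover ::
    "'j itself \<Rightarrow> 's itself \<Rightarrow> 'i itself
      \<Rightarrow> 'r ring \<Rightarrow> ('r, 'l) module \<Rightarrow> 'l topology \<Rightarrow> ('l, 'm) module \<Rightarrow> 'm topology
      \<Rightarrow> ('l, 'x) module \<Rightarrow> 'x topology \<Rightarrow> ('l, 'p) module \<Rightarrow> 'p topology \<Rightarrow> ('p \<Rightarrow> 'x) \<Rightarrow> bool" where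
  "Add_precover (tj :: 'j itself) (ts :: 's itself) (ti :: 'i itself) R L TL M TM X TX P TP \<rho> \<longleftrightarrow>
     in_Add tj R L TL M TM P TP \<and> continuous_hom L P TP X TX \<rho> \<and>
     (\<forall>(S :: ('l, 's) module) TS \<alpha>.
        in_Add ti R L TL M TM S TS \<and> continuous_hom L S TS X TX \<alpha> \<longrightarrow>
        (\<exists>\<gamma>. continuous_hom L S TS P TP \<gamma> \<and> (\<forall>s\<in>carrier S. \<rho> (\<gamma> s) = \<alpha> s)))"

definition Add_cover ::
    "'j itself \<Rightarrow> 's itself \<Rightarrow> 'i itself
      \<Rightarrow> 'r ring \<Rightarrow> ('r, 'l) module \<Rightarrow> 'l topology \<Rightarrow> ('l, 'm) module \<Rightarrow> 'm topology
      \<Rightarrow> ('l, 'x) module \<Rightarrow> 'x topology \<Rightarrow> ('l, 'p) module \<Rightarrow> 'p topology \<Rightarrow> ('p \<Rightarrow> 'x) \<Rightarrow> bool" where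
  "Add_cover (tj :: 'j itself) (ts :: 's itself) (ti :: 'i itself) R L TL M TM X TX P TP \<rho> \<longleftrightarrow>
     Add_precover tj ts ti R L TL M TM X TX P TP \<rho> \<and>
     (\<forall>\<gamma>. continuous_hom L P TP P TP \<gamma> \<and> (\<forall>p\<in>carrier P. \<rho> (\<gamma> p) = \<rho> p)
        \<longrightarrow> topological_iso L P TP P TP \<gamma>)"

text \<open>
  Types in which a cover of \<open>X\<close> is to be found: the indices of the product of copies of \<open>M\<close>, and the
  elements of the cover, which is isomorphic to a submodule of that product. The index type is large
  enough to label all sets of homomorphisms from \<open>M\<close> to \<open>X\<close>, in particular all open maximal
  \<open>End(M)\<close>-submodules of the module of continuous homomorphisms from \<open>M\<close> to \<open>X\<close>.

  Since the cover must not depend on the types of the test modules, its existence is to be stated as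
  follows: there is a cover \<open>P\<close> in these types, tested against modules in these types, and every such
  \<open>P\<close> is a cover with respect to test modules and index sets in arbitrary types.
\<close>

type_synonym ('m, 'x) cover_index = "(nat \<times> ('m \<Rightarrow> 'x)) set"
type_synonym ('m, 'x) cover_elem = "('m, 'x) cover_index \<Rightarrow> 'm"

end

theory Submission
  imports Defs
begin

text \<open>
  Since \<open>M\<close> is finitely generated, \<open>H(Y) = Hom(M, Y)\<close> is a linearly compact right module over
  \<open>End(M)\<close>, topologised by the submodules \<open>Hom(M, N)\<close> for \<open>N\<close> open in \<open>Y\<close> of finite colength, and
  continuous homomorphisms \<open>M\<^sup>I \<rightarrow> Y\<close> are the same as families in \<open>H(Y)\<close> indexed by \<open>I\<close> that converge to
  zero. By Zorn's lemma and linear compactness, such null families lift along surjections, and \<open>H(X)\<close> is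
  topologically generated by one of them; it gives a precover \<open>\<rho> : P = M\<^sup>I \<rightarrow> X\<close>.

  Let \<open>U\<close> be minimal among the closed submodules of \<open>H(P)\<close> that \<open>\<rho>\<close> maps onto \<open>H(X)\<close>, and \<open>V\<close> minimal
  among the closed submodules of the kernel with \<open>U + V = H(P)\<close>. Splitting the null family of coordinate
  inclusions along \<open>U + V\<close> gives an endomorphism \<open>e\<close> of \<open>P\<close> into \<open>U\<close> congruent to the identity
  modulo \<open>V\<close>. The two minimality conditions force \<open>e\<close> to be idempotent, with \<open>\<rho> e = \<rho>\<close>, and minimality
  of \<open>U\<close> makes every endomorphism of \<open>e P\<close> over \<open>X\<close> an automorphism.
\<close>

section \<open>Subgroups and linearly compact groups with operators\<close>

text \<open>The construction imitates that of projective covers: in a projective module, two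
  submodules that are supplements of each other are direct summands. Here \<open>U\<close> is a
  supplement of the kernel in \<open>H(P)\<close> and \<open>V\<close> a supplement of
  \<open>U\<close>; the coordinate inclusions serve as a topological basis of \<open>H(P)\<close>,
  and the lifting of null families takes the place of projectivity. Supplements exist because linear
  compactness lets images and sums commute with directed intersections of closed submodules, so that
  Zorn's lemma applies downwards. The obstacle is convergence. Lifts chosen one index at a time need
  not tend to zero, and as there may be no countable base of neighbourhoods they cannot be corrected
  along a sequence. Hence nullity is relaxed to nullity modulo a closed submodule \<open>K\<close>,
  and pairs of a \<open>K\<close> and a family are refined by Zorn's lemma until \<open>K\<close> is
  zero. The same device produces the generators of \<open>H(X)\<close>. Finite length enters these
  arguments only through strictly monotone rank functions with values in \<open>nat\<close>.\<close>

definition asub :: "('a, 'b) ring_scheme \<Rightarrow> 'a set \<Rightarrow> bool" where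
  "asub G K \<longleftrightarrow> K \<subseteq> carrier G \<and> \<zero>\<^bsub>G\<^esub> \<in> K \<and> (\<forall>x\<in>K. \<forall>y\<in>K. x \<ominus>\<^bsub>G\<^esub> y \<in> K)"

text \<open>Written through differences, so that membership is a condition on a single subtraction;
  \<open>rcoset_coset_of\<close> gives the agreement with the cosets of HOL-Algebra.\<close>

definition coset_of :: "('a, 'b) ring_scheme \<Rightarrow> 'a \<Rightarrow> 'a set \<Rightarrow> 'a set" where
  "coset_of G c K = {y \<in> carrier G. y \<ominus>\<^bsub>G\<^esub> c \<in> K}"

text \<open>The sum K + W, in the form in which it occurs: \<open>z\<close> is approximated by an
  element of \<open>K\<close> up to an error in \<open>W\<close>.\<close>

definition ssum :: "('a, 'b) ring_scheme \<Rightarrow> 'a set \<Rightarrow> 'a set \<Rightarrow> 'a set" where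
  "ssum G K W = {z \<in> carrier G. \<exists>k\<in>K. z \<ominus>\<^bsub>G\<^esub> k \<in> W}"

context abelian_group
begin

lemma neg_zero [simp]: "\<ominus> \<zero> = \<zero>"
  by (rule minus_equality) simp_all

lemma diff_zero [simp]: "x \<in> carrier G \<Longrightarrow> x \<ominus> \<zero> = x"
  by (simp add: minus_eq)

lemma diff_self [simp]: "x \<in> carrier G \<Longrightarrow> x \<ominus> x = \<zero>"
  by (simp add: minus_eq r_neg)

text \<open>Rewriting with associativity and commutativity can leave other summands between
  \<open>x\<close> and its negative. The four rules cover the distances that occur and complete the
  simplification set \<open>agr\<close>, which normalises differences.\<close>

lemma cancel1: "\<lbrakk>x \<in> carrier G; y \<in> carrier G\<rbrakk> \<Longrightarrow> x \<oplus> (y \<oplus> \<ominus> x) = y"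
  by (metis a_comm a_inv_closed r_neg2)

lemma cancel2: "\<lbrakk>x \<in> carrier G; y \<in> carrier G; z \<in> carrier G\<rbrakk> \<Longrightarrow> x \<oplus> (y \<oplus> (\<ominus> x \<oplus> z)) = y \<oplus> z"
  by (metis a_lcomm a_inv_closed r_neg2 a_closed)

lemma cancel3: "\<lbrakk>x \<in> carrier G; y \<in> carrier G; z \<in> carrier G\<rbrakk> \<Longrightarrow> x \<oplus> (y \<oplus> (z \<oplus> \<ominus> x)) = y \<oplus> z"
  by (metis a_assoc cancel1 a_closed a_inv_closed)

lemma cancel4: "\<lbrakk>x \<in> carrier G; y \<in> carrier G; z \<in> carrier G; w \<in> carrier G\<rbrakk>
    \<Longrightarrow> x \<oplus> (y \<oplus> (z \<oplus> (\<ominus> x \<oplus> w))) = y \<oplus> (z \<oplus> w)"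
  by (metis a_assoc cancel2 a_closed a_inv_closed)

lemmas agr = minus_eq a_ac minus_add minus_minus r_neg l_neg r_neg1 r_neg2 cancel1 cancel2 cancel3 cancel4

lemma asub_subset: "asub G K \<Longrightarrow> x \<in> K \<Longrightarrow> x \<in> carrier G"
  and asub_zero: "asub G K \<Longrightarrow> \<zero> \<in> K"
  and asub_diff: "asub G K \<Longrightarrow> x \<in> K \<Longrightarrow> y \<in> K \<Longrightarrow> x \<ominus> y \<in> K"
  by (auto simp: asub_def)

lemma asub_neg: "asub G K \<Longrightarrow> x \<in> K \<Longrightarrow> \<ominus> x \<in> K"
  using asub_diff[of K \<zero> x] asub_zero[of K] asub_subset[of K x] by (simp add: agr)

lemma asub_add: "asub G K \<Longrightarrow> x \<in> K \<Longrightarrow> y \<in> K \<Longrightarrow> x \<oplus> y \<in> K"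
  using asub_diff[of K x "\<ominus> y"] asub_neg[of K y] asub_subset[of K x] asub_subset[of K y] by (simp add: agr)

lemma asub_subgroup: "asub G K \<longleftrightarrow> subgroup K (add_monoid G)"
proof
  assume K: "asub G K"
  show "subgroup K (add_monoid G)"
    using K by (intro subgroup.intro) (auto simp: asub_subset asub_zero asub_add asub_neg simp flip: a_inv_def)
next
  assume "subgroup K (add_monoid G)"
  then show "asub G K"
    by (auto simp: asub_def subgroup_def a_inv_def a_minus_def)
qed

lemma asub_carrier: "asub G (carrier G)"
  by (simp add: asub_def)

lemma asub_singleton: "asub G {\<zero>}"
  by (simp add: asub_def)

lemma asub_Int: "asub G K \<Longrightarrow> asub G K' \<Longrightarrow> asub G (K \<inter> K')"
  by (auto simp: asub_def)

lemma diff_sym: "asub G K \<Longrightarrow> x \<ominus> y \<in> K \<Longrightarrow> x \<in> carrier G \<Longrightarrow> y \<in> carrier G \<Longrightarrow> y \<ominus> x \<in> K"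
  using asub_neg[of K "x \<ominus> y"] by (simp add: agr)

lemma diff_trans: "asub G K \<Longrightarrow> x \<ominus> y \<in> K \<Longrightarrow> y \<ominus> z \<in> K \<Longrightarrow> x \<in> carrier G \<Longrightarrow> y \<in> carrier G
    \<Longrightarrow> z \<in> carrier G \<Longrightarrow> x \<ominus> z \<in> K"
  using asub_add[of K "x \<ominus> y" "y \<ominus> z"] by (simp add: agr)

lemma diff_mem: "asub G K \<Longrightarrow> x \<ominus> y \<in> K \<Longrightarrow> y \<in> K \<Longrightarrow> x \<in> carrier G \<Longrightarrow> x \<in> K"
  using asub_add[of K "x \<ominus> y" y] asub_subset[of K y] by (simp add: agr)

lemma diff_mem': "asub G K \<Longrightarrow> x \<ominus> y \<in> K \<Longrightarrow> x \<in> K \<Longrightarrow> y \<in> carrier G \<Longrightarrow> y \<in> K"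
  using asub_diff[of K x "x \<ominus> y"] asub_subset[of K x] by (simp add: agr)

lemma diff_add2: "asub G K \<Longrightarrow> x \<ominus> y \<in> K \<Longrightarrow> x' \<ominus> y' \<in> K \<Longrightarrow> x \<in> carrier G \<Longrightarrow> y \<in> carrier G
    \<Longrightarrow> x' \<in> carrier G \<Longrightarrow> y' \<in> carrier G \<Longrightarrow> (x \<oplus> x') \<ominus> (y \<oplus> y') \<in> K"
  using asub_add[of K "x \<ominus> y" "x' \<ominus> y'"] by (simp add: agr)

lemma diff_diff2: "asub G K \<Longrightarrow> x \<ominus> y \<in> K \<Longrightarrow> x' \<ominus> y' \<in> K \<Longrightarrow> x \<in> carrier G \<Longrightarrow> y \<in> carrier G
    \<Longrightarrow> x' \<in> carrier G \<Longrightarrow> y' \<in> carrier G \<Longrightarrow> (x \<ominus> x') \<ominus> (y \<ominus> y') \<in> K"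
  using asub_diff[of K "x \<ominus> y" "x' \<ominus> y'"] by (simp add: agr)

lemma asub_ssum:
  assumes K: "asub G K" and W: "asub G W"
  shows "asub G (ssum G K W)"
  unfolding asub_def
proof (intro conjI ballI)
  show "ssum G K W \<subseteq> carrier G" by (auto simp: ssum_def)
  show "\<zero> \<in> ssum G K W"
    using asub_zero[OF K] asub_zero[OF W] by (auto simp: ssum_def intro!: bexI[of _ \<zero>])
  fix x y assume x: "x \<in> ssum G K W" and y: "y \<in> ssum G K W"
  then obtain k l where k: "k \<in> K" "x \<ominus> k \<in> W" and l: "l \<in> K" "y \<ominus> l \<in> W" and c: "x \<in> carrier G" "y \<in> carrier G"
    by (auto simp: ssum_def)
  then have "(x \<ominus> y) \<ominus> (k \<ominus> l) \<in> W"
    using diff_diff2[OF W] asub_subset[OF K] by blast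
  then show "x \<ominus> y \<in> ssum G K W"
    using c asub_diff[OF K] k l by (auto simp: ssum_def)
qed

lemma ssum_left: "asub G K \<Longrightarrow> asub G W \<Longrightarrow> K \<subseteq> ssum G K W"
  using asub_zero[of W] by (auto simp: ssum_def asub_subset intro!: bexI)

lemma ssum_right: "asub G K \<Longrightarrow> asub G W \<Longrightarrow> W \<subseteq> ssum G K W"
  using asub_zero[of K] by (auto simp: ssum_def asub_subset intro!: bexI[of _ \<zero>])

lemma ssum_mono: "K \<subseteq> K' \<Longrightarrow> W \<subseteq> W' \<Longrightarrow> ssum G K W \<subseteq> ssum G K' W'"
  by (auto simp: ssum_def)

lemma coset_of_eq:
  assumes "asub G K" "c \<in> carrier G" "d \<in> coset_of G c K"
  shows "coset_of G c K = coset_of G d K"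
proof -
  have d: "d \<in> carrier G" "d \<ominus> c \<in> K" using assms(3) by (auto simp: coset_of_def)
  with assms have "c \<ominus> d \<in> K" by (meson diff_sym)
  then have "y \<ominus> c \<in> K \<longleftrightarrow> y \<ominus> d \<in> K" if "y \<in> carrier G" for y
    using d assms(2) that diff_trans[OF assms(1), of y c d] diff_trans[OF assms(1), of y d c] by auto
  then show ?thesis by (auto simp: coset_of_def)
qed

lemma asub_vimage:
  assumes "asub G U" "abelian_group B" "asub B V"
    and f: "\<And>x. x \<in> carrier G \<Longrightarrow> f x \<in> carrier B"
    and fa: "\<And>x y. x \<in> carrier G \<Longrightarrow> y \<in> carrier G \<Longrightarrow> f (x \<ominus> y) = f x \<ominus>\<^bsub>B\<^esub> f y"
  shows "asub G {u \<in> U. f u \<in> V}"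
proof -
  interpret B: abelian_group B by fact
  have "f \<zero> = f (\<zero> \<ominus> \<zero>)" by simp
  also have "\<dots> = \<zero>\<^bsub>B\<^esub>" by (subst fa) (simp_all add: f)
  finally have "f \<zero> \<in> V" using B.asub_zero assms(3) by simp
  then show ?thesis
    using assms(1,3) by (auto simp: asub_def fa subset_iff)
qed

lemma add_map_diff:
  assumes "abelian_group B"
    and f: "\<And>x. x \<in> carrier G \<Longrightarrow> f x \<in> carrier B"
    and fa: "\<And>x y. x \<in> carrier G \<Longrightarrow> y \<in> carrier G \<Longrightarrow> f (x \<oplus> y) = f x \<oplus>\<^bsub>B\<^esub> f y"
    and x: "x \<in> carrier G" "y \<in> carrier G"
  shows "f (x \<ominus> y) = f x \<ominus>\<^bsub>B\<^esub> f y"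
proof -
  interpret B: abelian_group B by fact
  have "f x = f ((x \<ominus> y) \<oplus> y)" using x by (simp add: agr)
  also have "\<dots> = f (x \<ominus> y) \<oplus>\<^bsub>B\<^esub> f y" using x by (simp add: fa)
  finally show ?thesis using x by (simp add: B.agr f)
qed

end

text \<open>\<open>E\<close> is a bare set of additive operators. This covers both Hom(M, Y) under
  precomposition with endomorphisms of M and modules under the scalars of R, so that subgroups and
  lengths are treated once for both.\<close>

locale op_group = abelian_group H for H :: "('h, 'b) ring_scheme" (structure) +
  fixes E :: "'e set" and act :: "'e \<Rightarrow> 'h \<Rightarrow> 'h"
  assumes act_closed: "\<lbrakk>e \<in> E; x \<in> carrier H\<rbrakk> \<Longrightarrow> act e x \<in> carrier H"
    and act_add: "\<lbrakk>e \<in> E; x \<in> carrier H; y \<in> carrier H\<rbrakk> \<Longrightarrow> act e (x \<oplus> y) = act e x \<oplus> act e y"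
begin

definition esub :: "'h set \<Rightarrow> bool" where
  "esub K \<longleftrightarrow> asub H K \<and> (\<forall>e\<in>E. \<forall>x\<in>K. act e x \<in> K)"

lemma act_diff: "\<lbrakk>e \<in> E; x \<in> carrier H; y \<in> carrier H\<rbrakk> \<Longrightarrow> act e (x \<ominus> y) = act e x \<ominus> act e y"
  by (rule add_map_diff) (auto simp: act_closed act_add abelian_group_axioms)

lemma act_zero: "e \<in> E \<Longrightarrow> act e \<zero> = \<zero>"
  using act_diff[of e \<zero> \<zero>] act_closed[of e \<zero>] by simp

lemma esub_asub: "esub K \<Longrightarrow> asub H K"
  by (simp add: esub_def)

lemma esub_act: "esub K \<Longrightarrow> e \<in> E \<Longrightarrow> x \<in> K \<Longrightarrow> act e x \<in> K"
  by (simp add: esub_def)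

lemma esub_carrier: "esub (carrier H)"
  by (simp add: esub_def asub_carrier act_closed)

lemma esub_singleton: "esub {\<zero>}"
  by (simp add: esub_def asub_singleton act_zero)

lemma esub_Int: "esub K \<Longrightarrow> esub K' \<Longrightarrow> esub (K \<inter> K')"
  by (simp add: esub_def asub_Int)

lemma esub_Inter: "\<K> \<noteq> {} \<Longrightarrow> (\<And>K. K \<in> \<K> \<Longrightarrow> esub K) \<Longrightarrow> esub (\<Inter>\<K>)"
  unfolding esub_def asub_def by (intro conjI) (blast | auto)+

lemma esub_ssum: "esub K \<Longrightarrow> esub W \<Longrightarrow> esub (ssum H K W)"
  unfolding esub_def
proof (intro conjI ballI)
  fix e x assume K: "asub H K \<and> (\<forall>e\<in>E. \<forall>x\<in>K. act e x \<in> K)" and W: "asub H W \<and> (\<forall>e\<in>E. \<forall>x\<in>W. act e x \<in> W)"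
    and e: "e \<in> E" and x: "x \<in> ssum H K W"
  from x obtain k where k: "x \<in> carrier H" "k \<in> K" "x \<ominus> k \<in> W" by (auto simp: ssum_def)
  moreover have "k \<in> carrier H" using K k asub_subset by blast
  ultimately have "act e x \<ominus> act e k \<in> W" using W e act_diff[of e x k] by metis
  then show "act e x \<in> ssum H K W" using K e k by (auto simp: ssum_def act_closed)
qed (auto intro: asub_ssum)

end

text \<open>The working form of linear compactness: a directed separated base of stable subgroups,
  complete, with quotients of finite length. \<open>W_length\<close> expresses the last point by a
  rank that grows strictly on stable subgroups above \<open>W\<close>; it is bounded by the rank of
  the carrier, so both minimal and maximal choices can be made with it.\<close>

locale lin_compact = op_group H E act for H :: "('h, 'b) ring_scheme" (structure) and E :: "'e set" and act +
  fixes \<W> :: "'h set set"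
  assumes W_ne: "\<W> \<noteq> {}"
    and W_esub: "W \<in> \<W> \<Longrightarrow> esub W"
    and W_dir: "W \<in> \<W> \<Longrightarrow> W' \<in> \<W> \<Longrightarrow> \<exists>W''\<in>\<W>. W'' \<subseteq> W \<inter> W'"
    and W_sep: "x \<in> carrier H \<Longrightarrow> (\<And>W. W \<in> \<W> \<Longrightarrow> x \<in> W) \<Longrightarrow> x = \<zero>"
    and W_complete: "\<And>a. (\<And>W. W \<in> \<W> \<Longrightarrow> a W \<in> carrier H) \<Longrightarrow>
      (\<And>W W'. W \<in> \<W> \<Longrightarrow> W' \<in> \<W> \<Longrightarrow> W \<subseteq> W' \<Longrightarrow> a W \<ominus> a W' \<in> W') \<Longrightarrow>
      \<exists>x\<in>carrier H. \<forall>W\<in>\<W>. x \<ominus> a W \<in> W"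
    and W_length: "W \<in> \<W> \<Longrightarrow>
      \<exists>len::'h set \<Rightarrow> nat. \<forall>A B. esub A \<and> esub B \<and> W \<subseteq> A \<and> A \<subset> B \<longrightarrow> len A < len B"
begin

text \<open>The topology with base \<open>\<W>\<close> at zero is never formed. Openness and
  closedness are needed for stable subgroups only: open means containing a member of the base, and
  \<open>clsd\<close> below says that K is the intersection of all K + W, which is its
  closure.\<close>

definition opn :: "'h set \<Rightarrow> bool" where
  "opn W \<longleftrightarrow> esub W \<and> (\<exists>W0\<in>\<W>. W0 \<subseteq> W)"

definition clsd :: "'h set \<Rightarrow> bool" where
  "clsd K \<longleftrightarrow> esub K \<and> (\<forall>x\<in>carrier H. (\<forall>W\<in>\<W>. x \<in> ssum H K W) \<longrightarrow> x \<in> K)"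

definition ccoset :: "'h set \<Rightarrow> bool" where
  "ccoset C \<longleftrightarrow> (\<exists>c\<in>carrier H. \<exists>K. clsd K \<and> C = coset_of H c K)"

lemma W_asub: "W \<in> \<W> \<Longrightarrow> asub H W"
  by (simp add: W_esub esub_asub)

lemma clsd_esub: "clsd K \<Longrightarrow> esub K"
  by (simp add: clsd_def)

lemma clsd_asub: "clsd K \<Longrightarrow> asub H K"
  by (simp add: clsd_def esub_asub)

lemma clsdI: "esub K \<Longrightarrow> (\<And>x. x \<in> carrier H \<Longrightarrow> (\<And>W. W \<in> \<W> \<Longrightarrow> x \<in> ssum H K W) \<Longrightarrow> x \<in> K) \<Longrightarrow> clsd K"
  by (auto simp: clsd_def)

lemma clsdD: "clsd K \<Longrightarrow> x \<in> carrier H \<Longrightarrow> (\<And>W. W \<in> \<W> \<Longrightarrow> x \<in> ssum H K W) \<Longrightarrow> x \<in> K"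
  by (auto simp: clsd_def)

lemma opn_esub: "opn W \<Longrightarrow> esub W"
  by (simp add: opn_def)

lemma opn_asub: "opn W \<Longrightarrow> asub H W"
  by (simp add: opn_def esub_asub)

lemma W_opn: "W \<in> \<W> \<Longrightarrow> opn W"
  by (auto simp: opn_def W_esub)

lemma opn_mono: "opn W \<Longrightarrow> esub K \<Longrightarrow> W \<subseteq> K \<Longrightarrow> opn K"
  by (auto simp: opn_def)

lemma opn_carrier: "opn (carrier H)"
proof -
  from W_ne obtain W where W: "W \<in> \<W>" by blast
  then have "W \<subseteq> carrier H" using W_asub asub_subset by blast
  with W show ?thesis using esub_carrier by (auto simp: opn_def)
qed

lemma opn_ssum: "esub K \<Longrightarrow> opn W \<Longrightarrow> opn (ssum H K W)"
  by (rule opn_mono[where W=W]) (auto intro: esub_ssum opn_esub ssum_right[THEN subsetD] esub_asub)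

lemma opn_Int: "opn W \<Longrightarrow> opn W' \<Longrightarrow> opn (W \<inter> W')"
proof -
  assume a: "opn W" "opn W'"
  then obtain W1 W2 where w: "W1 \<in> \<W>" "W2 \<in> \<W>" "W1 \<subseteq> W" "W2 \<subseteq> W'" by (auto simp: opn_def)
  with W_dir obtain W3 where "W3 \<in> \<W>" "W3 \<subseteq> W1 \<inter> W2" by meson
  then have "W3 \<subseteq> W \<inter> W'" using w by blast
  then show ?thesis unfolding opn_def using \<open>W3 \<in> \<W>\<close> a by (blast intro: esub_Int opn_esub)
qed

lemma opn_clsd: "opn W \<Longrightarrow> clsd W"
proof (rule clsdI)
  assume W: "opn W"
  then show "esub W" by (rule opn_esub)
  fix x assume x: "x \<in> carrier H" and *: "\<And>W'. W' \<in> \<W> \<Longrightarrow> x \<in> ssum H W W'"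
  from W obtain W0 where W0: "W0 \<in> \<W>" "W0 \<subseteq> W" by (auto simp: opn_def)
  from *[OF W0(1)] obtain k where "k \<in> W" "x \<ominus> k \<in> W0" by (auto simp: ssum_def)
  then show "x \<in> W" using W0 diff_mem[OF opn_asub[OF W]] x by blast
qed

lemma clsd_carrier: "clsd (carrier H)"
  by (rule opn_clsd[OF opn_carrier])

lemma clsd_singleton: "clsd {\<zero>}"
  by (rule clsdI[OF esub_singleton]) (use W_sep in \<open>fastforce simp: ssum_def\<close>)

lemma clsd_Inter:
  assumes "\<K> \<noteq> {}" "\<And>K. K \<in> \<K> \<Longrightarrow> clsd K"
  shows "clsd (\<Inter>\<K>)"
proof (rule clsdI)
  show "esub (\<Inter>\<K>)" using assms clsd_esub by (auto intro!: esub_Inter)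
  fix x assume x: "x \<in> carrier H" and *: "\<And>W. W \<in> \<W> \<Longrightarrow> x \<in> ssum H (\<Inter>\<K>) W"
  show "x \<in> \<Inter>\<K>"
  proof
    fix K assume K: "K \<in> \<K>"
    show "x \<in> K"
    proof (rule clsdD[OF assms(2)[OF K] x])
      fix W assume "W \<in> \<W>"
      with * have "x \<in> ssum H (\<Inter>\<K>) W" by blast
      then show "x \<in> ssum H K W" using K by (auto simp: ssum_def)
    qed
  qed
qed

lemma clsd_Int: "clsd K \<Longrightarrow> clsd K' \<Longrightarrow> clsd (K \<inter> K')"
  using clsd_Inter[of "{K, K'}"] by auto

lemma ccosetI: "c \<in> carrier H \<Longrightarrow> clsd K \<Longrightarrow> C = coset_of H c K \<Longrightarrow> ccoset C"
  by (auto simp: ccoset_def)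

lemma opn_length:
  assumes "opn W"
  shows "\<exists>len::'h set \<Rightarrow> nat. \<forall>A B. esub A \<and> esub B \<and> W \<subseteq> A \<and> A \<subset> B \<longrightarrow> len A < len B"
proof -
  from assms obtain W0 where "W0 \<in> \<W>" "W0 \<subseteq> W" by (auto simp: opn_def)
  with W_length[of W0] show ?thesis by (meson order_trans)
qed

end

context abelian_group
begin

lemma coset_of_Int:
  assumes "asub G K" "asub G L" "c \<in> carrier G" "d \<in> carrier G" "x \<in> coset_of G c K" "x \<in> coset_of G d L"
  shows "coset_of G c K \<inter> coset_of G d L = coset_of G x (K \<inter> L)"
  using coset_of_eq[OF assms(1,3,5)] coset_of_eq[OF assms(2,4,6)] by (auto simp: coset_of_def)

lemma coset_of_self: "asub G K \<Longrightarrow> c \<in> carrier G \<Longrightarrow> c \<in> coset_of G c K"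
  by (simp add: coset_of_def asub_zero)

lemma coset_of_subset: "K \<subseteq> L \<Longrightarrow> coset_of G c K \<subseteq> coset_of G c L"
  by (auto simp: coset_of_def)

end

text \<open>Every member can be rebased at the common point \<open>d\<close>, after which only the
  subgroups have to be intersected. The factor \<open>carrier H\<close> gives the empty family its
  proper meaning.\<close>

lemma (in op_group) finite_Inter_cosets:
  assumes "finite F" "\<And>D. D \<in> F \<Longrightarrow> \<exists>c\<in>carrier H. \<exists>K. esub K \<and> D = coset_of H c K"
    and "d \<in> carrier H" "d \<in> \<Inter>F"
  shows "\<exists>L. esub L \<and> carrier H \<inter> \<Inter>F = coset_of H d L"
  using assms
proof (induction F rule: finite_induct)
  case empty
  then show ?case by (intro exI[of _ "carrier H"]) (auto simp: coset_of_def esub_carrier)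
next
  case (insert D F)
  then obtain L where L: "esub L" "carrier H \<inter> \<Inter>F = coset_of H d L" by auto
  from insert.prems obtain c K where c: "c \<in> carrier H" "esub K" "D = coset_of H c K" by blast
  have "coset_of H c K \<inter> coset_of H d L = coset_of H d (K \<inter> L)"
    using insert.prems c L by (intro coset_of_Int coset_of_self) (auto simp: esub_asub)
  then show ?case using L c by (intro exI[of _ "K \<inter> L"]) (auto simp: esub_Int)
qed

text \<open>
  A maximal family of cosets with the finite intersection property contains,
  for every \<open>W \<in> \<W>\<close>, a coset of \<open>W\<close>: otherwise pick a member saturated by \<open>W\<close> of least length.
  Completeness produces a point from these cosets.
\<close>

lemma (in lin_compact) directed_ccosets:
  assumes ne: "\<C> \<noteq> {}" and cc: "\<And>C. C \<in> \<C> \<Longrightarrow> ccoset C"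
    and dir: "\<And>C D. C \<in> \<C> \<Longrightarrow> D \<in> \<C> \<Longrightarrow> \<exists>C'\<in>\<C>. C' \<subseteq> C \<inter> D"
  shows "\<exists>x. x \<in> carrier H \<and> x \<in> \<Inter>\<C>"
proof -
  define cos where "cos = {D. \<exists>c\<in>carrier H. \<exists>K. esub K \<and> D = coset_of H c K}"
  define fip where "fip M \<longleftrightarrow> M \<subseteq> cos \<and> (\<forall>F. F \<subseteq> M \<and> finite F \<longrightarrow> carrier H \<inter> \<Inter>F \<noteq> {})" for M
  have ne': "C \<noteq> {}" "C \<subseteq> carrier H" "C \<in> cos" if "C \<in> \<C>" for C
  proof -
    from cc[OF that] obtain c K where c: "c \<in> carrier H" "clsd K" "C = coset_of H c K" by (auto simp: ccoset_def)
    then show "C \<noteq> {}" using coset_of_self[OF clsd_asub] by blast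
    show "C \<subseteq> carrier H" using c by (auto simp: coset_of_def)
    show "C \<in> cos" using c clsd_esub by (auto simp: cos_def)
  qed
  have sub: "\<exists>C\<in>\<C>. C \<subseteq> \<Inter>F" if "finite F" "F \<subseteq> \<C>" for F
    using that
  proof (induction F rule: finite_induct)
    case empty then show ?case using ne by auto
  next
    case (insert D F)
    then obtain C where C: "C \<in> \<C>" "C \<subseteq> \<Inter>F" by auto
    with dir[of D C] insert.prems obtain C' where "C' \<in> \<C>" "C' \<subseteq> D \<inter> C" by auto
    with C show ?case by (intro bexI[of _ C']) auto
  qed
  have fipC: "fip \<C>"
    unfolding fip_def using ne' sub by (metis Int_subset_iff subset_empty subsetI)
  define \<A> where "\<A> = {M. \<C> \<subseteq> M \<and> fip M}"
  have "\<exists>M\<in>\<A>. \<forall>X\<in>\<A>. M \<subseteq> X \<longrightarrow> X = M"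
  proof (rule subset_Zorn_nonempty)
    show "\<A> \<noteq> {}" using fipC by (auto simp: \<A>_def)
    fix S assume S: "S \<noteq> {}" "subset.chain \<A> S"
    then have SA: "S \<subseteq> \<A>" by (auto simp: subset.chain_def)
    have "carrier H \<inter> \<Inter>F \<noteq> {}" if F: "F \<subseteq> \<Union>S" "finite F" for F
    proof -
      from finite_subset_Union_chain[OF F(2,1) S] obtain B where "B \<in> S" "F \<subseteq> B" by blast
      with SA F(2) show ?thesis by (auto simp: \<A>_def fip_def)
    qed
    moreover have "\<C> \<subseteq> \<Union>S" "\<Union>S \<subseteq> cos" using S(1) SA unfolding \<A>_def fip_def by blast+
    ultimately show "\<Union>S \<in> \<A>" by (auto simp: \<A>_def fip_def)
  qed
  then obtain M where M: "M \<in> \<A>" "\<And>X. X \<in> \<A> \<Longrightarrow> M \<subseteq> X \<Longrightarrow> X = M" by blast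
  then have CM: "\<C> \<subseteq> M" and fipM: "fip M" by (auto simp: \<A>_def)
  have fipD: "\<exists>x. x \<in> carrier H \<and> x \<in> \<Inter>F" if "F \<subseteq> M" "finite F" for F
  proof -
    have "carrier H \<inter> \<Inter>F \<noteq> {}" using fipM that unfolding fip_def by simp
    then show ?thesis by blast
  qed
  have max: "D \<in> M" if D: "D \<in> cos" "\<And>F. F \<subseteq> M \<Longrightarrow> finite F \<Longrightarrow> carrier H \<inter> \<Inter>F \<inter> D \<noteq> {}" for D
  proof -
    have "carrier H \<inter> \<Inter>F \<noteq> {}" if F: "F \<subseteq> insert D M" "finite F" for F
    proof -
      have "carrier H \<inter> \<Inter>(F - {D}) \<inter> D \<noteq> {}" using F by (intro D(2)) auto
      then show ?thesis by blast
    qed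
    then have "insert D M \<in> \<A>" using M(1) D(1) by (auto simp: \<A>_def fip_def)
    from M(2)[OF this] show ?thesis by blast
  qed
  have pt: "\<exists>a\<in>carrier H. coset_of H a W \<in> M" if W: "W \<in> \<W>" for W
  proof -
    from W_length[OF W] obtain len :: "'h set \<Rightarrow> nat"
      where len: "\<And>A B. esub A \<Longrightarrow> esub B \<Longrightarrow> W \<subseteq> A \<Longrightarrow> A \<subset> B \<Longrightarrow> len A < len B" by blast
    define Q where "Q = (\<lambda>(c, K). c \<in> carrier H \<and> esub K \<and> W \<subseteq> K \<and> coset_of H c K \<in> M)"
    have "carrier H = coset_of H \<zero> (carrier H)" by (auto simp: coset_of_def)
    then have "carrier H \<in> cos" using esub_carrier by (auto simp: cos_def)
    then have "carrier H \<in> M" using fipM by (intro max) (auto simp: fip_def Int_ac)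
    then have "Q (\<zero>, carrier H)"
      using asub_subset[OF W_asub[OF W]] \<open>carrier H = _\<close> by (auto simp: Q_def esub_carrier)
    from ex_has_least_nat[of Q, OF this, of "len \<circ> snd"]
    obtain c K where cK: "c \<in> carrier H" "esub K" "W \<subseteq> K" "coset_of H c K \<in> M"
      and least: "\<And>d L. d \<in> carrier H \<Longrightarrow> esub L \<Longrightarrow> W \<subseteq> L \<Longrightarrow> coset_of H d L \<in> M \<Longrightarrow> len K \<le> len L"
      by (auto simp: Q_def)
    have "coset_of H c W \<in> M"
    proof (rule max)
      show "coset_of H c W \<in> cos" using cK W_esub[OF W] by (auto simp: cos_def)
      fix F assume F: "F \<subseteq> M" "finite F"
      \<comment> \<open>Adjoining the coset of least rank forces the direction \<open>L\<close> of
        the intersection into \<open>K\<close>. Minimality then yields L + W = K, so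
        \<open>c\<close> differs from a point d + l of the intersection by an element of
        \<open>W\<close>.\<close>
      let ?F = "insert (coset_of H c K) F"
      have "?F \<subseteq> M" "finite ?F" using F cK by auto
      then obtain d where d: "d \<in> carrier H" "d \<in> \<Inter>?F" using fipD by blast
      have "\<And>D. D \<in> ?F \<Longrightarrow> \<exists>c\<in>carrier H. \<exists>K. esub K \<and> D = coset_of H c K"
      proof -
        fix D assume "D \<in> ?F"
        then have "D \<in> cos" using fipM \<open>?F \<subseteq> M\<close> unfolding fip_def by (meson subsetD)
        then show "\<exists>c\<in>carrier H. \<exists>K. esub K \<and> D = coset_of H c K" by (simp only: cos_def mem_Collect_eq)
      qed
      from finite_Inter_cosets[OF \<open>finite ?F\<close> this d]
      obtain L where L: "esub L" "carrier H \<inter> \<Inter>?F = coset_of H d L" by blast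
      have dK: "coset_of H c K = coset_of H d K"
        by (rule coset_of_eq[OF esub_asub[OF cK(2)] cK(1)]) (use d in blast)
      have LK: "L \<subseteq> K"
      proof
        fix l assume l: "l \<in> L"
        then have lc: "l \<in> carrier H" by (rule asub_subset[OF esub_asub[OF L(1)]])
        then have "d \<oplus> l \<in> coset_of H d L" using l d(1) by (simp add: coset_of_def agr)
        then have "d \<oplus> l \<in> coset_of H d K" using L(2) dK by blast
        then show "l \<in> K" using lc d(1) by (simp add: coset_of_def agr)
      qed
      define K' where "K' = ssum H L W"
      have K': "esub K'" "W \<subseteq> K'" "K' \<subseteq> K"
      proof -
        show "esub K'" unfolding K'_def using L(1) W_esub[OF W] by (rule esub_ssum)
        show "W \<subseteq> K'" unfolding K'_def using L(1) W_asub[OF W] esub_asub by (intro ssum_right) auto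
        show "K' \<subseteq> K" using LK cK(2,3) diff_mem[OF esub_asub[OF cK(2)]] by (auto simp: K'_def ssum_def)
      qed
      have "coset_of H d K' \<in> M"
      proof (rule max)
        show "coset_of H d K' \<in> cos" using d K' by (auto simp: cos_def)
        fix G assume G: "G \<subseteq> M" "finite G"
        then have "G \<union> ?F \<subseteq> M" "finite (G \<union> ?F)" using \<open>?F \<subseteq> M\<close> \<open>finite ?F\<close> by auto
        from fipD[OF this] obtain y where y: "y \<in> carrier H" "y \<in> \<Inter>G" "y \<in> \<Inter>?F" by auto
        then have "y \<in> coset_of H d L" using L(2) by blast
        moreover have "L \<subseteq> K'" unfolding K'_def using L(1) W_asub[OF W] esub_asub by (intro ssum_left) auto
        ultimately have "y \<in> coset_of H d K'" using coset_of_subset by blast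
        with y show "carrier H \<inter> \<Inter>G \<inter> coset_of H d K' \<noteq> {}" by blast
      qed
      then have "len K \<le> len K'" using least d K' by blast
      then have "K' = K" using len[OF K'(1) cK(2) K'(2)] K'(3) by fastforce
      have "c \<in> coset_of H d K'" using \<open>K' = K\<close> dK coset_of_self[OF esub_asub[OF cK(2)] cK(1)] by simp
      then obtain l where l: "l \<in> L" "(c \<ominus> d) \<ominus> l \<in> W" by (auto simp: coset_of_def K'_def ssum_def)
      have lc: "l \<in> carrier H" by (rule asub_subset[OF esub_asub[OF L(1)] l(1)])
      have "d \<oplus> l \<in> coset_of H d L" using l lc d(1) by (simp add: coset_of_def agr)
      then have 1: "d \<oplus> l \<in> \<Inter>F" using L(2) by blast
      have "c \<ominus> (d \<oplus> l) \<in> W" using l(2) lc d(1) cK(1) by (simp add: agr)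
      then have "(d \<oplus> l) \<ominus> c \<in> W" using diff_sym[OF W_asub[OF W]] lc d(1) cK(1) by simp
      then show "carrier H \<inter> \<Inter>F \<inter> coset_of H c W \<noteq> {}" using 1 lc d(1) by (auto simp: coset_of_def)
    qed
    then show ?thesis using cK(1) by blast
  qed
  then obtain a where a: "\<And>W. W \<in> \<W> \<Longrightarrow> a W \<in> carrier H" "\<And>W. W \<in> \<W> \<Longrightarrow> coset_of H (a W) W \<in> M" by metis
  have pair: "\<exists>y\<in>carrier H. y \<in> A \<and> y \<in> B" if "A \<in> M" "B \<in> M" for A B
  proof -
    have "{A, B} \<subseteq> M" "finite {A, B}" using that by auto
    from fipD[OF this] show ?thesis by auto
  qed
  \<comment> \<open>The chosen representatives are compatible because the cosets of \<open>W\<close>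
    and of \<open>W'\<close> both belong to \<open>M\<close> and hence meet.\<close>
  have "\<exists>x\<in>carrier H. \<forall>W\<in>\<W>. x \<ominus> a W \<in> W"
  proof (rule W_complete[OF a(1)])
    fix W W' assume W: "W \<in> \<W>" "W' \<in> \<W>" "W \<subseteq> W'"
    from pair[OF a(2)[OF W(1)] a(2)[OF W(2)]] obtain y where
      y: "y \<in> carrier H" "y \<ominus> a W \<in> W" "y \<ominus> a W' \<in> W'" by (auto simp: coset_of_def)
    have aW: "a W \<in> carrier H" "a W' \<in> carrier H" using a W by auto
    have "a W \<ominus> y \<in> W" using diff_sym[OF W_asub[OF W(1)] y(2) y(1) aW(1)] .
    then have "a W \<ominus> y \<in> W'" using W(3) by blast
    then show "a W \<ominus> a W' \<in> W'" using diff_trans[OF W_asub[OF W(2)] _ y(3) aW(1) y(1) aW(2)] by blast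
  qed
  then obtain x where x: "x \<in> carrier H" "\<And>W. W \<in> \<W> \<Longrightarrow> x \<ominus> a W \<in> W" by blast
  have "x \<in> C" if C: "C \<in> \<C>" for C
  proof -
    from cc[OF C] obtain c K where c: "c \<in> carrier H" "clsd K" "C = coset_of H c K" by (auto simp: ccoset_def)
    have "x \<ominus> c \<in> K"
    proof (rule clsdD[OF c(2)])
      show "x \<ominus> c \<in> carrier H" using x c by simp
      fix W assume W: "W \<in> \<W>"
      from pair[OF a(2)[OF W], of C] CM C c obtain y where y: "y \<in> carrier H" "y \<ominus> a W \<in> W" "y \<ominus> c \<in> K"
        by (auto simp: coset_of_def)
      have "a W \<ominus> y \<in> W" by (rule diff_sym[OF W_asub[OF W] y(2) y(1) a(1)[OF W]])
      then have "x \<ominus> y \<in> W" by (rule diff_trans[OF W_asub[OF W] x(2)[OF W] _ x(1) a(1)[OF W] y(1)])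
      then have "(x \<ominus> c) \<ominus> (y \<ominus> c) \<in> W" using x c y by (simp add: agr)
      then show "x \<ominus> c \<in> ssum H K W" using y x c by (auto simp: ssum_def)
    qed
    then show ?thesis using x c by (auto simp: coset_of_def)
  qed
  then show ?thesis using x by blast
qed

section \<open>Homomorphisms of linearly compact groups\<close>

locale lin_compact_hom = A: lin_compact HA E actA \<W>A + B: lin_compact HB E actB \<W>B
  for HA :: "('a, 'c) ring_scheme" and E :: "'e set" and actA :: "'e \<Rightarrow> 'a \<Rightarrow> 'a" and \<W>A :: "'a set set"
    and HB :: "('b, 'd) ring_scheme" and actB :: "'e \<Rightarrow> 'b \<Rightarrow> 'b" and \<W>B :: "'b set set" +
  fixes q :: "'a \<Rightarrow> 'b"
  assumes q_closed: "x \<in> carrier HA \<Longrightarrow> q x \<in> carrier HB"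
    and q_add: "x \<in> carrier HA \<Longrightarrow> y \<in> carrier HA \<Longrightarrow> q (x \<oplus>\<^bsub>HA\<^esub> y) = q x \<oplus>\<^bsub>HB\<^esub> q y"
    and q_act: "e \<in> E \<Longrightarrow> x \<in> carrier HA \<Longrightarrow> q (actA e x) = actB e (q x)"
    and q_cont: "W' \<in> \<W>B \<Longrightarrow> \<exists>W\<in>\<W>A. q ` W \<subseteq> W'"
begin

lemma q_diff: "x \<in> carrier HA \<Longrightarrow> y \<in> carrier HA \<Longrightarrow> q (x \<ominus>\<^bsub>HA\<^esub> y) = q x \<ominus>\<^bsub>HB\<^esub> q y"
  by (rule A.add_map_diff) (auto simp: q_closed q_add B.abelian_group_axioms)

lemma q_zero: "q \<zero>\<^bsub>HA\<^esub> = \<zero>\<^bsub>HB\<^esub>"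
  using q_diff[of "\<zero>\<^bsub>HA\<^esub>" "\<zero>\<^bsub>HA\<^esub>"] q_closed[of "\<zero>\<^bsub>HA\<^esub>"] by simp

text \<open>\<open>im U V\<close> is \<open>q(U) + V\<close>.\<close>

definition im :: "'a set \<Rightarrow> 'b set \<Rightarrow> 'b set" where
  "im U V = {b \<in> carrier HB. \<exists>u\<in>U. b \<ominus>\<^bsub>HB\<^esub> q u \<in> V}"

lemma esub_vimage:
  assumes U: "A.esub U" and V: "B.esub V"
  shows "A.esub {u \<in> U. q u \<in> V}"
  unfolding A.esub_def
proof (intro conjI ballI)
  show "asub HA {u \<in> U. q u \<in> V}"
    by (rule A.asub_vimage[OF A.esub_asub[OF U] B.abelian_group_axioms B.esub_asub[OF V]])
      (auto simp: q_closed q_diff)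
  fix e x assume e: "e \<in> E" and x: "x \<in> {u \<in> U. q u \<in> V}"
  then have "x \<in> carrier HA" using A.asub_subset[OF A.esub_asub[OF U]] by blast
  then show "actA e x \<in> {u \<in> U. q u \<in> V}"
    using e x A.esub_act[OF U] B.esub_act[OF V] by (simp add: q_act)
qed

lemma clsd_vimage:
  assumes U: "A.clsd U" and V: "B.clsd V"
  shows "A.clsd {u \<in> U. q u \<in> V}"
proof (rule A.clsdI)
  show "A.esub {u \<in> U. q u \<in> V}" by (rule esub_vimage[OF A.clsd_esub[OF U] B.clsd_esub[OF V]])
  fix x assume x: "x \<in> carrier HA" and *: "\<And>W. W \<in> \<W>A \<Longrightarrow> x \<in> ssum HA {u \<in> U. q u \<in> V} W"
  have "x \<in> U"
  proof (rule A.clsdD[OF U x])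
    fix W assume "W \<in> \<W>A"
    from *[OF this] show "x \<in> ssum HA U W" by (auto simp: ssum_def)
  qed
  moreover have "q x \<in> V"
  proof (rule B.clsdD[OF V q_closed[OF x]])
    fix W' assume "W' \<in> \<W>B"
    from q_cont[OF this] obtain W where W: "W \<in> \<W>A" "q ` W \<subseteq> W'" by blast
    from *[OF W(1)] obtain u where u: "u \<in> U" "q u \<in> V" "x \<ominus>\<^bsub>HA\<^esub> u \<in> W" by (auto simp: ssum_def)
    then have "u \<in> carrier HA" using A.asub_subset[OF A.clsd_asub[OF U]] by blast
    then have "q x \<ominus>\<^bsub>HB\<^esub> q u = q (x \<ominus>\<^bsub>HA\<^esub> u)" using x by (simp add: q_diff)
    also have "\<dots> \<in> W'" using u W by blast
    finally show "q x \<in> ssum HB V W'" using u x by (auto simp: ssum_def q_closed)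
  qed
  ultimately show "x \<in> {u \<in> U. q u \<in> V}" by simp
qed

text \<open>Two solutions \<open>u\<close> differ by an element of \<open>K\<close> that
  \<open>q\<close> sends into \<open>V\<close>. This turns the solvability of equations modulo
  \<open>V\<close> into the nonemptiness of intersections of closed cosets.\<close>

lemma fibre_ccoset:
  assumes K: "A.clsd K" and V: "B.clsd V" and b: "b \<in> carrier HB"
    and k: "k \<in> K" "b \<ominus>\<^bsub>HB\<^esub> q k \<in> V"
  shows "A.ccoset {u \<in> K. b \<ominus>\<^bsub>HB\<^esub> q u \<in> V}"
proof (rule A.ccosetI)
  have Kc: "u \<in> K \<Longrightarrow> u \<in> carrier HA" for u using A.asub_subset[OF A.clsd_asub[OF K]] by blast
  show kc: "k \<in> carrier HA" using Kc k by blast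
  show "A.clsd {u \<in> K. q u \<in> V}" by (rule clsd_vimage[OF K V])
  have Ka: "asub HA K" by (rule A.clsd_asub[OF K])
  have Va: "asub HB V" by (rule B.clsd_asub[OF V])
  have 1: "u \<in> K \<longleftrightarrow> u \<ominus>\<^bsub>HA\<^esub> k \<in> K" if "u \<in> carrier HA" for u
    using A.diff_mem[OF Ka _ k(1) that] A.asub_diff[OF Ka _ k(1)] by blast
  have 2: "b \<ominus>\<^bsub>HB\<^esub> q u \<in> V \<longleftrightarrow> q (u \<ominus>\<^bsub>HA\<^esub> k) \<in> V" if u: "u \<in> carrier HA" for u
  proof -
    have "(b \<ominus>\<^bsub>HB\<^esub> q k) \<ominus>\<^bsub>HB\<^esub> (b \<ominus>\<^bsub>HB\<^esub> q u) = q (u \<ominus>\<^bsub>HA\<^esub> k)"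
      using u kc b q_closed by (simp add: q_diff B.agr)
    moreover have "b \<ominus>\<^bsub>HB\<^esub> q u \<in> carrier HB" using u b q_closed by simp
    ultimately show ?thesis
      using B.asub_diff[OF Va k(2), of "b \<ominus>\<^bsub>HB\<^esub> q u"] B.diff_mem'[OF Va _ k(2), of "b \<ominus>\<^bsub>HB\<^esub> q u"] by auto
  qed
  show "{u \<in> K. b \<ominus>\<^bsub>HB\<^esub> q u \<in> V} = coset_of HA k {u \<in> K. q u \<in> V}"
    using 1 2 Kc by (auto simp: coset_of_def)
qed

text \<open>The fibres over \<open>b\<close> in the members of \<open>\<K>\<close> form a directed
  family of closed cosets, and a common point of them is a preimage in the intersection.\<close>

lemma im_Inter:
  assumes ne: "\<K> \<noteq> {}" and K: "\<And>K. K \<in> \<K> \<Longrightarrow> A.clsd K"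
    and dir: "\<And>K L. K \<in> \<K> \<Longrightarrow> L \<in> \<K> \<Longrightarrow> \<exists>K'\<in>\<K>. K' \<subseteq> K \<inter> L"
    and V: "B.clsd V" and b: "b \<in> carrier HB" and im: "\<And>K. K \<in> \<K> \<Longrightarrow> b \<in> im K V"
  shows "b \<in> im (\<Inter>\<K>) V"
proof -
  define C where "C K = {u \<in> K. b \<ominus>\<^bsub>HB\<^esub> q u \<in> V}" for K
  have "\<exists>x. x \<in> carrier HA \<and> x \<in> \<Inter>(C ` \<K>)"
  proof (rule A.directed_ccosets)
    show "C ` \<K> \<noteq> {}" using ne by simp
    show "A.ccoset D" if "D \<in> C ` \<K>" for D
      using that im fibre_ccoset[OF K V b] by (auto simp: C_def im_def)
    fix D D' assume "D \<in> C ` \<K>" "D' \<in> C ` \<K>"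
    then obtain K L where KL: "K \<in> \<K>" "L \<in> \<K>" "D = C K" "D' = C L" by auto
    from dir[OF KL(1,2)] obtain K' where "K' \<in> \<K>" "K' \<subseteq> K \<inter> L" by blast
    then show "\<exists>C'\<in>C ` \<K>. C' \<subseteq> D \<inter> D'" using KL by (auto simp: C_def intro!: bexI[of _ K'])
  qed
  then obtain x where "\<And>K. K \<in> \<K> \<Longrightarrow> x \<in> C K" by blast
  then show ?thesis using ne b by (auto simp: im_def C_def intro!: bexI[of _ x])
qed

lemma esub_im:
  assumes U: "A.esub U" and V: "B.esub V"
  shows "B.esub (im U V)"
  unfolding B.esub_def asub_def
proof (intro conjI ballI)
  have Uc: "u \<in> U \<Longrightarrow> u \<in> carrier HA" for u using A.asub_subset[OF A.esub_asub[OF U]] by blast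
  show "im U V \<subseteq> carrier HB" by (auto simp: im_def)
  show "\<zero>\<^bsub>HB\<^esub> \<in> im U V" unfolding im_def
    using A.asub_zero[OF A.esub_asub[OF U]] B.asub_zero[OF B.esub_asub[OF V]] q_zero by force
  fix x assume "x \<in> im U V"
  then obtain u where u: "x \<in> carrier HB" "u \<in> U" "x \<ominus>\<^bsub>HB\<^esub> q u \<in> V" by (auto simp: im_def)
  { fix y assume "y \<in> im U V"
    then obtain w where w: "y \<in> carrier HB" "w \<in> U" "y \<ominus>\<^bsub>HB\<^esub> q w \<in> V" by (auto simp: im_def)
    have "(x \<ominus>\<^bsub>HB\<^esub> y) \<ominus>\<^bsub>HB\<^esub> (q u \<ominus>\<^bsub>HB\<^esub> q w) \<in> V"
      by (rule B.diff_diff2[OF B.esub_asub[OF V] u(3) w(3)]) (use u w Uc q_closed in auto)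
    then have "(x \<ominus>\<^bsub>HB\<^esub> y) \<ominus>\<^bsub>HB\<^esub> q (u \<ominus>\<^bsub>HA\<^esub> w) \<in> V" using u w Uc by (simp add: q_diff)
    moreover have "u \<ominus>\<^bsub>HA\<^esub> w \<in> U" by (rule A.asub_diff[OF A.esub_asub[OF U] u(2) w(2)])
    ultimately show "x \<ominus>\<^bsub>HB\<^esub> y \<in> im U V" using u w by (auto simp: im_def)
  next
    fix e assume e: "e \<in> E"
    have "actB e (x \<ominus>\<^bsub>HB\<^esub> q u) \<in> V" by (rule B.esub_act[OF V e u(3)])
    then have "actB e x \<ominus>\<^bsub>HB\<^esub> q (actA e u) \<in> V" using e u Uc q_closed by (simp add: q_act B.act_diff)
    then show "actB e x \<in> im U V" using e u A.esub_act[OF U e] by (auto simp: im_def B.act_closed) }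
qed

lemma im_right: "A.esub U \<Longrightarrow> B.esub V \<Longrightarrow> V \<subseteq> im U V"
  using A.asub_zero[OF A.esub_asub] B.asub_subset[OF B.esub_asub] by (force simp: im_def q_zero)

lemma im_left: "A.esub U \<Longrightarrow> B.esub V \<Longrightarrow> u \<in> U \<Longrightarrow> q u \<in> im U V"
  using A.asub_subset[OF A.esub_asub] B.asub_zero[OF B.esub_asub]
  by (auto simp: im_def q_closed intro!: bexI[of _ u])

text \<open>If \<open>b\<close> lies in the closure, then each equation for \<open>b\<close> modulo
  V + W is solvable in \<open>U\<close>. The solution sets are closed cosets directed by
  \<open>W\<close>; a common solution solves the equation modulo every V + W, hence modulo the
  closed \<open>V\<close>.\<close>

lemma clsd_im:
  assumes U: "A.clsd U" and V: "B.clsd V"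
  shows "B.clsd (im U V)"
proof (rule B.clsdI)
  show "B.esub (im U V)" by (rule esub_im[OF A.clsd_esub[OF U] B.clsd_esub[OF V]])
  have Uc: "u \<in> U \<Longrightarrow> u \<in> carrier HA" for u using A.asub_subset[OF A.clsd_asub[OF U]] by blast
  fix b assume b: "b \<in> carrier HB" and *: "\<And>W. W \<in> \<W>B \<Longrightarrow> b \<in> ssum HB (im U V) W"
  define C where "C W = {u \<in> U. b \<ominus>\<^bsub>HB\<^esub> q u \<in> ssum HB V W}" for W
  have "\<exists>x. x \<in> carrier HA \<and> x \<in> \<Inter>(C ` \<W>B)"
  proof (rule A.directed_ccosets)
    show "C ` \<W>B \<noteq> {}" using B.W_ne by simp
    show "A.ccoset D" if "D \<in> C ` \<W>B" for D
    proof -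
      from that obtain W where W: "W \<in> \<W>B" "D = C W" by blast
      from *[OF W(1)] obtain z u where z: "z \<in> carrier HB" "u \<in> U" "z \<ominus>\<^bsub>HB\<^esub> q u \<in> V" "b \<ominus>\<^bsub>HB\<^esub> z \<in> W"
        by (auto simp: im_def ssum_def)
      have "(b \<ominus>\<^bsub>HB\<^esub> q u) \<ominus>\<^bsub>HB\<^esub> (z \<ominus>\<^bsub>HB\<^esub> q u) = b \<ominus>\<^bsub>HB\<^esub> z" using z b Uc q_closed by (simp add: B.agr)
      then have "b \<ominus>\<^bsub>HB\<^esub> q u \<in> ssum HB V W" using z b Uc q_closed by (auto simp: ssum_def intro!: bexI)
      then show ?thesis unfolding W(2) C_def
        using z by (intro fibre_ccoset[OF U _ b]) (auto intro: B.opn_clsd B.opn_ssum B.W_opn W B.clsd_esub[OF V])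
    qed
    fix D D' assume "D \<in> C ` \<W>B" "D' \<in> C ` \<W>B"
    then obtain K L where KL: "K \<in> \<W>B" "L \<in> \<W>B" "D = C K" "D' = C L" by auto
    from B.W_dir[OF KL(1,2)] obtain K' where K': "K' \<in> \<W>B" "K' \<subseteq> K \<inter> L" by blast
    then have "C K' \<subseteq> D \<inter> D'" unfolding KL C_def ssum_def by blast
    then show "\<exists>C'\<in>C ` \<W>B. C' \<subseteq> D \<inter> D'" using K' by blast
  qed
  then obtain x where x: "\<And>W. W \<in> \<W>B \<Longrightarrow> x \<in> C W" by blast
  then have xU: "x \<in> U" using B.W_ne by (auto simp: C_def)
  have "b \<ominus>\<^bsub>HB\<^esub> q x \<in> V"
    by (rule B.clsdD[OF V]) (use x xU Uc b q_closed in \<open>auto simp: C_def\<close>)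
  then show "b \<in> im U V" using xU b by (auto simp: im_def)
qed

text \<open>By finite length, one of the neighbourhoods \<open>W'\<close> does the work of all of them.\<close>

lemma open_mapping:
  assumes U: "A.clsd U" and V: "B.clsd V" and W: "A.opn W"
  shows "\<exists>W'\<in>\<W>B. im U V \<inter> W' \<subseteq> im (U \<inter> W) V"
proof -
  have Ua: "asub HA U" and Ue: "A.esub U" by (rule A.clsd_asub[OF U], rule A.clsd_esub[OF U])
  have Uc: "u \<in> U \<Longrightarrow> u \<in> carrier HA" for u using A.asub_subset[OF Ua] by blast
  have Wa: "asub HA W" by (rule A.opn_asub[OF W])
  define J where "J = im (U \<inter> W) V"
  have Jc: "B.clsd J" unfolding J_def by (rule clsd_im[OF A.clsd_Int[OF U A.opn_clsd[OF W]] V])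
  have VJ: "V \<subseteq> J" unfolding J_def
    by (rule im_right[OF A.esub_Int[OF Ue A.opn_esub[OF W]] B.clsd_esub[OF V]])
  define S where "S W' = {u \<in> U. q u \<in> ssum HB J W'}" for W'
  define T where "T W' = ssum HA (S W') W" for W'
  have Se: "A.esub (S W')" if "W' \<in> \<W>B" for W'
    unfolding S_def by (rule esub_vimage[OF Ue B.esub_ssum[OF B.clsd_esub[OF Jc] B.W_esub[OF that]]])
  have Te: "A.esub (T W')" "W \<subseteq> T W'" if "W' \<in> \<W>B" for W'
    unfolding T_def using A.esub_ssum[OF Se[OF that] A.opn_esub[OF W]]
      A.ssum_right[OF A.esub_asub[OF Se[OF that]] Wa] by auto
  from A.opn_length[OF W] obtain len :: "'a set \<Rightarrow> nat"
    where len: "\<And>A B. A.esub A \<Longrightarrow> A.esub B \<Longrightarrow> W \<subseteq> A \<Longrightarrow> A \<subset> B \<Longrightarrow> len A < len B" by blast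
  from B.W_ne obtain W0 where "W0 \<in> \<W>B" by blast
  \<comment> \<open>At the least rank of S(W') + W, shrinking \<open>W'\<close> further has no
    effect. An element \<open>u\<close> of S(W') can therefore be moved by an element of
    \<open>W\<close>, and so of U \<inter> W, into S(W2) for every smaller W2; the closedness of
    \<open>J\<close> then gives q u \<in> J.\<close>
  from ex_has_least_nat[of "\<lambda>W'. W' \<in> \<W>B", OF this, of "len \<circ> T"]
  obtain W' where W': "W' \<in> \<W>B" and least: "\<And>W''. W'' \<in> \<W>B \<Longrightarrow> len (T W') \<le> len (T W'')" by auto
  have SJ: "q u \<in> J" if u: "u \<in> S W'" for u
  proof (rule B.clsdD[OF Jc])
    have uU: "u \<in> U" using u by (simp add: S_def)
    then show "q u \<in> carrier HB" using Uc q_closed by blast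
    fix W1 assume W1: "W1 \<in> \<W>B"
    from B.W_dir[OF W' W1] obtain W2 where W2: "W2 \<in> \<W>B" "W2 \<subseteq> W' \<inter> W1" by blast
    have "T W2 \<subseteq> T W'" using W2 unfolding T_def S_def ssum_def by blast
    moreover have "\<not> T W2 \<subset> T W'" using len[OF Te(1)[OF W2(1)] Te(1)[OF W'] Te(2)[OF W2(1)]] least[OF W2(1)] by fastforce
    ultimately have "T W2 = T W'" by blast
    moreover have "u \<in> T W'" unfolding T_def using A.ssum_left[OF A.esub_asub[OF Se[OF W']] Wa] u by blast
    ultimately have "u \<in> T W2" by simp
    then obtain s where s: "s \<in> U" "q s \<in> ssum HB J W2" "u \<ominus>\<^bsub>HA\<^esub> s \<in> W" by (auto simp: T_def S_def ssum_def)
    have "u \<ominus>\<^bsub>HA\<^esub> s \<in> U \<inter> W" using A.asub_diff[OF Ua uU s(1)] s by simp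
    then have *: "q (u \<ominus>\<^bsub>HA\<^esub> s) \<in> J" unfolding J_def
      by (rule im_left[OF A.esub_Int[OF Ue A.opn_esub[OF W]] B.clsd_esub[OF V]])
    have S2: "asub HB (ssum HB J W2)" by (rule B.asub_ssum[OF B.clsd_asub[OF Jc] B.W_asub[OF W2(1)]])
    have "q u \<ominus>\<^bsub>HB\<^esub> q s \<in> ssum HB J W2"
      using * B.ssum_left[OF B.clsd_asub[OF Jc] B.W_asub[OF W2(1)]] uU s Uc by (auto simp: q_diff)
    then have "q u \<in> ssum HB J W2" using B.diff_mem[OF S2 _ s(2)] q_closed uU Uc by blast
    then show "q u \<in> ssum HB J W1" using W2 by (auto simp: ssum_def)
  qed
  have "b \<in> J" if b: "b \<in> im U V" "b \<in> W'" for b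
  proof -
    from b obtain u where u: "b \<in> carrier HB" "u \<in> U" "b \<ominus>\<^bsub>HB\<^esub> q u \<in> V" by (auto simp: im_def)
    have qu: "q u \<in> carrier HB" using u Uc q_closed by blast
    have bJ: "b \<ominus>\<^bsub>HB\<^esub> q u \<in> J" using u VJ by blast
    then have "\<ominus>\<^bsub>HB\<^esub> (b \<ominus>\<^bsub>HB\<^esub> q u) \<in> J" by (rule B.asub_neg[OF B.clsd_asub[OF Jc]])
    moreover have "q u \<ominus>\<^bsub>HB\<^esub> (\<ominus>\<^bsub>HB\<^esub> (b \<ominus>\<^bsub>HB\<^esub> q u)) = b" using u qu by (simp add: B.agr)
    ultimately have "q u \<in> ssum HB J W'" using b(2) qu by (auto simp: ssum_def intro!: bexI)
    then have "q u \<in> J" using u by (intro SJ) (simp add: S_def)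
    then show "b \<in> J" using B.diff_mem[OF B.clsd_asub[OF Jc] bJ] u by blast
  qed
  then show ?thesis using W' by (auto simp: J_def)
qed

text \<open>Zorn's lemma downwards: by \<open>im_Inter\<close> the intersection of a chain is still
  mapped onto everything modulo \<open>V\<close>. It is applied to \<rho> to obtain U, and to the
  identity map to obtain a minimal supplement of U inside the kernel.\<close>

lemma ex_minimal:
  assumes K0: "A.clsd K0" and V: "B.clsd V" and im0: "im K0 V = carrier HB"
  obtains K where "A.clsd K" "K \<subseteq> K0" "im K V = carrier HB"
    "\<And>L. A.clsd L \<Longrightarrow> L \<subseteq> K \<Longrightarrow> im L V = carrier HB \<Longrightarrow> L = K"
proof -
  define \<A> where "\<A> = {K. A.clsd K \<and> K \<subseteq> K0 \<and> im K V = carrier HB}"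
  have "\<exists>m\<in>\<A>. \<forall>a\<in>\<A>. m \<supseteq> a \<longrightarrow> a = m"
  proof (rule predicate_Zorn)
    show "partial_order_on \<A> (relation_of (\<supseteq>) \<A>)"
      by (rule partial_order_on_relation_ofI) auto
    fix C assume C: "C \<in> Chains (relation_of (\<supseteq>) \<A>)"
    show "\<exists>u\<in>\<A>. \<forall>a\<in>C. a \<supseteq> u"
    proof (cases "C = {}")
      case True
      then show ?thesis using assms by (auto simp: \<A>_def)
    next
      case False
      have CA: "C \<subseteq> \<A>" and tot: "\<And>a b. a \<in> C \<Longrightarrow> b \<in> C \<Longrightarrow> a \<subseteq> b \<or> b \<subseteq> a"
        using C by (auto simp: Chains_def relation_of_def)
      have "\<Inter>C \<in> \<A>" unfolding \<A>_def
      proof (intro CollectI conjI)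
        show "A.clsd (\<Inter>C)" using False CA by (intro A.clsd_Inter) (auto simp: \<A>_def)
        show "\<Inter>C \<subseteq> K0" using False CA by (auto simp: \<A>_def)
        show "im (\<Inter>C) V = carrier HB"
        proof
          show "im (\<Inter>C) V \<subseteq> carrier HB" by (auto simp: im_def)
          show "carrier HB \<subseteq> im (\<Inter>C) V"
          proof
            fix b assume b: "b \<in> carrier HB"
            show "b \<in> im (\<Inter>C) V"
            proof (rule im_Inter[OF False _ _ V b])
              show "A.clsd K" if "K \<in> C" for K using CA that by (auto simp: \<A>_def)
              show "b \<in> im K V" if "K \<in> C" for K using CA that b by (auto simp: \<A>_def)
              show "\<exists>K'\<in>C. K' \<subseteq> K \<inter> L" if "K \<in> C" "L \<in> C" for K L
                using tot[OF that] that by (metis Int_greatest order_refl)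
            qed
          qed
        qed
      qed
      then show ?thesis by blast
    qed
  qed
  then show ?thesis using that unfolding \<A>_def by (smt (verit, best) mem_Collect_eq subset_trans)
qed

end

section \<open>Null families\<close>

context lin_compact
begin

text \<open>Through the identity map, the facts about \<open>im\<close> become facts about sums K +
  V within one group.\<close>

lemma id_hom: "lin_compact_hom H E act \<W> H act \<W> (\<lambda>x. x)"
  by unfold_locales auto

lemma im_id: "lin_compact_hom.im H (\<lambda>x. x) K V = ssum H K V"
  by (simp add: lin_compact_hom.im_def[OF id_hom] ssum_def)

lemma ssum_Inter:
  assumes "\<K> \<noteq> {}" "\<And>K. K \<in> \<K> \<Longrightarrow> clsd K"
    and "\<And>K L. K \<in> \<K> \<Longrightarrow> L \<in> \<K> \<Longrightarrow> \<exists>K'\<in>\<K>. K' \<subseteq> K \<inter> L"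
    and "clsd V" "b \<in> carrier H" "\<And>K. K \<in> \<K> \<Longrightarrow> b \<in> ssum H K V"
  shows "b \<in> ssum H (\<Inter>\<K>) V"
  using lin_compact_hom.im_Inter[OF id_hom, of \<K> V b] assms by (simp add: im_id)

text \<open>Choose a member K0 for which K0 + W has least rank. If no member were contained in
  \<open>W\<close>, some x in K0 outside \<open>W\<close> would lie in L + W for all members L,
  hence by \<open>ssum_Inter\<close> in the sum of the intersection with \<open>W\<close>, which is
  \<open>W\<close>.\<close>

lemma opn_above_Inter:
  assumes ne: "\<K> \<noteq> {}" and K: "\<And>K. K \<in> \<K> \<Longrightarrow> clsd K"
    and dir: "\<And>K L. K \<in> \<K> \<Longrightarrow> L \<in> \<K> \<Longrightarrow> \<exists>K'\<in>\<K>. K' \<subseteq> K \<inter> L"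
    and W: "opn W" "\<Inter>\<K> \<subseteq> W"
  shows "\<exists>K\<in>\<K>. K \<subseteq> W"
proof (rule ccontr)
  assume no: "\<not> (\<exists>K\<in>\<K>. K \<subseteq> W)"
  have Wa: "asub H W" by (rule opn_asub[OF W(1)])
  from opn_length[OF W(1)] obtain len :: "'h set \<Rightarrow> nat"
    where len: "\<And>A B. esub A \<Longrightarrow> esub B \<Longrightarrow> W \<subseteq> A \<Longrightarrow> A \<subset> B \<Longrightarrow> len A < len B" by blast
  from ne obtain K1 where "K1 \<in> \<K>" by blast
  from ex_has_least_nat[of "\<lambda>K. K \<in> \<K>", OF this, of "\<lambda>K. len (ssum H K W)"]
  obtain K0 where K0: "K0 \<in> \<K>" and least: "\<And>L. L \<in> \<K> \<Longrightarrow> len (ssum H K0 W) \<le> len (ssum H L W)" by auto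
  from no K0 obtain x where x: "x \<in> K0" "x \<notin> W" by blast
  have xc: "x \<in> carrier H" by (rule asub_subset[OF clsd_asub[OF K[OF K0]] x(1)])
  have "x \<in> ssum H (\<Inter>\<K>) W"
  proof (rule ssum_Inter[OF ne K dir opn_clsd[OF W(1)] xc])
    fix L assume L: "L \<in> \<K>"
    from dir[OF K0 L] obtain K' where K': "K' \<in> \<K>" "K' \<subseteq> K0 \<inter> L" by blast
    have e: "esub (ssum H K' W)" "esub (ssum H K0 W)" "W \<subseteq> ssum H K' W"
      using esub_ssum[OF clsd_esub[OF K] opn_esub[OF W(1)]] K' K0 ssum_right[OF clsd_asub[OF K] Wa] by auto
    have "ssum H K' W \<subseteq> ssum H K0 W" using K' by (intro ssum_mono) auto
    then have "ssum H K' W = ssum H K0 W" using len[OF e(1,2,3)] least[OF K'(1)] by fastforce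
    moreover have "x \<in> ssum H K0 W" using ssum_left[OF clsd_asub[OF K[OF K0]] Wa] x by blast
    ultimately have "x \<in> ssum H K' W" by simp
    then show "x \<in> ssum H L W" using K' by (auto simp: ssum_def)
  qed
  then obtain k where "k \<in> \<Inter>\<K>" "x \<ominus> k \<in> W" by (auto simp: ssum_def)
  then have "x \<in> W" using W diff_mem[OF Wa _ _ xc] by blast
  with x show False by simp
qed

text \<open>Convergence to zero in the quotient by \<open>K\<close>, without forming it. The case of
  interest is K = 0; the others are intermediate stages of the refinement. All open subgroups are
  quantified over, since sums such as K + W need not belong to the base.\<close>

definition null :: "'h set \<Rightarrow> 'i set \<Rightarrow> ('i \<Rightarrow> 'h) \<Rightarrow> bool" where
  "null K I u \<longleftrightarrow> (\<forall>i\<in>I. u i \<in> carrier H) \<and> (\<forall>W. opn W \<and> K \<subseteq> W \<longrightarrow> finite {i \<in> I. u i \<notin> W})"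

lemma null_carrier: "null K I u \<Longrightarrow> i \<in> I \<Longrightarrow> u i \<in> carrier H"
  by (simp add: null_def)

lemma nullD: "null K I u \<Longrightarrow> opn W \<Longrightarrow> K \<subseteq> W \<Longrightarrow> finite {i \<in> I. u i \<notin> W}"
  by (simp add: null_def)

lemma null_zeroI:
  assumes "\<And>i. i \<in> I \<Longrightarrow> u i \<in> carrier H" "\<And>W. W \<in> \<W> \<Longrightarrow> finite {i \<in> I. u i \<notin> W}"
  shows "null {\<zero>} I u"
  unfolding null_def
proof (intro conjI allI impI ballI)
  fix W assume "opn W \<and> {\<zero>} \<subseteq> W"
  then obtain W' where "W' \<in> \<W>" "W' \<subseteq> W" by (auto simp: opn_def)
  from assms(2)[OF this(1)] show "finite {i \<in> I. u i \<notin> W}"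
    by (rule rev_finite_subset) (use \<open>W' \<subseteq> W\<close> in blast)
qed (use assms in auto)

lemma null_zeroD: "null {\<zero>} I u \<Longrightarrow> opn W \<Longrightarrow> finite {i \<in> I. u i \<notin> W}"
  using asub_zero[OF opn_asub] by (auto simp: null_def)

text \<open>For each index the cosets \<open>u i\<close> + K along the chain have a common point
  \<open>w i\<close>. An open subgroup above the intersection already contains some \<open>K\<close>
  of the chain, and modulo this \<open>K\<close> the limit agrees with a null family.\<close>

lemma chain_limit:
  assumes ne: "\<P> \<noteq> {}" and K: "\<And>K u. (K, u) \<in> \<P> \<Longrightarrow> clsd K" and null: "\<And>K u. (K, u) \<in> \<P> \<Longrightarrow> null K I u"
    and chain: "\<And>K u L v. (K, u) \<in> \<P> \<Longrightarrow> (L, v) \<in> \<P> \<Longrightarrow>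
      (L \<subseteq> K \<and> (\<forall>i\<in>I. v i \<ominus> u i \<in> K)) \<or> (K \<subseteq> L \<and> (\<forall>i\<in>I. u i \<ominus> v i \<in> L))"
  shows "\<exists>w. null (\<Inter>(fst ` \<P>)) I w \<and> (\<forall>(K, u)\<in>\<P>. \<forall>i\<in>I. w i \<ominus> u i \<in> K)"
proof -
  have "\<exists>x. x \<in> carrier H \<and> x \<in> \<Inter>((\<lambda>(K, u). coset_of H (u i) K) ` \<P>)" if i: "i \<in> I" for i
  proof (rule directed_ccosets)
    show "(\<lambda>(K, u). coset_of H (u i) K) ` \<P> \<noteq> {}" using ne by simp
    show "ccoset C" if "C \<in> (\<lambda>(K, u). coset_of H (u i) K) ` \<P>" for C
    proof -
      from that obtain K u where "(K, u) \<in> \<P>" "C = coset_of H (u i) K" by auto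
      then show ?thesis using ccosetI K null_carrier[OF null i] by blast
    qed
    fix C D assume "C \<in> (\<lambda>(K, u). coset_of H (u i) K) ` \<P>" "D \<in> (\<lambda>(K, u). coset_of H (u i) K) ` \<P>"
    then obtain K u L v where p: "(K, u) \<in> \<P>" "C = coset_of H (u i) K" "(L, v) \<in> \<P>" "D = coset_of H (v i) L" by auto
    have *: "coset_of H (v i) L \<subseteq> coset_of H (u i) K"
      if p: "(K, u) \<in> \<P>" "(L, v) \<in> \<P>" and "L \<subseteq> K" "v i \<ominus> u i \<in> K" for K L u v
      using that diff_trans[OF clsd_asub[OF K[OF p(1)]] _ that(4) _ null_carrier[OF null[OF p(2)] i] null_carrier[OF null[OF p(1)] i]]
      by (auto simp: coset_of_def)
    from chain[OF p(1,3)] i have "D \<subseteq> C \<or> C \<subseteq> D" unfolding p(2,4) using *[OF p(1,3)] *[OF p(3,1)] by blast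
    then show "\<exists>C'\<in>(\<lambda>(K, u). coset_of H (u i) K) ` \<P>. C' \<subseteq> C \<inter> D" using p by blast
  qed
  then obtain w where w: "\<And>i. i \<in> I \<Longrightarrow> w i \<in> carrier H"
      "\<And>i. i \<in> I \<Longrightarrow> w i \<in> \<Inter>((\<lambda>(K, u). coset_of H (u i) K) ` \<P>)" by metis
  have wd: "w i \<ominus> u i \<in> K" if "(K, u) \<in> \<P>" "i \<in> I" for K u i
    using w(2)[OF that(2)] that(1) by (auto simp: coset_of_def)
  have "null (\<Inter>(fst ` \<P>)) I w" unfolding null_def
  proof (intro conjI allI impI ballI)
    show "w i \<in> carrier H" if "i \<in> I" for i using w that by blast
    fix W assume W: "opn W \<and> \<Inter>(fst ` \<P>) \<subseteq> W"
    have "\<exists>K\<in>fst ` \<P>. K \<subseteq> W"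
    proof (rule opn_above_Inter)
      show "\<exists>K'\<in>fst ` \<P>. K' \<subseteq> K \<inter> L" if "K \<in> fst ` \<P>" "L \<in> fst ` \<P>" for K L
      proof -
        from that obtain u v where "(K, u) \<in> \<P>" "(L, v) \<in> \<P>" by auto
        with chain have "L \<subseteq> K \<or> K \<subseteq> L" by blast
        with that show ?thesis by blast
      qed
    qed (use W ne K in auto)
    then obtain K u where Ku: "(K, u) \<in> \<P>" "K \<subseteq> W" by auto
    have Wa: "asub H W" using W opn_asub by blast
    have "w i \<in> W" if i: "i \<in> I" and u: "u i \<in> W" for i
      by (rule diff_mem[OF Wa _ u w(1)[OF i]]) (use wd[OF Ku(1) i] Ku(2) in blast)
    then have "{i \<in> I. w i \<notin> W} \<subseteq> {i \<in> I. u i \<notin> W}" by blast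
    then show "finite {i \<in> I. w i \<notin> W}" using nullD[OF null[OF Ku(1)] _ Ku(2)] W finite_subset by blast
  qed
  then show ?thesis using wd by blast
qed

text \<open>The members in the open subgroup K + W0, that is all but finitely many, are moved into
  \<open>W0\<close> by subtracting elements of \<open>K\<close>; the others stay. This is the step
  that makes \<open>K\<close> smaller in the Zorn arguments.\<close>

lemma null_refine:
  assumes K: "clsd K" and null: "null K I u" and W0: "opn W0"
  shows "\<exists>v. null (K \<inter> W0) I v \<and> (\<forall>i\<in>I. v i \<ominus> u i \<in> K)"
proof -
  have Ka: "asub H K" by (rule clsd_asub[OF K])
  have W0a: "asub H W0" by (rule opn_asub[OF W0])
  let ?S = "ssum H K W0"
  have S: "opn ?S" "K \<subseteq> ?S" by (rule opn_ssum[OF clsd_esub[OF K] W0]) (rule ssum_left[OF Ka W0a])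
  define v where "v i = (if u i \<in> ?S then u i \<ominus> (SOME k. k \<in> K \<and> u i \<ominus> k \<in> W0) else u i)" for i
  have v: "v i \<ominus> u i \<in> K" "v i \<in> carrier H" "u i \<in> ?S \<Longrightarrow> v i \<in> W0" if i: "i \<in> I" for i
  proof -
    have ui: "u i \<in> carrier H" by (rule null_carrier[OF null i])
    have "v i \<ominus> u i \<in> K \<and> v i \<in> carrier H \<and> (u i \<in> ?S \<longrightarrow> v i \<in> W0)"
    proof (cases "u i \<in> ?S")
      case True
      then obtain k0 where "k0 \<in> K \<and> u i \<ominus> k0 \<in> W0" by (auto simp: ssum_def)
      then have k: "(SOME k. k \<in> K \<and> u i \<ominus> k \<in> W0) \<in> K \<and> u i \<ominus> (SOME k. k \<in> K \<and> u i \<ominus> k \<in> W0) \<in> W0" (is "?k \<in> _ \<and> _")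
        by (rule someI)
      then have kc: "?k \<in> carrier H" using asub_subset[OF Ka] by blast
      have "(u i \<ominus> ?k) \<ominus> u i = \<ominus> ?k" using ui kc by (simp add: agr)
      then show ?thesis using True k kc ui asub_neg[OF Ka] by (simp add: v_def)
    next
      case False
      then show ?thesis using ui asub_zero[OF Ka] by (simp add: v_def)
    qed
    then show "v i \<ominus> u i \<in> K" "v i \<in> carrier H" "u i \<in> ?S \<Longrightarrow> v i \<in> W0" by auto
  qed
  have "null (K \<inter> W0) I v" unfolding null_def
  proof (intro conjI allI impI ballI)
    show "v i \<in> carrier H" if "i \<in> I" for i using v that by blast
    fix W assume W: "opn W \<and> K \<inter> W0 \<subseteq> W"
    \<comment> \<open>\<open>W\<close> contains K \<inter> W0 but perhaps not \<open>K\<close>, so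
      nullity modulo \<open>K\<close> is applied to K + (W \<inter> W0). If v i - k lies in W
      \<inter> W0 and \<open>v i\<close> in \<open>W0\<close>, then k lies in K \<inter> W0, hence
      in \<open>W\<close>, and so does \<open>v i\<close>.\<close>
    let ?T = "ssum H K (W \<inter> W0)"
    have WW: "opn (W \<inter> W0)" using W W0 opn_Int by blast
    have T: "opn ?T" "K \<subseteq> ?T" by (rule opn_ssum[OF clsd_esub[OF K] WW]) (rule ssum_left[OF Ka opn_asub[OF WW]])
    have "v i \<in> W" if i: "i \<in> I" and u: "u i \<in> ?T" for i
    proof -
      have ui: "u i \<in> carrier H" by (rule null_carrier[OF null i])
      have "u i \<in> ?S" using u by (auto simp: ssum_def)
      then have vW0: "v i \<in> W0" using v(3)[OF i] by blast
      have "v i \<in> ?T"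
        by (rule diff_mem[OF opn_asub[OF T(1)] _ u v(2)[OF i]]) (use v(1)[OF i] T(2) in blast)
      then obtain k where k: "k \<in> K" "v i \<ominus> k \<in> W" "v i \<ominus> k \<in> W0" by (auto simp: ssum_def)
      have kc: "k \<in> carrier H" by (rule asub_subset[OF Ka k(1)])
      have "k \<in> W0" by (rule diff_mem'[OF W0a k(3) vW0 kc])
      then have "k \<in> W" using k W by blast
      then show "v i \<in> W" using diff_mem[OF _ k(2) _ v(2)[OF i]] W opn_asub by blast
    qed
    then have "{i \<in> I. v i \<notin> W} \<subseteq> {i \<in> I. u i \<notin> ?T}" by blast
    then show "finite {i \<in> I. v i \<notin> W}" using nullD[OF null T] finite_subset by blast
  qed
  then show ?thesis using v(1) by blast
qed

text \<open>Common Zorn argument for \<open>null_lift\<close> and \<open>ex_null_generators\<close>.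
  The premise \<open>lim\<close> allows the limit \<open>w\<close> of a chain to be replaced by a
  congruent \<open>w'\<close> that meets the further conditions in \<open>Q\<close>.\<close>

lemma ex_minimal_pair:
  assumes Q0: "Q K0 u0" and Qc: "\<And>K u. Q K u \<Longrightarrow> clsd K" and Qn: "\<And>K u. Q K u \<Longrightarrow> null K I u"
    and lim: "\<And>\<P> w. \<lbrakk>\<P> \<noteq> {}; \<And>K u. (K, u) \<in> \<P> \<Longrightarrow> Q K u;
      \<And>K L. K \<in> fst ` \<P> \<Longrightarrow> L \<in> fst ` \<P> \<Longrightarrow> K \<subseteq> L \<or> L \<subseteq> K; null (\<Inter>(fst ` \<P>)) I w;
      \<And>K u i. (K, u) \<in> \<P> \<Longrightarrow> i \<in> I \<Longrightarrow> w i \<ominus> u i \<in> K\<rbrakk>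
      \<Longrightarrow> \<exists>w'. Q (\<Inter>(fst ` \<P>)) w' \<and> (\<forall>(K, u)\<in>\<P>. \<forall>i\<in>I. w' i \<ominus> u i \<in> K)"
  obtains K u where "Q K u" "\<And>L v. Q L v \<Longrightarrow> L \<subset> K \<Longrightarrow> \<exists>i\<in>I. v i \<ominus> u i \<notin> K"
proof -
  define \<A> where "\<A> = {(L, v). Q L v}"
  \<comment> \<open>Strict inclusion keeps the order antisymmetric: two different families over the
    same submodule are incomparable even when they are congruent modulo it.\<close>
  define P where "P = (\<lambda>(L, v) (L', v'). (L, v) = (L', v') \<or> (L' \<subset> L \<and> (\<forall>i\<in>I. v' i \<ominus> v i \<in> L)))"
  have "\<exists>m\<in>\<A>. \<forall>a\<in>\<A>. P m a \<longrightarrow> a = m"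
  proof (rule predicate_Zorn)
    show "partial_order_on \<A> (relation_of P \<A>)"
    proof (rule partial_order_on_relation_ofI)
      show "P a a" for a by (auto simp: P_def)
      show "a = b" if "P a b" "P b a" for a b using that by (auto simp: P_def)
      fix a b c assume A: "a \<in> \<A>" "b \<in> \<A>" "c \<in> \<A>" and P: "P a b" "P b c"
      obtain L1 v1 L2 v2 L3 v3 where eq: "a = (L1, v1)" "b = (L2, v2)" "c = (L3, v3)" by (metis surj_pair)
      show "P a c"
      proof (cases "a = b \<or> b = c")
        case True then show ?thesis using P by auto
      next
        case False
        then have l: "L2 \<subset> L1" "L3 \<subset> L2" "\<forall>i\<in>I. v2 i \<ominus> v1 i \<in> L1" "\<forall>i\<in>I. v3 i \<ominus> v2 i \<in> L2"
          using P by (auto simp: P_def eq)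
        have Q: "Q L1 v1" "Q L2 v2" "Q L3 v3" using A by (auto simp: \<A>_def eq)
        have "v3 i \<ominus> v1 i \<in> L1" if i: "i \<in> I" for i
        proof (rule diff_trans[OF clsd_asub[OF Qc[OF Q(1)]]])
          show "v3 i \<ominus> v2 i \<in> L1" "v2 i \<ominus> v1 i \<in> L1" using l i by auto
        qed (use null_carrier[OF Qn i] Q in auto)
        then show ?thesis using l by (auto simp: P_def eq)
      qed
    qed
    fix C assume C: "C \<in> Chains (relation_of P \<A>)"
    show "\<exists>m\<in>\<A>. \<forall>a\<in>C. P a m"
    proof (cases "C = {}")
      case True
      then show ?thesis using Q0 by (auto simp: \<A>_def)
    next
      case False
      have CA: "C \<subseteq> \<A>" and tot: "\<And>a b. a \<in> C \<Longrightarrow> b \<in> C \<Longrightarrow> P a b \<or> P b a"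
        using C by (auto simp: Chains_def relation_of_def)
      have CQ: "Q L v" if "(L, v) \<in> C" for L v
        using CA that by (auto simp: \<A>_def)
      have ch: "(L' \<subseteq> L \<and> (\<forall>i\<in>I. v' i \<ominus> v i \<in> L)) \<or> (L \<subseteq> L' \<and> (\<forall>i\<in>I. v i \<ominus> v' i \<in> L'))"
        if "(L, v) \<in> C" "(L', v') \<in> C" for L v L' v'
      proof -
        have "v i \<ominus> v i \<in> L" if "i \<in> I" for i
          using null_carrier[OF Qn[OF CQ[OF \<open>(L, v) \<in> C\<close>]] that]
            asub_zero[OF clsd_asub[OF Qc[OF CQ[OF \<open>(L, v) \<in> C\<close>]]]] by simp
        then show ?thesis using tot[OF that] by (auto simp: P_def)
      qed
      have "\<exists>w. null (\<Inter>(fst ` C)) I w \<and> (\<forall>(L, v)\<in>C. \<forall>i\<in>I. w i \<ominus> v i \<in> L)"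
      proof (rule chain_limit[OF False])
        show "clsd L" "null L I v" if "(L, v) \<in> C" for L v using Qc[OF CQ[OF that]] Qn[OF CQ[OF that]] by auto
      qed (rule ch)
      then obtain w0 where
        w0: "null (\<Inter>(fst ` C)) I w0" "\<And>L v i. (L, v) \<in> C \<Longrightarrow> i \<in> I \<Longrightarrow> w0 i \<ominus> v i \<in> L" by blast
      have tot': "K \<subseteq> L \<or> L \<subseteq> K" if KL: "K \<in> fst ` C" "L \<in> fst ` C" for K L
      proof -
        from KL obtain u v where "(K, u) \<in> C" "(L, v) \<in> C" by auto
        from ch[OF this] show ?thesis by blast
      qed
      have "\<exists>w. Q (\<Inter>(fst ` C)) w \<and> (\<forall>(L, v)\<in>C. \<forall>i\<in>I. w i \<ominus> v i \<in> L)"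
        by (rule lim[of C w0]) (fact False CQ tot' w0)+
      then obtain w where
        w: "Q (\<Inter>(fst ` C)) w" "\<And>L v i. (L, v) \<in> C \<Longrightarrow> i \<in> I \<Longrightarrow> w i \<ominus> v i \<in> L" by blast
      \<comment> \<open>If the chain attains its intersection, the pair found there is already an
        upper bound. Otherwise the intersection is strictly smaller than all members, and the limit
        family can be placed on it.\<close>
      show ?thesis
      proof (cases "\<Inter>(fst ` C) \<in> fst ` C")
        case True
        then obtain v where v: "(\<Inter>(fst ` C), v) \<in> C" by auto
        have "P a (\<Inter>(fst ` C), v)" if a: "a \<in> C" for a
        proof -
          have "fst (\<Inter>(fst ` C), v) \<subseteq> fst a" using a by auto
          then show ?thesis using tot[OF a v] by (auto simp: P_def)
        qed
        then show ?thesis using v CA by blast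
      next
        case nin: False
        have "(\<Inter>(fst ` C), w) \<in> \<A>" using w(1) by (auto simp: \<A>_def)
        moreover have "P a (\<Inter>(fst ` C), w)" if a: "a \<in> C" for a
        proof -
          obtain L' v' where eq: "a = (L', v')" by (cases a)
          have "L' \<in> fst ` C" using a eq by force
          then have "\<Inter>(fst ` C) \<subset> L'" using nin by blast
          then show ?thesis using w(2) a by (auto simp: P_def eq)
        qed
        ultimately show ?thesis by blast
      qed
    qed
  qed
  then obtain L v where m: "(L, v) \<in> \<A>" and max: "\<And>a. a \<in> \<A> \<Longrightarrow> P (L, v) a \<Longrightarrow> a = (L, v)" by (metis surj_pair)
  show thesis
  proof (rule that)
    show "Q L v" using m by (simp add: \<A>_def)
    fix L' v' assume "Q L' v'" "L' \<subset> L"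
    with max[of "(L', v')"] show "\<exists>i\<in>I. v' i \<ominus> v i \<notin> L" by (auto simp: P_def \<A>_def)
  qed
qed

text \<open>Start from the pair of \<open>K\<close> and \<open>u\<close> and take a minimal pair of
  a submodule L of \<open>K\<close> and a family null modulo L that is congruent to \<open>u\<close>
  modulo \<open>K\<close>. If L were nonzero, \<open>null_refine\<close> with a neighbourhood
  missing some element of L would give a smaller pair.\<close>

lemma null_lift:
  assumes K: "clsd K" and u: "null K I u"
  shows "\<exists>v. null {\<zero>} I v \<and> (\<forall>i\<in>I. v i \<ominus> u i \<in> K)"
proof -
  define Q where "Q L v \<longleftrightarrow> clsd L \<and> L \<subseteq> K \<and> null L I v \<and> (\<forall>i\<in>I. v i \<ominus> u i \<in> K)" for L v
  have Ka: "asub H K" by (rule clsd_asub[OF K])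
  have step: "v' i \<ominus> u i \<in> K"
    if "i \<in> I" "v' i \<in> carrier H" "v' i \<ominus> v i \<in> L" "Q L v" for v v' i L
    using that by (intro diff_trans[OF Ka, of "v' i" "v i" "u i"]) (auto simp: Q_def null_carrier[OF u] null_carrier)
  obtain L v where QL: "Q L v" and max: "\<And>L' v'. Q L' v' \<Longrightarrow> L' \<subset> L \<Longrightarrow> \<exists>i\<in>I. v' i \<ominus> v i \<notin> L"
  proof (rule ex_minimal_pair[of Q K u I])
    show "Q K u" using K u asub_zero[OF Ka] null_carrier[OF u] by (auto simp: Q_def)
    show "clsd L" "null L I v" if "Q L v" for L v using that by (auto simp: Q_def)
    fix \<P> w assume ne: "\<P> \<noteq> {}" and PQ: "\<And>K u. (K, u) \<in> \<P> \<Longrightarrow> Q K u" and n: "null (\<Inter>(fst ` \<P>)) I w"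
      and w: "\<And>K u i. (K, u) \<in> \<P> \<Longrightarrow> i \<in> I \<Longrightarrow> w i \<ominus> u i \<in> K"
    obtain L v where Lv: "(L, v) \<in> \<P>" using ne by auto
    have "w i \<ominus> u i \<in> K" if i: "i \<in> I" for i
      using step[of i w v L] i null_carrier[OF n i] w[OF Lv i] PQ[OF Lv] by blast
    moreover have "clsd (\<Inter>(fst ` \<P>))" using ne PQ by (intro clsd_Inter) (auto simp: Q_def)
    moreover have "\<Inter>(fst ` \<P>) \<subseteq> K" using Lv PQ[OF Lv] by (force simp: Q_def)
    ultimately have "Q (\<Inter>(fst ` \<P>)) w" using n by (simp add: Q_def)
    then show "\<exists>w'. Q (\<Inter>(fst ` \<P>)) w' \<and> (\<forall>(K, u)\<in>\<P>. \<forall>i\<in>I. w' i \<ominus> u i \<in> K)" using w by blast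
  qed blast
  then have L: "clsd L" "L \<subseteq> K" "null L I v" "\<And>i. i \<in> I \<Longrightarrow> v i \<ominus> u i \<in> K" by (auto simp: Q_def)
  have La: "asub H L" by (rule clsd_asub[OF L(1)])
  have "L = {\<zero>}"
  proof (rule ccontr)
    assume "L \<noteq> {\<zero>}"
    then obtain x where x: "x \<in> L" "x \<noteq> \<zero>" using asub_zero[OF La] by blast
    then obtain W0 where W0: "W0 \<in> \<W>" "x \<notin> W0" using W_sep[of x] asub_subset[OF La] by blast
    from null_refine[OF L(1,3) W_opn[OF W0(1)]] obtain v' where
      v': "null (L \<inter> W0) I v'" "\<And>i. i \<in> I \<Longrightarrow> v' i \<ominus> v i \<in> L" by blast
    have "v' i \<ominus> u i \<in> K" if i: "i \<in> I" for i
      using step[of i v' v L] i null_carrier[OF v'(1) i] v'(2)[OF i] QL by blast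
    moreover have "clsd (L \<inter> W0)" using clsd_Int L(1) opn_clsd W_opn W0 by blast
    ultimately have "Q (L \<inter> W0) v'" using L v' by (auto simp: Q_def)
    moreover have "L \<inter> W0 \<subset> L" using x W0 by blast
    ultimately show False using max v'(2) by blast
  qed
  then show ?thesis using L by blast
qed

end

text \<open>Lifts \<open>u0\<close> are chosen arbitrarily; any two lifts of the same element differ
  by U0, the part of \<open>U\<close> mapped into \<open>V\<close>. By \<open>open_mapping\<close>
  the choice is null modulo U0, and \<open>null_lift\<close> corrects it within U0. This replaces
  projectivity throughout.\<close>

lemma (in lin_compact_hom) null_lift_im:
  assumes U: "A.clsd U" and V: "B.clsd V" and b: "B.null {\<zero>\<^bsub>HB\<^esub>} I b"
    and im: "\<And>i. i \<in> I \<Longrightarrow> b i \<in> im U V"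
  shows "\<exists>u. A.null {\<zero>\<^bsub>HA\<^esub>} I u \<and> (\<forall>i\<in>I. u i \<in> U \<and> b i \<ominus>\<^bsub>HB\<^esub> q (u i) \<in> V)"
proof -
  have Ua: "asub HA U" by (rule A.clsd_asub[OF U])
  have Va: "asub HB V" by (rule B.clsd_asub[OF V])
  have Uc: "u \<in> U \<Longrightarrow> u \<in> carrier HA" for u using A.asub_subset[OF Ua] by blast
  have "\<exists>u. u \<in> U \<and> b i \<ominus>\<^bsub>HB\<^esub> q u \<in> V" if "i \<in> I" for i using im[OF that] by (auto simp: im_def)
  then obtain u0 where u0: "\<And>i. i \<in> I \<Longrightarrow> u0 i \<in> U" "\<And>i. i \<in> I \<Longrightarrow> b i \<ominus>\<^bsub>HB\<^esub> q (u0 i) \<in> V" by metis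
  define U0 where "U0 = {x \<in> U. q x \<in> V}"
  have U0: "A.clsd U0" unfolding U0_def by (rule clsd_vimage[OF U V])
  have close: "w \<ominus>\<^bsub>HA\<^esub> u0 i \<in> U0" if i: "i \<in> I" and w: "w \<in> U" "b i \<ominus>\<^bsub>HB\<^esub> q w \<in> V" for i w
  proof -
    have c: "w \<in> carrier HA" "u0 i \<in> carrier HA" "b i \<in> carrier HB"
      using w u0[OF i] Uc B.null_carrier[OF b i] by auto
    have "(b i \<ominus>\<^bsub>HB\<^esub> q (u0 i)) \<ominus>\<^bsub>HB\<^esub> (b i \<ominus>\<^bsub>HB\<^esub> q w) = q (w \<ominus>\<^bsub>HA\<^esub> u0 i)"
      using c q_closed by (simp add: q_diff B.agr)
    then have "q (w \<ominus>\<^bsub>HA\<^esub> u0 i) \<in> V" using B.asub_diff[OF Va u0(2)[OF i] w(2)] by simp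
    then show ?thesis using A.asub_diff[OF Ua w(1) u0(1)[OF i]] by (simp add: U0_def)
  qed
  have "A.null U0 I u0" unfolding A.null_def
  proof (intro conjI allI impI ballI)
    show "u0 i \<in> carrier HA" if "i \<in> I" for i using u0[OF that] Uc by blast
    fix W assume W: "A.opn W \<and> U0 \<subseteq> W"
    from open_mapping[OF U V, of W] W obtain W' where W': "W' \<in> \<W>B" "im U V \<inter> W' \<subseteq> im (U \<inter> W) V" by blast
    have "u0 i \<in> W" if i: "i \<in> I" and bi: "b i \<in> W'" for i
    proof -
      have "b i \<in> im (U \<inter> W) V" using W' im[OF i] bi by blast
      then obtain w where w: "w \<in> U" "w \<in> W" "b i \<ominus>\<^bsub>HB\<^esub> q w \<in> V" by (auto simp: im_def)
      from close[OF i w(1,3)] W have "w \<ominus>\<^bsub>HA\<^esub> u0 i \<in> W" by blast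
      then show ?thesis using A.diff_mem'[OF A.opn_asub _ w(2)] W u0(1)[OF i] Uc by blast
    qed
    then have "{i \<in> I. u0 i \<notin> W} \<subseteq> {i \<in> I. b i \<notin> W'}" by blast
    then show "finite {i \<in> I. u0 i \<notin> W}" using B.null_zeroD[OF b B.W_opn[OF W'(1)]] finite_subset by blast
  qed
  from A.null_lift[OF U0 this] obtain u where u: "A.null {\<zero>\<^bsub>HA\<^esub>} I u" "\<And>i. i \<in> I \<Longrightarrow> u i \<ominus>\<^bsub>HA\<^esub> u0 i \<in> U0" by blast
  have "u i \<in> U \<and> b i \<ominus>\<^bsub>HB\<^esub> q (u i) \<in> V" if i: "i \<in> I" for i
  proof
    have c: "u i \<in> carrier HA" "u0 i \<in> carrier HA" "b i \<in> carrier HB"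
      using A.null_carrier[OF u(1) i] u0[OF i] Uc B.null_carrier[OF b i] by auto
    show "u i \<in> U" using A.diff_mem[OF Ua _ u0(1)[OF i] c(1)] u(2)[OF i] by (auto simp: U0_def)
    have "q (u i \<ominus>\<^bsub>HA\<^esub> u0 i) \<in> V" using u(2)[OF i] by (simp add: U0_def)
    from B.asub_diff[OF Va u0(2)[OF i] this] show "b i \<ominus>\<^bsub>HB\<^esub> q (u i) \<in> V"
      using c q_closed by (simp add: q_diff B.agr)
  qed
  then show ?thesis using u(1) by blast
qed

section \<open>Maximal closed submodules and topological generators\<close>

context lin_compact
begin

text \<open>Among the closed proper submodules of \<open>K\<close> above K \<inter> W, the rank of L
  + W grows strictly with L by the modular law and is bounded by that of K + W. Take L of greatest
  rank.\<close>

lemma ex_maximal_esub: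
  assumes K: "clsd K" and W: "opn W" and ne: "\<not> K \<subseteq> W"
  obtains L where "clsd L" "L \<subset> K" "\<And>Z. clsd Z \<Longrightarrow> L \<subset> Z \<Longrightarrow> Z \<subseteq> K \<Longrightarrow> Z = K"
proof -
  have Ka: "asub H K" and Ke: "esub K" by (rule clsd_asub[OF K], rule clsd_esub[OF K])
  have Wa: "asub H W" and We: "esub W" by (rule opn_asub[OF W], rule opn_esub[OF W])
  from opn_length[OF W] obtain len :: "'h set \<Rightarrow> nat"
    where len: "\<And>A B. esub A \<Longrightarrow> esub B \<Longrightarrow> W \<subseteq> A \<Longrightarrow> A \<subset> B \<Longrightarrow> len A < len B" by blast
  define Q where "Q L \<longleftrightarrow> clsd L \<and> K \<inter> W \<subseteq> L \<and> L \<subset> K" for L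
  have lt: "len (ssum H A W) < len (ssum H B W)" if "clsd A" "clsd B" "A \<subset> B" "K \<inter> W \<subseteq> A" "B \<subseteq> K" for A B
  proof (rule len)
    show "esub (ssum H A W)" "esub (ssum H B W)" "W \<subseteq> ssum H A W"
      using that esub_ssum[OF clsd_esub We] ssum_right[OF clsd_asub Wa] by auto
    have "ssum H A W \<subseteq> ssum H B W" using that by (intro ssum_mono) auto
    moreover from \<open>A \<subset> B\<close> obtain b where b: "b \<in> B" "b \<notin> A" by auto
    have bc: "b \<in> carrier H" by (rule asub_subset[OF clsd_asub[OF that(2)] b(1)])
    have "b \<notin> ssum H A W"
    proof
      assume "b \<in> ssum H A W"
      then obtain a where a: "a \<in> A" "b \<ominus> a \<in> W" by (auto simp: ssum_def)
      have "b \<ominus> a \<in> B" using asub_diff[OF clsd_asub[OF that(2)] b(1)] a(1) that(3) by blast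
      then have "b \<ominus> a \<in> A" using a that by blast
      then show False using diff_mem[OF clsd_asub[OF that(1)] _ a(1) bc] b by blast
    qed
    moreover have "b \<in> ssum H B W" using ssum_left[OF clsd_asub[OF that(2)] Wa] b by blast
    ultimately show "ssum H A W \<subset> ssum H B W" by blast
  qed
  have ex: "Q (K \<inter> W)" unfolding Q_def using clsd_Int[OF K opn_clsd[OF W]] ne by auto
  have "\<forall>L. Q L \<longrightarrow> len (ssum H L W) \<le> len (ssum H K W)"
    using lt[OF _ K] by (auto simp: Q_def intro: less_imp_le)
  with ex obtain L where L: "Q L" "\<And>Z. Q Z \<Longrightarrow> len (ssum H Z W) \<le> len (ssum H L W)"
    using ex_has_greatest_nat[of Q "K \<inter> W" "\<lambda>L. len (ssum H L W)" "Suc (len (ssum H K W))"] by (auto simp: less_Suc_eq_le)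
  show thesis
  proof (rule that)
    show "clsd L" "L \<subset> K" using L by (auto simp: Q_def)
    fix Z assume Z: "clsd Z" "L \<subset> Z" "Z \<subseteq> K"
    show "Z = K"
    proof (rule ccontr)
      assume "Z \<noteq> K"
      then have "Q Z" using Z L(1) by (auto simp: Q_def)
      moreover have "len (ssum H L W) < len (ssum H Z W)" using lt Z L(1) by (auto simp: Q_def)
      ultimately show False using L(2) by fastforce
    qed
  qed
qed

text \<open>
  Indexing the generators by the closed submodules \<open>K\<close> reached so far makes room for a new one at
  every step: the family constructed up to \<open>K\<close> is supported on the \<open>S\<close> properly containing \<open>K\<close>.
\<close>

lemma ex_null_generators:
  "\<exists>u :: 'h set \<Rightarrow> 'h. null {\<zero>} UNIV u \<and> (\<forall>Z. clsd Z \<and> range u \<subseteq> Z \<longrightarrow> Z = carrier H)"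
proof -
  define Q where "Q K u \<longleftrightarrow> clsd K \<and> null {\<zero>} UNIV u \<and> (\<forall>S. u S \<noteq> \<zero> \<longrightarrow> K \<subset> S) \<and>
    (\<forall>Z. clsd Z \<and> K \<subseteq> Z \<and> range u \<subseteq> Z \<longrightarrow> Z = carrier H)" for K and u :: "'h set \<Rightarrow> 'h"
  have Qc: "clsd K" if "Q K u" for K u using that by (simp add: Q_def)
  have Qz: "null {\<zero>} UNIV u" if "Q K u" for K u using that by (simp add: Q_def)
  have Qn: "null K UNIV u" if "Q K u" for K u
    using null_zeroD[OF Qz[OF that]] null_carrier[OF Qz[OF that]] by (auto simp: null_def)
  obtain K u where QK: "Q K u" and max: "\<And>L v. Q L v \<Longrightarrow> L \<subset> K \<Longrightarrow> \<exists>S\<in>UNIV. v S \<ominus> u S \<notin> K"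
  proof (rule ex_minimal_pair[of Q "carrier H" "\<lambda>_. \<zero>" UNIV])
    show "Q (carrier H) (\<lambda>_. \<zero>)"
      using clsd_asub asub_subset by (auto simp: Q_def clsd_carrier null_def asub_zero opn_asub)
    show "clsd L" "null L UNIV v" if "Q L v" for L v using Qc[OF that] Qn[OF that] by auto
    fix \<P> w0 assume ne: "\<P> \<noteq> {}" and PQ: "\<And>K u. (K, u) \<in> \<P> \<Longrightarrow> Q K u"
      and tot: "\<And>K L. K \<in> fst ` \<P> \<Longrightarrow> L \<in> fst ` \<P> \<Longrightarrow> K \<subseteq> L \<or> L \<subseteq> K"
      and n0: "null (\<Inter>(fst ` \<P>)) UNIV w0"
      and w0: "\<And>K u S. (K, u) \<in> \<P> \<Longrightarrow> S \<in> UNIV \<Longrightarrow> w0 S \<ominus> u S \<in> K"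
    let ?K = "\<Inter>(fst ` \<P>)"
    have PK: "clsd K" if "K \<in> fst ` \<P>" for K
    proof -
      from that obtain u where "(K, u) \<in> \<P>" by auto
      then show ?thesis using PQ Qc by blast
    qed
    then have cK: "clsd ?K" using ne by (intro clsd_Inter) auto
    have above: "\<exists>K\<in>fst ` \<P>. K \<subseteq> W" if "opn W" "?K \<subseteq> W" for W
    proof (rule opn_above_Inter[OF _ _ _ that])
      show "\<exists>K'\<in>fst ` \<P>. K' \<subseteq> K \<inter> L" if "K \<in> fst ` \<P>" "L \<in> fst ` \<P>" for K L
        using tot[OF that] that by blast
    qed (use ne PK in auto)
    from null_lift[OF cK n0] obtain w1 where
      w1: "null {\<zero>} UNIV w1" "\<And>S. w1 S \<ominus> w0 S \<in> ?K" by blast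
    \<comment> \<open>The lifted limit is null but may be nonzero at any index. Resetting it to zero
      where all families of the chain vanish restores the support condition and keeps the
      congruences.\<close>
    define w where "w S = (if \<exists>(K, u)\<in>\<P>. u S \<noteq> \<zero> then w1 S else \<zero>)" for S
    have cong: "w S \<ominus> u S \<in> K" if p: "(K, u) \<in> \<P>" for K u S
    proof -
      have Ka: "asub H K" by (rule clsd_asub[OF Qc[OF PQ[OF p]]])
      show ?thesis
      proof (cases "\<exists>(K, u)\<in>\<P>. u S \<noteq> \<zero>")
        case True
        have "w1 S \<ominus> u S \<in> K"
        proof (rule diff_trans[OF Ka])
          show "w1 S \<ominus> w0 S \<in> K" using w1(2)[of S] p by force
          show "w0 S \<ominus> u S \<in> K" using w0[OF p] by simp
        qed (use null_carrier[OF w1(1)] null_carrier[OF n0] null_carrier[OF Qn[OF PQ[OF p]]] in auto)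
        then show ?thesis unfolding w_def if_P[OF True] .
      next
        case False
        moreover from this p have "u S = \<zero>" by blast
        ultimately show ?thesis using asub_zero[OF Ka] by (simp only: w_def if_False) simp
      qed
    qed
    have wn: "null {\<zero>} UNIV w" unfolding null_def
    proof (intro conjI allI impI ballI)
      show "w S \<in> carrier H" for S using null_carrier[OF w1(1)] by (auto simp: w_def)
      fix W assume W: "opn W \<and> {\<zero>} \<subseteq> W"
      have "{S \<in> UNIV. w S \<notin> W} \<subseteq> {S \<in> UNIV. w1 S \<notin> W}" using W by (auto simp: w_def)
      then show "finite {S \<in> UNIV. w S \<notin> W}" using nullD[OF w1(1)] W finite_subset by blast
    qed
    have supp: "?K \<subset> S" if "w S \<noteq> \<zero>" for S
    proof -
      from that have "\<exists>(K, u)\<in>\<P>. u S \<noteq> \<zero>" by (metis w_def)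
      then obtain K u where "(K, u) \<in> \<P>" "u S \<noteq> \<zero>" by blast
      then have "K \<subset> S" "?K \<subseteq> K" using PQ by (auto simp: Q_def)
      then show ?thesis by blast
    qed
    have "Z = carrier H" if Z: "clsd Z" "?K \<subseteq> Z" "range w \<subseteq> Z" for Z
    proof
      show "Z \<subseteq> carrier H" using asub_subset[OF clsd_asub[OF Z(1)]] by blast
      show "carrier H \<subseteq> Z"
      proof
        fix x assume x: "x \<in> carrier H"
        show "x \<in> Z"
        proof (rule clsdD[OF Z(1) x])
          fix W assume W: "W \<in> \<W>"
          \<comment> \<open>Generation survives in the limit: the open Z + W contains the
            intersection, hence some \<open>K\<close> of the chain, and then also the values of the
            family belonging to this \<open>K\<close>. So Z + W is everything for each
            \<open>W\<close>.\<close>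
          let ?S = "ssum H Z W"
          have S: "opn ?S" "Z \<subseteq> ?S"
            by (rule opn_ssum[OF clsd_esub[OF Z(1)] W_opn[OF W]]) (rule ssum_left[OF clsd_asub[OF Z(1)] W_asub[OF W]])
          from above[OF S(1)] S(2) Z(2) obtain K u where p: "(K, u) \<in> \<P>" "K \<subseteq> ?S" by force
          have "u T \<in> ?S" for T
          proof (rule diff_mem'[OF opn_asub[OF S(1)]])
            show "w T \<ominus> u T \<in> ?S" using cong[OF p(1)] p(2) by blast
            show "w T \<in> ?S" using S(2) Z(3) by blast
            show "u T \<in> carrier H" using null_carrier[OF Qn[OF PQ[OF p(1)]]] by blast
          qed
          then have "?S = carrier H" using PQ[OF p(1)] p(2) opn_clsd[OF S(1)] unfolding Q_def by blast
          then show "x \<in> ?S" using x by simp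
        qed
      qed
    qed
    then have "Q ?K w" using cK wn supp unfolding Q_def by blast
    then show "\<exists>w'. Q ?K w' \<and> (\<forall>(K, u)\<in>\<P>. \<forall>i\<in>UNIV. w' i \<ominus> u i \<in> K)" using cong by blast
  qed blast
  have K: "clsd K" by (rule Qc[OF QK])
  have Ka: "asub H K" by (rule clsd_asub[OF K])
  have "K = {\<zero>}"
  proof (rule ccontr)
    assume "K \<noteq> {\<zero>}"
    then obtain x where x: "x \<in> K" "x \<noteq> \<zero>" using asub_zero[OF Ka] by blast
    then obtain W where W: "W \<in> \<W>" "x \<notin> W" using W_sep[of x] asub_subset[OF Ka] by blast
    have "\<not> K \<subseteq> W" using x W by blast
    from ex_maximal_esub[OF K W_opn[OF W(1)] this] obtain L where
      L: "clsd L" "L \<subset> K" "\<And>Z. clsd Z \<Longrightarrow> L \<subset> Z \<Longrightarrow> Z \<subseteq> K \<Longrightarrow> Z = K" by blast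
    then obtain y where y: "y \<in> K" "y \<notin> L" by blast
    \<comment> \<open>The index \<open>K\<close> is free because \<open>u\<close> is supported on
      proper supersets of \<open>K\<close>. By maximality of L, any closed submodule containing L
      and \<open>y\<close> contains \<open>K\<close>, so \<open>y\<close> makes up for replacing
      \<open>K\<close> by L.\<close>
    define v where "v = u(K := y)"
    have uK: "u K = \<zero>" using QK by (auto simp: Q_def)
    have uc: "u S \<in> carrier H" for S using null_carrier[OF Qn[OF QK]] by blast
    have yc: "y \<in> carrier H" by (rule asub_subset[OF Ka y(1)])
    have "null {\<zero>} UNIV v" unfolding null_def
    proof (intro conjI allI impI ballI)
      show "v S \<in> carrier H" for S using uc yc by (simp add: v_def)
      fix W assume W: "opn W \<and> {\<zero>} \<subseteq> W"
      have "{S \<in> UNIV. v S \<notin> W} \<subseteq> insert K {S \<in> UNIV. u S \<notin> W}" by (auto simp: v_def)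
      then show "finite {S \<in> UNIV. v S \<notin> W}" using nullD[OF Qz[OF QK]] W finite_subset by blast
    qed
    moreover have "L \<subset> S" if "v S \<noteq> \<zero>" for S
      using that L(2) QK by (cases "S = K") (auto simp: v_def Q_def)
    moreover have "Z = carrier H" if Z: "clsd Z" "L \<subseteq> Z" "range v \<subseteq> Z" for Z
    proof -
      have "y \<in> Z" using Z(3) by (auto simp: v_def image_subset_iff dest: spec[of _ K])
      then have "Z \<inter> K = K" using L y Z by (intro L(3) clsd_Int K) auto
      moreover have "u S \<in> Z" for S
        using Z(3) uK asub_zero[OF clsd_asub[OF Z(1)]] by (cases "S = K") (auto simp: v_def image_subset_iff split: if_splits)
      ultimately show ?thesis using QK Z(1) unfolding Q_def by blast
    qed
    ultimately have "Q L v" using L(1) unfolding Q_def by blast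
    from max[OF this L(2)] obtain S where "v S \<ominus> u S \<notin> K" by blast
    then show False using uK y yc uc asub_zero[OF Ka] by (cases "S = K") (auto simp: v_def)
  qed
  have "Z = carrier H" if Z: "clsd Z" "range u \<subseteq> Z" for Z
  proof -
    have "K \<subseteq> Z" using asub_zero[OF clsd_asub[OF Z(1)]] \<open>K = _\<close> by simp
    then show ?thesis using QK Z unfolding Q_def by blast
  qed
  then show ?thesis using Qz[OF QK] by blast
qed

end

lemma (in lin_compact_hom) im_zero:
  assumes "U \<subseteq> carrier HA"
  shows "im U {\<zero>\<^bsub>HB\<^esub>} = q ` U"
proof -
  have "b = q u" if "b \<in> carrier HB" "u \<in> carrier HA" "b \<ominus>\<^bsub>HB\<^esub> q u = \<zero>\<^bsub>HB\<^esub>" for b u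
  proof -
    have "b = (b \<ominus>\<^bsub>HB\<^esub> q u) \<oplus>\<^bsub>HB\<^esub> q u" using that(1,2) q_closed by (simp add: B.agr)
    also have "\<dots> = q u" using that(2) q_closed by (simp add: that(3))
    finally show ?thesis .
  qed
  moreover have "q u \<ominus>\<^bsub>HB\<^esub> q u = \<zero>\<^bsub>HB\<^esub>" if "u \<in> U" for u using that assms q_closed by (meson B.diff_self subsetD)
  ultimately show ?thesis using assms q_closed unfolding im_def by blast
qed

text \<open>
  If \<open>U\<close> is minimal among the closed submodules that \<open>q\<close> maps onto everything and \<open>V \<le> ker q\<close> is a
  minimal supplement of \<open>U\<close>, then every endomorphism into \<open>U\<close> that is the identity modulo \<open>V\<close> is
  the projection onto a direct summand.
\<close>

lemma (in lin_compact_hom) idempotent: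
  assumes U: "A.clsd U" and Umin: "\<And>L. A.clsd L \<Longrightarrow> L \<subseteq> U \<Longrightarrow> im L {\<zero>\<^bsub>HB\<^esub>} = carrier HB \<Longrightarrow> L = U"
    and V: "A.clsd V" and Vmin: "\<And>L. A.clsd L \<Longrightarrow> L \<subseteq> V \<Longrightarrow> ssum HA L U = carrier HA \<Longrightarrow> L = V"
    and Uq: "im U {\<zero>\<^bsub>HB\<^esub>} = carrier HB" and Vq: "\<And>x. x \<in> V \<Longrightarrow> q x = \<zero>\<^bsub>HB\<^esub>"
    and d: "lin_compact_hom HA E actA \<W>A HA actA \<W>A d"
    and dU: "\<And>x. x \<in> carrier HA \<Longrightarrow> d x \<in> U" and dV: "\<And>x. x \<in> carrier HA \<Longrightarrow> x \<ominus>\<^bsub>HA\<^esub> d x \<in> V"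
  shows "x \<in> carrier HA \<Longrightarrow> d (d x) = d x"
    and "d ` U = U"
proof -
  interpret d: lin_compact_hom HA E actA \<W>A HA actA \<W>A d by fact
  have Ua: "asub HA U" and Va: "asub HA V" using U V by (auto intro: A.clsd_asub)
  have Uc: "u \<in> U \<Longrightarrow> u \<in> carrier HA" for u using A.asub_subset[OF Ua] by blast
  have Vc: "u \<in> V \<Longrightarrow> u \<in> carrier HA" for u using A.asub_subset[OF Va] by blast
  have im0: "d.im U {\<zero>\<^bsub>HA\<^esub>} = d ` U" using Uc by (intro d.im_zero) blast
  have "d ` U = U"
  proof (rule Umin)
    show "A.clsd (d ` U)" using d.clsd_im[OF U A.clsd_singleton] by (simp add: im0)
    show "d ` U \<subseteq> U" using dU Uc by blast
    \<comment> \<open>\<open>d\<close> is the identity modulo \<open>V\<close>, which lies in the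
      kernel of \<open>q\<close>. Hence the image of \<open>U\<close> under \<open>d\<close> is
      still mapped onto everything, and minimality of \<open>U\<close> applies to it.\<close>
    have qd: "q (d u) = q u" if "u \<in> carrier HA" for u
    proof -
      have "d u = u \<ominus>\<^bsub>HA\<^esub> (u \<ominus>\<^bsub>HA\<^esub> d u)" using that d.q_closed by (simp add: A.agr)
      then have "q (d u) = q (u \<ominus>\<^bsub>HA\<^esub> (u \<ominus>\<^bsub>HA\<^esub> d u))" by simp
      also have "\<dots> = q u" using Vq[OF dV[OF that]] that d.q_closed by (simp add: q_diff q_closed)
      finally show ?thesis .
    qed
    show "im (d ` U) {\<zero>\<^bsub>HB\<^esub>} = carrier HB" using Uq Uc qd by (auto simp: im_def)
  qed
  then show "d ` U = U" .
  \<comment> \<open>The kernel of \<open>d\<close> on \<open>V\<close> also supplements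
    \<open>U\<close>. For y = x - d x both y and d y lie in \<open>V\<close>, and d y also lies in
    \<open>U\<close>, so d y = d u with u in \<open>U\<close>. This u lies in \<open>V\<close> too,
    so y - u is in the kernel and x - (y - u) = d x + u is in \<open>U\<close>.\<close>
  define V' where "V' = {v \<in> V. d v \<in> {\<zero>\<^bsub>HA\<^esub>}}"
  have V': "A.clsd V'" unfolding V'_def by (rule d.clsd_vimage[OF V A.clsd_singleton])
  have "V' = V"
  proof (rule Vmin[OF V'])
    show "V' \<subseteq> V" by (auto simp: V'_def)
    show "ssum HA V' U = carrier HA"
    proof
      show "ssum HA V' U \<subseteq> carrier HA" by (auto simp: ssum_def)
      show "carrier HA \<subseteq> ssum HA V' U"
      proof
        fix x assume x: "x \<in> carrier HA"
        let ?y = "x \<ominus>\<^bsub>HA\<^esub> d x"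
        have y: "?y \<in> V" "?y \<in> carrier HA" using dV x d.q_closed by auto
        have "d ?y \<in> V" using A.diff_mem'[OF Va dV[OF y(2)] y(1)] d.q_closed y(2) by blast
        moreover have "d ?y \<in> U" using dU y by blast
        ultimately have D: "d ?y \<in> U" "d ?y \<in> V" by auto
        then obtain u where u: "u \<in> U" "d ?y = d u" using \<open>d ` U = U\<close> by blast
        have uV: "u \<in> V" using A.diff_mem[OF Va dV[OF Uc[OF u(1)]] _ Uc[OF u(1)]] D u by simp
        have uc: "u \<in> carrier HA" using Uc u by blast
        have "?y \<ominus>\<^bsub>HA\<^esub> u \<in> V'"
          using A.asub_diff[OF Va y(1) uV] y uc u(2) d.q_closed by (simp add: V'_def d.q_diff)
        moreover have "x \<ominus>\<^bsub>HA\<^esub> (?y \<ominus>\<^bsub>HA\<^esub> u) \<in> U"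
        proof -
          have "x \<ominus>\<^bsub>HA\<^esub> (?y \<ominus>\<^bsub>HA\<^esub> u) = d x \<oplus>\<^bsub>HA\<^esub> u" using x uc d.q_closed by (simp add: A.agr)
          then show ?thesis using A.asub_add[OF Ua dU[OF x] u(1)] by simp
        qed
        ultimately show "x \<in> ssum HA V' U" using x by (auto simp: ssum_def)
      qed
    qed
  qed
  then show "d (d x) = d x" if x: "x \<in> carrier HA"
  proof -
    have "d (x \<ominus>\<^bsub>HA\<^esub> d x) = \<zero>\<^bsub>HA\<^esub>" using dV[OF x] \<open>V' = V\<close> by (auto simp: V'_def)
    then have "d x \<ominus>\<^bsub>HA\<^esub> d (d x) = \<zero>\<^bsub>HA\<^esub>" using x d.q_closed by (simp add: d.q_diff)
    moreover have "d (d x) = d x \<ominus>\<^bsub>HA\<^esub> (d x \<ominus>\<^bsub>HA\<^esub> d (d x))" using x d.q_closed by (simp add: A.agr)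
    ultimately show ?thesis using x d.q_closed by simp
  qed
qed

section \<open>Modules of finite length\<close>

context op_group
begin

text \<open>Finite length of H/N, in the form required by \<open>W_length\<close>; the next results
  compare it with composition series.\<close>

definition has_length :: "'h set \<Rightarrow> bool" where
  "has_length N \<longleftrightarrow> (\<exists>len::'h set \<Rightarrow> nat. \<forall>A B. esub A \<and> esub B \<and> N \<subseteq> A \<and> A \<subset> B \<longrightarrow> len A < len B)"

text \<open>A composition series of H/N, pulled back to H so that no quotient has to be
  formed.\<close>

definition comp_series :: "'h set \<Rightarrow> nat \<Rightarrow> (nat \<Rightarrow> 'h set) \<Rightarrow> bool" where
  "comp_series N n F \<longleftrightarrow> F 0 = N \<and> F n = carrier H \<and> (\<forall>i\<le>n. esub (F i)) \<and>
     (\<forall>i<n. F i \<subset> F (Suc i) \<and> \<not> (\<exists>K. esub K \<and> F i \<subset> K \<and> K \<subset> F (Suc i)))"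

text \<open>The length of \<open>A\<close> is the number of steps of the series at which \<open>A\<close> grows.\<close>

lemma comp_series_has_length:
  assumes "comp_series N n F"
  shows "has_length N"
proof -
  have F: "F 0 = N" "F n = carrier H" "\<And>i. i \<le> n \<Longrightarrow> esub (F i)"
    and simple: "\<And>i K. i < n \<Longrightarrow> esub K \<Longrightarrow> F i \<subset> K \<Longrightarrow> K \<subseteq> F (Suc i) \<Longrightarrow> K = F (Suc i)"
    and step: "\<And>i. i < n \<Longrightarrow> F i \<subseteq> F (Suc i)"
    using assms unfolding comp_series_def by blast+
  define J where "J A = {i. i < n \<and> \<not> A \<inter> F (Suc i) \<subseteq> F i}" for A
  have "card (J A) < card (J B)" if A: "esub A" and B: "esub B" and NA: "N \<subseteq> A" and AB: "A \<subset> B" for A B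
  proof (rule psubset_card_mono)
    show "finite (J B)" by (simp add: J_def)
    have sub: "J A \<subseteq> J B" using AB by (auto simp: J_def)
    have "B \<subseteq> A" if eq: "J A = J B"
    proof -
      have "B \<inter> F i \<subseteq> A" if "i \<le> n" for i
        using that
      proof (induction i)
        case 0
        then show ?case using F NA by auto
      next
        case (Suc i)
        then have IH: "B \<inter> F i \<subseteq> A" and i: "i < n" by auto
        show ?case
        proof (cases "i \<in> J B")
          case False
          then have "B \<inter> F (Suc i) \<subseteq> F i" using i by (auto simp: J_def)
          then show ?thesis using IH by blast
        next
          case True
          then have iA: "\<not> A \<inter> F (Suc i) \<subseteq> F i" using eq by (auto simp: J_def)
          have e: "esub (F i)" "esub (F (Suc i))" using F i by auto
          let ?S = "ssum H (A \<inter> F (Suc i)) (F i)"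
          have AF: "esub (A \<inter> F (Suc i))" by (rule esub_Int[OF A e(2)])
          \<comment> \<open>As \<open>A\<close> grows at step i, this sum is strictly above F i, and
            simplicity of the factor makes it all of F (i + 1). An element of \<open>B\<close> can
            then be corrected by one of \<open>A\<close> into F i, where the induction hypothesis
            applies.\<close>
          have "?S = F (Suc i)"
          proof (rule simple[OF i])
            show "esub ?S" by (rule esub_ssum[OF AF e(1)])
            have "F i \<subseteq> ?S" "A \<inter> F (Suc i) \<subseteq> ?S"
              using ssum_right[OF esub_asub[OF AF] esub_asub[OF e(1)]] ssum_left[OF esub_asub[OF AF] esub_asub[OF e(1)]] by auto
            then show "F i \<subset> ?S" using iA by blast
            show "?S \<subseteq> F (Suc i)" using step[OF i] diff_mem[OF esub_asub[OF e(2)]] by (auto simp: ssum_def)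
          qed
          show ?thesis
          proof
            fix b assume b: "b \<in> B \<inter> F (Suc i)"
            then have bc: "b \<in> carrier H" using asub_subset[OF esub_asub[OF B]] by blast
            from b \<open>?S = F (Suc i)\<close> obtain a where a: "a \<in> A" "b \<ominus> a \<in> F i" by (auto simp: ssum_def)
            have "b \<ominus> a \<in> B" using asub_diff[OF esub_asub[OF B]] b a AB by blast
            then have "b \<ominus> a \<in> A" using a IH by blast
            then show "b \<in> A" by (rule diff_mem[OF esub_asub[OF A] _ a(1) bc])
          qed
        qed
      qed
      from this[of n] show "B \<subseteq> A" using F(2) asub_subset[OF esub_asub[OF B]] by blast
    qed
    then have "J A \<noteq> J B" using AB by auto
    then show "J A \<subset> J B" using sub by auto
  qed
  then show ?thesis unfolding has_length_def by (intro exI[of _ "\<lambda>A. card (J A)"]) simp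
qed

text \<open>An overgroup of least rank among those properly containing A is a minimal one, so it can
  serve as the next term. The distance of the rank to that of the carrier decreases.\<close>

lemma has_length_comp_series:
  assumes N: "esub N" and "has_length N"
  shows "\<exists>n F. comp_series N n F"
proof -
  from assms obtain len :: "'h set \<Rightarrow> nat"
    where len: "\<And>A B. esub A \<Longrightarrow> esub B \<Longrightarrow> N \<subseteq> A \<Longrightarrow> A \<subset> B \<Longrightarrow> len A < len B" unfolding has_length_def by blast
  have "\<exists>n F. comp_series A n F" if "esub A" "N \<subseteq> A" for A
    using that
  proof (induction "len (carrier H) - len A" arbitrary: A rule: less_induct)
    case less
    show ?case
    proof (cases "A = carrier H")
      case True
      then have "comp_series A 0 (\<lambda>_. A)" using less by (auto simp: comp_series_def)
      then show ?thesis by blast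
    next
      case False
      then have AH: "A \<subset> carrier H" using asub_subset[OF esub_asub[OF less.prems(1)]] by blast
      define Q where "Q B \<longleftrightarrow> esub B \<and> A \<subset> B" for B
      have "Q (carrier H)" using AH esub_carrier by (simp add: Q_def)
      from ex_has_least_nat[of Q, OF this, of len] obtain B where
        B: "Q B" "\<And>C. Q C \<Longrightarrow> len B \<le> len C" by blast
      have eB: "esub B" "A \<subset> B" using B(1) by (auto simp: Q_def)
      have "len A < len B" using len less.prems eB by blast
      moreover have "len A < len (carrier H)" using len less.prems AH esub_carrier by blast
      ultimately have "len (carrier H) - len B < len (carrier H) - len A" by linarith
      moreover have "N \<subseteq> B" using less.prems eB by blast
      ultimately obtain n F where F: "comp_series B n F" using less.hyps[of B] eB(1) by blast
      have no: "\<not> (\<exists>K. esub K \<and> A \<subset> K \<and> K \<subset> B)"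
      proof
        assume "\<exists>K. esub K \<and> A \<subset> K \<and> K \<subset> B"
        then obtain K where K: "esub K" "A \<subset> K" "K \<subset> B" by blast
        then have "Q K" by (simp add: Q_def)
        moreover have "N \<subseteq> K" using K(2) less.prems(2) by blast
        then have "len K < len B" using len K eB by blast
        ultimately show False using B(2) by fastforce
      qed
      have "comp_series A (Suc n) (\<lambda>i. case i of 0 \<Rightarrow> A | Suc j \<Rightarrow> F j)"
        using F no eB less.prems by (auto simp: comp_series_def split: nat.split)
      then show ?thesis by blast
    qed
  qed
  then show ?thesis using N by blast
qed

lemma has_length_carrier: "has_length (carrier H)"
  unfolding has_length_def using asub_subset[OF esub_asub] by (intro exI[of _ "\<lambda>_. 0"]) blast

text \<open>The rank of A is that of A + N plus that of (A \<inter> N) + N': one part measures A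
  modulo N, the other its trace on N modulo N'. If neither part grows from A to B, an element of B
  is corrected into A first modulo N and then modulo N'.\<close>

lemma has_length_Int:
  assumes N: "esub N" "has_length N" and N': "esub N'" "has_length N'"
  shows "has_length (N \<inter> N')"
proof -
  from N obtain len1 :: "'h set \<Rightarrow> nat"
    where len1: "\<And>A B. esub A \<Longrightarrow> esub B \<Longrightarrow> N \<subseteq> A \<Longrightarrow> A \<subset> B \<Longrightarrow> len1 A < len1 B" unfolding has_length_def by blast
  from N' obtain len2 :: "'h set \<Rightarrow> nat"
    where len2: "\<And>A B. esub A \<Longrightarrow> esub B \<Longrightarrow> N' \<subseteq> A \<Longrightarrow> A \<subset> B \<Longrightarrow> len2 A < len2 B" unfolding has_length_def by blast
  have a: "asub H N" "asub H N'" using N N' esub_asub by auto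
  define len where "len A = len1 (ssum H A N) + len2 (ssum H (A \<inter> N) N')" for A
  have "len A < len B" if A: "esub A" and B: "esub B" and NA: "N \<inter> N' \<subseteq> A" and AB: "A \<subset> B" for A B
  proof -
    note e = esub_ssum[OF A N(1)] esub_ssum[OF B N(1)] esub_ssum[OF esub_Int[OF A N(1)] N'(1)] esub_ssum[OF esub_Int[OF B N(1)] N'(1)]
    have r: "N \<subseteq> ssum H A N" "N' \<subseteq> ssum H (A \<inter> N) N'"
      using ssum_right[OF esub_asub[OF A] a(1)] ssum_right[OF esub_asub[OF esub_Int[OF A N(1)]] a(2)] by auto
    have m: "ssum H A N \<subseteq> ssum H B N" "ssum H (A \<inter> N) N' \<subseteq> ssum H (B \<inter> N) N'"
      using AB by (intro ssum_mono; auto)+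
    have "ssum H A N \<noteq> ssum H B N \<or> ssum H (A \<inter> N) N' \<noteq> ssum H (B \<inter> N) N'"
    proof (rule ccontr)
      assume "\<not> ?thesis"
      then have eq: "ssum H A N = ssum H B N" "ssum H (A \<inter> N) N' = ssum H (B \<inter> N) N'" by auto
      have "b \<in> A" if b: "b \<in> B" for b
      proof -
        have bc: "b \<in> carrier H" by (rule asub_subset[OF esub_asub[OF B] b])
        have "b \<in> ssum H A N" using ssum_left[OF esub_asub[OF B] a(1)] b eq by blast
        then obtain x where x: "x \<in> A" "b \<ominus> x \<in> N" by (auto simp: ssum_def)
        have bx: "b \<ominus> x \<in> B" using asub_diff[OF esub_asub[OF B] b] x(1) AB by blast
        then have bxc: "b \<ominus> x \<in> carrier H" by (rule asub_subset[OF esub_asub[OF B]])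
        have "b \<ominus> x \<in> ssum H (B \<inter> N) N'" using ssum_left[OF esub_asub[OF esub_Int[OF B N(1)]] a(2)] bx x by blast
        then have "b \<ominus> x \<in> ssum H (A \<inter> N) N'" using eq by simp
        then obtain y where y: "y \<in> A" "y \<in> N" "(b \<ominus> x) \<ominus> y \<in> N'" by (auto simp: ssum_def)
        have "(b \<ominus> x) \<ominus> y \<in> N" by (rule asub_diff[OF a(1) x(2) y(2)])
        then have "(b \<ominus> x) \<ominus> y \<in> A" using y NA by blast
        then have "b \<ominus> x \<in> A" by (rule diff_mem[OF esub_asub[OF A] _ y(1) bxc])
        then show "b \<in> A" by (rule diff_mem[OF esub_asub[OF A] _ x(1) bc])
      qed
      then show False using AB by blast
    qed
    then show ?thesis
      using len1[OF e(1,2) r(1)] len2[OF e(3,4) r(2)] m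
      by (cases "ssum H A N = ssum H B N"; cases "ssum H (A \<inter> N) N' = ssum H (B \<inter> N) N'")
        (fastforce simp: len_def psubset_eq intro: add_strict_mono add_less_le_mono)+
  qed
  then show ?thesis unfolding has_length_def by (intro exI[of _ len]) simp
qed

end

section \<open>Cosets and finite length of quotient modules\<close>

lemma (in abelian_group) rcoset_coset_of:
  assumes "asub G N" "x \<in> carrier G"
  shows "N +> x = coset_of G x N"
proof -
  have "y = (y \<ominus> x) \<oplus> x" if "y \<in> carrier G" for y using assms(2) that by (simp add: agr)
  moreover have "(h \<oplus> x) \<ominus> x = h" if "h \<in> N" for h using assms(2) asub_subset[OF assms(1) that] by (simp add: agr)
  ultimately show ?thesis using assms asub_subset[OF assms(1)]
    unfolding a_r_coset_def' coset_of_def by fastforce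
qed

lemma (in abelian_group) rcosets_coset_of:
  assumes "asub G N"
  shows "a_rcosets N = (\<lambda>x. coset_of G x N) ` carrier G"
  using rcoset_coset_of[OF assms] by (auto simp: A_RCOSETS_def' )

lemma (in abelian_group) coset_of_eq_iff:
  assumes "asub G N" "x \<in> carrier G" "y \<in> carrier G"
  shows "coset_of G x N = coset_of G y N \<longleftrightarrow> x \<ominus> y \<in> N"
proof
  assume "coset_of G x N = coset_of G y N"
  moreover have "x \<in> coset_of G x N" using assms asub_zero by (simp add: coset_of_def)
  ultimately show "x \<ominus> y \<in> N" by (simp add: coset_of_def)
next
  assume "x \<ominus> y \<in> N"
  then have "x \<in> coset_of G y N" using assms by (simp add: coset_of_def)
  from coset_of_eq[OF assms(1,3) this] show "coset_of G x N = coset_of G y N" by simp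
qed

lemma (in abelian_group) coset_of_add:
  assumes N: "asub G N" and x: "x \<in> carrier G" and y: "y \<in> carrier G"
  shows "coset_of G x N <+> coset_of G y N = coset_of G (x \<oplus> y) N"
proof
  show "coset_of G x N <+> coset_of G y N \<subseteq> coset_of G (x \<oplus> y) N"
    using diff_add2[OF N] x y by (auto simp: coset_of_def set_add_def')
  show "coset_of G (x \<oplus> y) N \<subseteq> coset_of G x N <+> coset_of G y N"
  proof
    fix z assume z: "z \<in> coset_of G (x \<oplus> y) N"
    then have zc: "z \<in> carrier G" "z \<ominus> (x \<oplus> y) \<in> N" by (auto simp: coset_of_def)
    have "(z \<ominus> y) \<ominus> x = z \<ominus> (x \<oplus> y)" "z = (z \<ominus> y) \<oplus> y" using zc(1) x y by (simp_all add: agr)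
    then show "z \<in> coset_of G x N <+> coset_of G y N"
      using zc x y asub_zero[OF N] unfolding coset_of_def set_add_def'
      by (intro UN_I[of "z \<ominus> y"] UN_I[of y]) auto
  qed
qed

text \<open>The scalar multiplication of \<open>restrict_scalars\<close>, isolated as an operator on
  M itself, so that \<open>op_group\<close> applies without changing the record.\<close>

definition ract :: "('r, 'l) module \<Rightarrow> ('l, 'm) module \<Rightarrow> 'r \<Rightarrow> 'm \<Rightarrow> 'm" where
  "ract L M r x = (r \<odot>\<^bsub>L\<^esub> \<one>\<^bsub>L\<^esub>) \<odot>\<^bsub>M\<^esub> x"

context left_module
begin

lemma submodule_iff: "submodule N L M \<longleftrightarrow> asub M N \<and> (\<forall>a\<in>carrier L. \<forall>x\<in>N. a \<odot>\<^bsub>M\<^esub> x \<in> N)"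
  using M.asub_subgroup by (auto simp: submodule_def submodule_axioms_def)

lemma submodule_asub: "submodule N L M \<Longrightarrow> asub M N"
  by (simp add: submodule_iff)

lemma submodule_carrier: "submodule (carrier M) L M"
  by (simp add: submodule_iff M.asub_carrier smult_closed)

lemma submodule_Int: "submodule N L M \<Longrightarrow> submodule N' L M \<Longrightarrow> submodule (N \<inter> N') L M"
  by (simp add: submodule_iff M.asub_Int)

lemma smult_diff: "\<lbrakk>a \<in> carrier L; x \<in> carrier M; y \<in> carrier M\<rbrakk>
    \<Longrightarrow> a \<odot>\<^bsub>M\<^esub> (x \<ominus>\<^bsub>M\<^esub> y) = a \<odot>\<^bsub>M\<^esub> x \<ominus>\<^bsub>M\<^esub> a \<odot>\<^bsub>M\<^esub> y"
  by (rule M.add_map_diff) (auto simp: smult_closed smult_r_distr M.abelian_group_axioms)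

lemma smult_zero: "a \<in> carrier L \<Longrightarrow> a \<odot>\<^bsub>M\<^esub> \<zero>\<^bsub>M\<^esub> = \<zero>\<^bsub>M\<^esub>"
  using smult_diff[of a "\<zero>\<^bsub>M\<^esub>" "\<zero>\<^bsub>M\<^esub>"] smult_closed[of a "\<zero>\<^bsub>M\<^esub>"] by simp

end

locale ralgebra =
  fixes R :: "'r ring" and L :: "('r, 'l) module"
  assumes alg: "assoc_algebra R L"
begin

lemma ringL: "ring L"
  using alg by (simp add: assoc_algebra_def)

lemma scalar_closed: "r \<in> carrier R \<Longrightarrow> r \<odot>\<^bsub>L\<^esub> \<one>\<^bsub>L\<^esub> \<in> carrier L"
  using alg ring.ring_simprules(6)[OF ringL] by (auto simp: assoc_algebra_def intro: module.smult_closed)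

text \<open>Needed for scalars of R to act on a left module by endomorphisms over L, see
  \<open>ract_E\<close>.\<close>

lemma scalar_central: "r \<in> carrier R \<Longrightarrow> a \<in> carrier L
    \<Longrightarrow> (r \<odot>\<^bsub>L\<^esub> \<one>\<^bsub>L\<^esub>) \<otimes>\<^bsub>L\<^esub> a = a \<otimes>\<^bsub>L\<^esub> (r \<odot>\<^bsub>L\<^esub> \<one>\<^bsub>L\<^esub>)"
proof -
  assume r: "r \<in> carrier R" and a: "a \<in> carrier L"
  interpret L: ring L by (rule ringL)
  have "(r \<odot>\<^bsub>L\<^esub> \<one>\<^bsub>L\<^esub>) \<otimes>\<^bsub>L\<^esub> a = r \<odot>\<^bsub>L\<^esub> (\<one>\<^bsub>L\<^esub> \<otimes>\<^bsub>L\<^esub> a)"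
    using alg r a L.one_closed unfolding assoc_algebra_def by blast
  also have "\<dots> = r \<odot>\<^bsub>L\<^esub> (a \<otimes>\<^bsub>L\<^esub> \<one>\<^bsub>L\<^esub>)" using a by simp
  also have "\<dots> = a \<otimes>\<^bsub>L\<^esub> (r \<odot>\<^bsub>L\<^esub> \<one>\<^bsub>L\<^esub>)"
    using alg r a L.one_closed unfolding assoc_algebra_def by metis
  finally show ?thesis .
qed

lemma op_group_ract: "left_module L M \<Longrightarrow> op_group M (carrier R) (ract L M)"
proof -
  assume "left_module L M"
  then interpret left_module L M .
  show ?thesis
    by unfold_locales (auto simp: ract_def scalar_closed smult_closed smult_r_distr)
qed

lemma submodule_esub: "left_module L M \<Longrightarrow> submodule N L M \<Longrightarrow> op_group.esub M (carrier R) (ract L M) N"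
  by (simp add: op_group.esub_def[OF op_group_ract] left_module.submodule_iff ract_def scalar_closed)

abbreviation has_rlength :: "('l, 'm) module \<Rightarrow> 'm set \<Rightarrow> bool" where
  "has_rlength M \<equiv> op_group.has_length M (carrier R) (ract L M)"

text \<open>The correspondence theorem: \<open>pre\<close> and the image under \<open>cl\<close> are
  inverse monotone bijections between the R-submodules of M/N and those of M above N. It is the
  bridge from composition series of quotient records to rank functions on M.\<close>

lemma finite_length_quot:
  fixes M :: "('l, 'm) module"
  assumes LM: "left_module L M" and N: "submodule N L M"
  shows "finite_length R (restrict_scalars L (quot_module M N)) \<longleftrightarrow> has_rlength M N"
proof -
  interpret M: op_group M "carrier R" "ract L M" by (rule op_group_ract[OF LM])
  interpret L: left_module L M by (rule LM)
  have Na: "asub M N" by (rule L.submodule_asub[OF N])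
  have Ne: "M.esub N" by (rule submodule_esub[OF LM N])
  define Q where "Q = restrict_scalars L (quot_module M N)"
  define cl where "cl x = coset_of M x N" for x
  have cl_eq: "cl x = cl y \<longleftrightarrow> x \<ominus>\<^bsub>M\<^esub> y \<in> N" if "x \<in> carrier M" "y \<in> carrier M" for x y
    unfolding cl_def by (rule M.coset_of_eq_iff[OF Na that])
  have cQ: "carrier Q = cl ` carrier M"
    unfolding Q_def cl_def restrict_scalars_def quot_module_def by (simp add: M.rcosets_coset_of[OF Na])
  have cl0: "cl \<zero>\<^bsub>M\<^esub> = N"
    unfolding cl_def coset_of_def using M.asub_subset[OF Na] by auto
  have zQ: "\<zero>\<^bsub>Q\<^esub> = cl \<zero>\<^bsub>M\<^esub>"
    unfolding cl0 by (simp add: Q_def restrict_scalars_def quot_module_def)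
  have aQ: "cl x \<oplus>\<^bsub>Q\<^esub> cl y = cl (x \<oplus>\<^bsub>M\<^esub> y)" if "x \<in> carrier M" "y \<in> carrier M" for x y
    using M.coset_of_add[OF Na that] by (simp add: Q_def restrict_scalars_def quot_module_def cl_def)
  \<comment> \<open>\<open>quot_module\<close> multiplies a coset through a union over all its
    elements; these all give the same coset because N is stable under R.\<close>
  have sQ: "r \<odot>\<^bsub>Q\<^esub> cl x = cl (ract L M r x)" if r: "r \<in> carrier R" and x: "x \<in> carrier M" for r x
  proof -
    have "N +>\<^bsub>M\<^esub> ract L M r y = cl (ract L M r x)" if y: "y \<in> cl x" for y
    proof -
      have yc: "y \<in> carrier M" "y \<ominus>\<^bsub>M\<^esub> x \<in> N" using y by (auto simp: cl_def coset_of_def)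
      have "ract L M r y \<ominus>\<^bsub>M\<^esub> ract L M r x \<in> N"
        using M.esub_act[OF Ne r yc(2)] by (simp add: M.act_diff[OF r yc(1) x])
      then show ?thesis
        using cl_eq[OF M.act_closed[OF r yc(1)] M.act_closed[OF r x]]
        by (simp add: M.rcoset_coset_of[OF Na M.act_closed[OF r yc(1)]] flip: cl_def)
    qed
    moreover have "x \<in> cl x" unfolding cl_def by (rule M.coset_of_self[OF Na x])
    moreover have "r \<odot>\<^bsub>Q\<^esub> cl x = (\<Union>y\<in>cl x. N +>\<^bsub>M\<^esub> ract L M r y)"
      by (simp add: Q_def restrict_scalars_def quot_module_def ract_def)
    ultimately show ?thesis by auto
  qed
  have "abelian_group Q"
  proof (rule abelian_groupI)
    show "\<exists>y\<in>carrier Q. y \<oplus>\<^bsub>Q\<^esub> x = \<zero>\<^bsub>Q\<^esub>" if x: "x \<in> carrier Q" for x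
    proof -
      from x obtain a where a: "a \<in> carrier M" "x = cl a" by (auto simp: cQ)
      then have "cl (\<ominus>\<^bsub>M\<^esub> a) \<oplus>\<^bsub>Q\<^esub> x = \<zero>\<^bsub>Q\<^esub>" by (simp add: aQ zQ M.l_neg)
      then show ?thesis using a by (auto simp: cQ)
    qed
  qed (auto simp: cQ zQ aQ M.a_ac)
  then interpret Q: abelian_group Q .
  have dQ: "cl (x \<ominus>\<^bsub>M\<^esub> y) = cl x \<ominus>\<^bsub>Q\<^esub> cl y" if "x \<in> carrier M" "y \<in> carrier M" for x y
    by (rule M.add_map_diff[OF Q.abelian_group_axioms _ _ that]) (auto simp: cQ aQ)
  have subQ: "submodule F R Q \<longleftrightarrow> asub Q F \<and> (\<forall>r\<in>carrier R. \<forall>C\<in>F. r \<odot>\<^bsub>Q\<^esub> C \<in> F)" for F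
    using Q.asub_subgroup by (auto simp: submodule_def submodule_axioms_def)
  define pre where "pre F = {x \<in> carrier M. cl x \<in> F}" for F
  have img: "submodule (cl ` A) R Q" if A: "M.esub A" for A
    unfolding subQ asub_def
  proof (intro conjI ballI)
    have Ac: "x \<in> A \<Longrightarrow> x \<in> carrier M" for x by (rule M.asub_subset[OF M.esub_asub[OF A]])
    show "cl ` A \<subseteq> carrier Q" using Ac by (auto simp: cQ)
    show "\<zero>\<^bsub>Q\<^esub> \<in> cl ` A" using M.asub_zero[OF M.esub_asub[OF A]] by (simp add: zQ)
    show "x \<ominus>\<^bsub>Q\<^esub> y \<in> cl ` A" if "x \<in> cl ` A" "y \<in> cl ` A" for x y
      using that Ac M.asub_diff[OF M.esub_asub[OF A]] by (auto simp: dQ[symmetric])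
    show "r \<odot>\<^bsub>Q\<^esub> C \<in> cl ` A" if "r \<in> carrier R" "C \<in> cl ` A" for r C
      using that Ac M.esub_act[OF A] by (auto simp: sQ)
  qed
  have pre: "M.esub (pre F)" "N \<subseteq> pre F" "cl ` pre F = F" if F: "submodule F R Q" for F
  proof -
    have Fa: "asub Q F" and Fs: "\<And>r C. r \<in> carrier R \<Longrightarrow> C \<in> F \<Longrightarrow> r \<odot>\<^bsub>Q\<^esub> C \<in> F" using F by (auto simp: subQ)
    have "asub M {u \<in> carrier M. cl u \<in> F}"
      by (rule M.asub_vimage[OF M.asub_carrier Q.abelian_group_axioms Fa]) (auto simp: dQ cQ)
    then show "M.esub (pre F)"
      using Fs by (auto simp: M.esub_def pre_def M.act_closed sQ[symmetric])
    have "cl x = \<zero>\<^bsub>Q\<^esub>" if "x \<in> N" for x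
      unfolding zQ using that M.asub_subset[OF Na that] by (simp add: cl_eq)
    then show "N \<subseteq> pre F" using M.asub_subset[OF Na] Q.asub_zero[OF Fa] by (auto simp: pre_def)
    show "cl ` pre F = F" using Q.asub_subset[OF Fa] by (auto simp: pre_def cQ)
  qed
  have pre_cl: "pre (cl ` A) = A" if A: "M.esub A" "N \<subseteq> A" for A
  proof
    have Ac: "x \<in> A \<Longrightarrow> x \<in> carrier M" for x by (rule M.asub_subset[OF M.esub_asub[OF A(1)]])
    show "A \<subseteq> pre (cl ` A)" using Ac by (auto simp: pre_def)
    show "pre (cl ` A) \<subseteq> A"
    proof
      fix x assume "x \<in> pre (cl ` A)"
      then obtain a where a: "a \<in> A" "cl x = cl a" "x \<in> carrier M" by (auto simp: pre_def)
      then have "x \<ominus>\<^bsub>M\<^esub> a \<in> A" using Ac A(2) by (auto simp: cl_eq)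
      then show "x \<in> A" by (rule M.diff_mem[OF M.esub_asub[OF A(1)] _ a(1,3)])
    qed
  qed
  have pre_mono: "pre F \<subset> pre G" if "submodule F R Q" "submodule G R Q" "F \<subset> G" for F G
  proof -
    have "pre F \<subseteq> pre G" using that by (auto simp: pre_def)
    moreover have "pre F \<noteq> pre G"
    proof
      assume "pre F = pre G"
      then have "cl ` pre F = cl ` pre G" by (rule arg_cong)
      then have "F = G" unfolding pre(3)[OF that(1)] pre(3)[OF that(2)] .
      then show False using that(3) by simp
    qed
    ultimately show ?thesis by (rule psubsetI)
  qed
  have cl_mono: "cl ` A \<subset> cl ` B" if "M.esub A" "N \<subseteq> A" "M.esub B" "A \<subset> B" for A B
  proof -
    have "cl ` A \<subseteq> cl ` B" using that by blast
    moreover have "cl ` A \<noteq> cl ` B"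
    proof
      assume "cl ` A = cl ` B"
      then have eq: "pre (cl ` A) = pre (cl ` B)" by (rule arg_cong)
      have "N \<subseteq> B" using that(2,4) by blast
      then have "A = B" using eq unfolding pre_cl[OF that(1,2)] by (simp only: pre_cl[OF that(3)])
      then show False using that(4) by simp
    qed
    ultimately show ?thesis by (rule psubsetI)
  qed
  show ?thesis unfolding Q_def[symmetric]
  proof
    assume "finite_length R Q"
    then obtain n F where F0: "F 0 = {\<zero>\<^bsub>Q\<^esub>} \<and> F n = carrier Q \<and> (\<forall>i\<le>n. submodule (F i) R Q) \<and>
        (\<forall>i<n. F i \<subset> F (Suc i) \<and> \<not> (\<exists>H. submodule H R Q \<and> F i \<subset> H \<and> H \<subset> F (Suc i)))"
      unfolding finite_length_def by (elim exE)
    then have F: "F 0 = {\<zero>\<^bsub>Q\<^esub>}" "F n = carrier Q" "\<And>i. i \<le> n \<Longrightarrow> submodule (F i) R Q"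
      "\<And>i. i < n \<Longrightarrow> F i \<subset> F (Suc i)" by simp_all
    have F5: False if "i < n" "submodule H R Q" "F i \<subset> H" "H \<subset> F (Suc i)" for i H using F0 that by meson
    have "M.comp_series N n (\<lambda>i. pre (F i))" unfolding M.comp_series_def
    proof (intro conjI allI impI)
      show "pre (F 0) = N"
        using cl_eq[of _ "\<zero>\<^bsub>M\<^esub>"] M.asub_subset[OF Na] by (auto simp: pre_def F(1) zQ)
      show "pre (F n) = carrier M" by (auto simp: pre_def F(2) cQ)
      show "M.esub (pre (F i))" if "i \<le> n" for i by (rule pre(1)[OF F(3)[OF that]])
      show "pre (F i) \<subset> pre (F (Suc i))" if "i < n" for i using that by (intro pre_mono F) auto
      show "\<not> (\<exists>K. M.esub K \<and> pre (F i) \<subset> K \<and> K \<subset> pre (F (Suc i)))" if i: "i < n" for i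
      proof
        assume "\<exists>K. M.esub K \<and> pre (F i) \<subset> K \<and> K \<subset> pre (F (Suc i))"
        then obtain K where K: "M.esub K" "pre (F i) \<subset> K" "K \<subset> pre (F (Suc i))" by (elim exE conjE)
        have Fi: "submodule (F i) R Q" "submodule (F (Suc i)) R Q" using i by (auto intro: F)
        have NK: "N \<subseteq> pre (F i)" "N \<subseteq> K" using pre(2)[OF Fi(1)] K(2) by auto
        have "cl ` pre (F i) \<subset> cl ` K" by (rule cl_mono[OF pre(1)[OF Fi(1)] NK(1) K(1,2)])
        moreover have "cl ` K \<subset> cl ` pre (F (Suc i))" by (rule cl_mono[OF K(1) NK(2) pre(1)[OF Fi(2)] K(3)])
        ultimately show False using F5[OF i img[OF K(1)]] pre(3)[OF Fi(1)] pre(3)[OF Fi(2)] by simp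
      qed
    qed
    then show "M.has_length N" by (rule M.comp_series_has_length)
  next
    assume "M.has_length N"
    from M.has_length_comp_series[OF Ne this] obtain n F where F: "M.comp_series N n F" by (elim exE)
    then have F: "F 0 = N" "F n = carrier M" "\<And>i. i \<le> n \<Longrightarrow> M.esub (F i)"
      "\<And>i. i < n \<Longrightarrow> F i \<subset> F (Suc i)"
      unfolding M.comp_series_def by simp_all
    have F5: False if "i < n" "M.esub H" "F i \<subset> H" "H \<subset> F (Suc i)" for i H
      using \<open>M.comp_series N n F\<close> that unfolding M.comp_series_def by meson
    have NF: "N \<subseteq> F i" if "i \<le> n" for i
      using that
    proof (induction i)
      case (Suc i)
      then have "N \<subseteq> F i" "F i \<subset> F (Suc i)" using F(4) by auto
      then show ?case by blast
    qed (simp add: F(1))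
    show "finite_length R Q" unfolding finite_length_def
    proof (intro exI conjI allI impI)
      have "cl x = \<zero>\<^bsub>Q\<^esub>" if "x \<in> N" for x
        unfolding zQ using that M.asub_subset[OF Na that] by (simp add: cl_eq)
      then show "cl ` F 0 = {\<zero>\<^bsub>Q\<^esub>}" using M.asub_zero[OF Na] unfolding F(1) by blast
      show "cl ` F n = carrier Q" by (simp add: F(2) cQ)
      show "submodule (cl ` F i) R Q" if "i \<le> n" for i by (rule img[OF F(3)[OF that]])
      show "cl ` F i \<subset> cl ` F (Suc i)" if "i < n" for i using that by (intro cl_mono F(3,4) NF) simp_all
      show "\<not> (\<exists>H. submodule H R Q \<and> cl ` F i \<subset> H \<and> H \<subset> cl ` F (Suc i))" if i: "i < n" for i
      proof
        assume "\<exists>H. submodule H R Q \<and> cl ` F i \<subset> H \<and> H \<subset> cl ` F (Suc i)"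
        then obtain H where H: "submodule H R Q" "cl ` F i \<subset> H" "H \<subset> cl ` F (Suc i)" by (elim exE conjE)
        have e: "M.esub (F i)" "M.esub (F (Suc i))" using i by (auto intro!: F(3))
        have "pre (cl ` F i) \<subset> pre H" by (rule pre_mono[OF img[OF e(1)] H(1,2)])
        moreover have "pre H \<subset> pre (cl ` F (Suc i))" by (rule pre_mono[OF H(1) img[OF e(2)] H(3)])
        moreover have "pre (cl ` F i) = F i" "pre (cl ` F (Suc i)) = F (Suc i)"
          using i by (auto intro!: pre_cl e NF del: subsetI)
        ultimately show False using F5[OF i pre(1)[OF H(1)]] by simp
      qed
    qed
  qed
qed

end

text \<open>The quotient by the preimage of K embeds in B/K, so the rank of f(U) + K serves as the
  rank of U.\<close>

lemma op_group_has_length_vimage: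
  assumes A: "op_group A E actA" and B: "op_group B E actB"
    and f: "\<And>x. x \<in> carrier A \<Longrightarrow> f x \<in> carrier B"
    and fa: "\<And>x y. x \<in> carrier A \<Longrightarrow> y \<in> carrier A \<Longrightarrow> f (x \<oplus>\<^bsub>A\<^esub> y) = f x \<oplus>\<^bsub>B\<^esub> f y"
    and fe: "\<And>e x. e \<in> E \<Longrightarrow> x \<in> carrier A \<Longrightarrow> f (actA e x) = actB e (f x)"
    and K: "op_group.esub B E actB K" "op_group.has_length B E actB K"
  shows "op_group.has_length A E actA {x \<in> carrier A. f x \<in> K}"
proof -
  interpret A: op_group A E actA by (rule A)
  interpret B: op_group B E actB by (rule B)
  have fd: "f (x \<ominus>\<^bsub>A\<^esub> y) = f x \<ominus>\<^bsub>B\<^esub> f y" if "x \<in> carrier A" "y \<in> carrier A" for x y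
    by (rule A.add_map_diff[OF B.abelian_group_axioms f fa that])
  from K obtain len :: "_ set \<Rightarrow> nat"
    where len: "\<And>A C. B.esub A \<Longrightarrow> B.esub C \<Longrightarrow> K \<subseteq> A \<Longrightarrow> A \<subset> C \<Longrightarrow> len A < len C"
    unfolding B.has_length_def by blast
  have Ka: "asub B K" by (rule B.esub_asub[OF K(1)])
  define im where "im U = {b \<in> carrier B. \<exists>u\<in>U. b \<ominus>\<^bsub>B\<^esub> f u \<in> K}" for U
  have im_self: "f u \<in> im U" if "u \<in> U" "A.esub U" for u U
    using that A.asub_subset[OF A.esub_asub] f B.asub_zero[OF Ka] by (auto simp: im_def intro!: bexI[of _ u])
  have f0: "f \<zero>\<^bsub>A\<^esub> = \<zero>\<^bsub>B\<^esub>" using fd[of "\<zero>\<^bsub>A\<^esub>" "\<zero>\<^bsub>A\<^esub>"] f by simp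
  have im_K: "K \<subseteq> im U" if "A.esub U" for U
    using A.asub_zero[OF A.esub_asub[OF that]] B.asub_subset[OF Ka] by (auto simp: im_def f0 intro!: bexI[of _ "\<zero>\<^bsub>A\<^esub>"])
  have im_esub: "B.esub (im U)" if U: "A.esub U" for U
    unfolding B.esub_def asub_def
  proof (intro conjI ballI)
    have Uc: "u \<in> U \<Longrightarrow> u \<in> carrier A" for u by (rule A.asub_subset[OF A.esub_asub[OF U]])
    show "im U \<subseteq> carrier B" by (auto simp: im_def)
    show "\<zero>\<^bsub>B\<^esub> \<in> im U" using im_K[OF U] B.asub_zero[OF Ka] by blast
    fix x assume "x \<in> im U"
    then obtain u where u: "x \<in> carrier B" "u \<in> U" "x \<ominus>\<^bsub>B\<^esub> f u \<in> K" by (auto simp: im_def)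
    { fix y assume "y \<in> im U"
      then obtain w where w: "y \<in> carrier B" "w \<in> U" "y \<ominus>\<^bsub>B\<^esub> f w \<in> K" by (auto simp: im_def)
      have "(x \<ominus>\<^bsub>B\<^esub> y) \<ominus>\<^bsub>B\<^esub> f (u \<ominus>\<^bsub>A\<^esub> w) \<in> K"
        unfolding fd[OF Uc[OF u(2)] Uc[OF w(2)]]
        by (rule B.diff_diff2[OF Ka u(3) w(3)]) (use u w Uc f in auto)
      then show "x \<ominus>\<^bsub>B\<^esub> y \<in> im U" using u w A.asub_diff[OF A.esub_asub[OF U] u(2) w(2)] by (auto simp: im_def)
    next
      fix e assume e: "e \<in> E"
      have "actB e (x \<ominus>\<^bsub>B\<^esub> f u) \<in> K" by (rule B.esub_act[OF K(1) e u(3)])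
      then have "actB e x \<ominus>\<^bsub>B\<^esub> f (actA e u) \<in> K" using e u Uc f by (simp add: fe B.act_diff)
      then show "actB e x \<in> im U" using e u A.esub_act[OF U e u(2)] by (auto simp: im_def B.act_closed) }
  qed
  have "len (im U) < len (im V)"
    if U: "A.esub U" and V: "A.esub V" and KU: "{x \<in> carrier A. f x \<in> K} \<subseteq> U" and UV: "U \<subset> V" for U V
  proof (rule len[OF im_esub[OF U] im_esub[OF V] im_K[OF U]])
    from UV obtain v where v: "v \<in> V" "v \<notin> U" by auto
    have vc: "v \<in> carrier A" by (rule A.asub_subset[OF A.esub_asub[OF V] v(1)])
    have "f v \<notin> im U"
    proof
      assume "f v \<in> im U"
      then obtain u where u: "u \<in> U" "f v \<ominus>\<^bsub>B\<^esub> f u \<in> K" by (auto simp: im_def)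
      have uc: "u \<in> carrier A" by (rule A.asub_subset[OF A.esub_asub[OF U] u(1)])
      have "v \<ominus>\<^bsub>A\<^esub> u \<in> U" using u uc vc KU by (auto simp: fd subset_iff)
      then show False using A.diff_mem[OF A.esub_asub[OF U] _ u(1) vc] v by blast
    qed
    moreover have "f v \<in> im V" by (rule im_self[OF v(1) V])
    moreover have "im U \<subseteq> im V" using UV by (auto simp: im_def)
    ultimately show "im U \<subset> im V" by (metis psubsetI)
  qed
  then show ?thesis unfolding A.has_length_def by (intro exI[of _ "\<lambda>U. len (im U)"]) simp
qed

section \<open>Pseudocompact modules by neighbourhoods of zero\<close>

locale tmod = ralgebra R L + left_module L M
  for R :: "'r ring" and L :: "('r, 'l) module" and M :: "('l, 'm) module" (structure) +
  fixes TL :: "'l topology" and TM :: "'m topology"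
  assumes topspaceL: "topspace TL = carrier L"
    and topspaceM: "topspace TM = carrier M"
    and cont_add: "continuous_map (prod_topology TM TM) TM (\<lambda>(x, y). x \<oplus>\<^bsub>M\<^esub> y)"
    and cont_neg: "continuous_map TM TM (\<lambda>x. \<ominus>\<^bsub>M\<^esub> x)"
    and cont_smult: "continuous_map (prod_topology TL TM) TM (\<lambda>(a, x). a \<odot>\<^bsub>M\<^esub> x)"

sublocale tmod \<subseteq> rop: op_group M "carrier R" "ract L M"
  by (rule op_group_ract) unfold_locales

context tmod
begin

lemma topological_module: "topological_module L TL M TM"
  unfolding topological_module_def using topspaceM cont_add cont_neg cont_smult left_module_axioms by blast

lemma open_translate:
  assumes U: "openin TM U" and c: "c \<in> carrier M"
  shows "openin TM {y \<in> carrier M. y \<ominus>\<^bsub>M\<^esub> c \<in> U}"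
proof -
  have "continuous_map TM TM ((\<lambda>(x, y). x \<oplus>\<^bsub>M\<^esub> y) \<circ> (\<lambda>y. (y, \<ominus>\<^bsub>M\<^esub> c)))"
    by (rule continuous_map_compose[OF _ cont_add]) (use c topspaceM in \<open>auto intro!: continuous_map_pairedI\<close>)
  from openin_continuous_map_preimage[OF this U] show ?thesis
    by (simp add: topspaceM a_minus_def)
qed

lemma open_translate': "openin TM U \<Longrightarrow> c \<in> carrier M \<Longrightarrow> openin TM {y \<in> carrier M. y \<oplus>\<^bsub>M\<^esub> c \<in> U}"
  using open_translate[of U "\<ominus>\<^bsub>M\<^esub> c"] by (simp add: M.minus_eq M.minus_minus)

definition nb :: "'m set set" where
  "nb = {N. submodule N L M \<and> openin TM N \<and> rop.has_length N}"

lemma nb_eq: "{N. submodule N L M \<and> openin TM N \<and> finite_length R (restrict_scalars L (quot_module M N))} = nb"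
  unfolding nb_def using finite_length_quot[OF left_module_axioms] by blast

lemma nb_submodule: "N \<in> nb \<Longrightarrow> submodule N L M"
  and nb_open: "N \<in> nb \<Longrightarrow> openin TM N"
  and nb_length: "N \<in> nb \<Longrightarrow> rop.has_length N"
  by (auto simp: nb_def)

lemma nb_asub: "N \<in> nb \<Longrightarrow> asub M N"
  by (rule submodule_asub[OF nb_submodule])

lemma nb_zero: "N \<in> nb \<Longrightarrow> \<zero>\<^bsub>M\<^esub> \<in> N"
  by (rule M.asub_zero[OF nb_asub])

lemma nb_esub: "N \<in> nb \<Longrightarrow> rop.esub N"
  by (rule submodule_esub[OF left_module_axioms nb_submodule])

lemma nb_carrier: "carrier M \<in> nb"
  unfolding nb_def using submodule_carrier openin_topspace[of TM] rop.has_length_carrier by (simp add: topspaceM)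

lemma nb_Int: "N \<in> nb \<Longrightarrow> N' \<in> nb \<Longrightarrow> N \<inter> N' \<in> nb"
  using rop.has_length_Int[OF nb_esub nb_length nb_esub nb_length]
  by (auto simp: nb_def submodule_Int)

lemma nb_Inter: "finite F \<Longrightarrow> F \<subseteq> nb \<Longrightarrow> carrier M \<inter> \<Inter>F \<in> nb"
proof (induction F rule: finite_induct)
  case (insert N F)
  then have "N \<inter> (carrier M \<inter> \<Inter>F) \<in> nb" using nb_Int[of N "carrier M \<inter> \<Inter>F"] by auto
  moreover have "N \<inter> (carrier M \<inter> \<Inter>F) = carrier M \<inter> \<Inter>(insert N F)" by auto
  ultimately show ?case by simp
qed (simp add: nb_carrier)

lemma coset_open: "openin TM N \<Longrightarrow> c \<in> carrier M \<Longrightarrow> openin TM (coset_of M c N)"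
  unfolding coset_of_def by (rule open_translate)

lemma open_coset_nb:
  assumes base: "\<And>U. openin TM U \<Longrightarrow> \<zero>\<^bsub>M\<^esub> \<in> U \<Longrightarrow> \<exists>N\<in>nb. N \<subseteq> U"
    and U: "openin TM U" and x: "x \<in> U"
  shows "\<exists>N\<in>nb. coset_of M x N \<subseteq> U"
proof -
  have xc: "x \<in> carrier M" using U x openin_subset topspaceM by blast
  have "\<exists>N\<in>nb. N \<subseteq> {y \<in> carrier M. y \<oplus>\<^bsub>M\<^esub> x \<in> U}"
    using x xc by (intro base open_translate'[OF U]) auto
  then obtain N where N: "N \<in> nb" "N \<subseteq> {y \<in> carrier M. y \<oplus>\<^bsub>M\<^esub> x \<in> U}" by blast
  have "y \<in> U" if y: "y \<in> coset_of M x N" for y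
  proof -
    have yc: "y \<in> carrier M" "y \<ominus>\<^bsub>M\<^esub> x \<in> N" using y by (auto simp: coset_of_def)
    then have "(y \<ominus>\<^bsub>M\<^esub> x) \<oplus>\<^bsub>M\<^esub> x \<in> U" using N by blast
    moreover have "(y \<ominus>\<^bsub>M\<^esub> x) \<oplus>\<^bsub>M\<^esub> x = y" using xc yc(1) by (simp add: M.agr)
    ultimately show ?thesis by simp
  qed
  then show ?thesis using N by blast
qed

section \<open>Comparison with the inverse limit of finite length quotients\<close>

definition cosets_map :: "'m \<Rightarrow> 'm set \<Rightarrow> 'm set" where
  "cosets_map x = (\<lambda>N\<in>nb. coset_of M x N)"

definition limit_top :: "('m set \<Rightarrow> 'm set) topology" where
  "limit_top = subtopology (product_topology (\<lambda>N. discrete_topology (a_rcosets\<^bsub>M\<^esub> N)) nb) (quotient_limit M nb)"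

lemma is_limit_iff: "is_limit_of_quotients M TM nb \<longleftrightarrow> homeomorphic_map TM limit_top cosets_map"
proof -
  have "(\<lambda>N\<in>nb. N +>\<^bsub>M\<^esub> x) = cosets_map x" if "x \<in> topspace TM" for x
    unfolding cosets_map_def using that by (intro restrict_ext M.rcoset_coset_of nb_asub) (simp_all add: topspaceM)
  then show ?thesis unfolding is_limit_of_quotients_def limit_top_def
    by (metis (mono_tags, lifting) homeomorphic_map_eq)
qed

lemma topspace_limit: "topspace limit_top = quotient_limit M nb"
  unfolding limit_top_def by (auto simp: quotient_limit_def)

lemma cosets_map_in: "x \<in> carrier M \<Longrightarrow> cosets_map x \<in> quotient_limit M nb"
  unfolding quotient_limit_def cosets_map_def
  using M.rcosets_coset_of[OF nb_asub] M.coset_of_subset by auto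

lemma quotient_limit_rep:
  assumes c: "c \<in> quotient_limit M nb"
  obtains a where "\<And>N. N \<in> nb \<Longrightarrow> a N \<in> carrier M" "c = (\<lambda>N\<in>nb. coset_of M (a N) N)"
    "\<And>N N'. N \<in> nb \<Longrightarrow> N' \<in> nb \<Longrightarrow> N \<subseteq> N' \<Longrightarrow> a N \<ominus>\<^bsub>M\<^esub> a N' \<in> N'"
proof -
  have "\<exists>a. a \<in> carrier M \<and> c N = coset_of M a N" if "N \<in> nb" for N
  proof -
    have "c N \<in> a_rcosets\<^bsub>M\<^esub> N" using c that by (auto simp: quotient_limit_def)
    then show ?thesis unfolding M.rcosets_coset_of[OF nb_asub[OF that]] by blast
  qed
  then obtain a where a: "\<And>N. N \<in> nb \<Longrightarrow> a N \<in> carrier M" "\<And>N. N \<in> nb \<Longrightarrow> c N = coset_of M (a N) N" by metis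
  show thesis
  proof (rule that[of a])
    show "c = (\<lambda>N\<in>nb. coset_of M (a N) N)"
      using c a(2) by (auto simp: quotient_limit_def PiE_iff extensional_def fun_eq_iff)
    fix N N' assume N: "N \<in> nb" "N' \<in> nb" "N \<subseteq> N'"
    have "a N \<in> c N" using a(2)[OF N(1)] M.coset_of_self[OF nb_asub[OF N(1)] a(1)[OF N(1)]] by simp
    moreover have "c N \<subseteq> c N'" using c N by (simp add: quotient_limit_def)
    ultimately have "a N \<in> c N'" by blast
    then show "a N \<ominus>\<^bsub>M\<^esub> a N' \<in> N'" using a(2)[OF N(2)] by (simp add: coset_of_def)
  qed (rule a(1))
qed

text \<open>The image of U is open in the limit and contains a box around the image of zero. A box
  constrains finitely many coordinates, and the intersection of the corresponding submodules again
  has finite colength.\<close>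

lemma limit_base:
  assumes hom: "homeomorphic_map TM limit_top cosets_map" and U: "openin TM U" "\<zero>\<^bsub>M\<^esub> \<in> U"
  shows "\<exists>N\<in>nb. N \<subseteq> U"
proof -
  have inj: "inj_on cosets_map (carrier M)" using homeomorphic_imp_injective_map[OF hom] by (simp add: topspaceM)
  have Uc: "U \<subseteq> carrier M" using U(1) openin_subset topspaceM by blast
  have "openin limit_top (cosets_map ` U)"
    using homeomorphic_imp_open_map[OF hom] U by (simp add: open_map_def)
  then obtain V where V: "openin (product_topology (\<lambda>N. discrete_topology (a_rcosets\<^bsub>M\<^esub> N)) nb) V"
    "cosets_map ` U = V \<inter> quotient_limit M nb"
    unfolding limit_top_def openin_subtopology by blast
  have "cosets_map \<zero>\<^bsub>M\<^esub> \<in> V" using V(2) U(2) by blast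
  with V(1) obtain W where W: "finite {N \<in> nb. W N \<noteq> a_rcosets\<^bsub>M\<^esub> N}" "cosets_map \<zero>\<^bsub>M\<^esub> \<in> Pi\<^sub>E nb W" "Pi\<^sub>E nb W \<subseteq> V"
    unfolding openin_product_topology_alt by (metis (no_types, lifting) topspace_discrete_topology Collect_cong)
  let ?F = "{N \<in> nb. W N \<noteq> a_rcosets\<^bsub>M\<^esub> N}"
  have "carrier M \<inter> \<Inter>?F \<in> nb" by (rule nb_Inter[OF W(1)]) auto
  moreover have "x \<in> U" if x: "x \<in> carrier M \<inter> \<Inter>?F" for x
  proof -
    have xc: "x \<in> carrier M" using x by blast
    have "cosets_map x \<in> Pi\<^sub>E nb W"
    proof (rule PiE_I)
      fix N assume N: "N \<in> nb"
      show "cosets_map x N \<in> W N"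
      proof (cases "N \<in> ?F")
        case True
        then have "coset_of M x N = coset_of M \<zero>\<^bsub>M\<^esub> N"
          using x xc M.coset_of_eq_iff[OF nb_asub[OF N] xc M.zero_closed] by auto
        then have "cosets_map x N = cosets_map \<zero>\<^bsub>M\<^esub> N" using N by (simp add: cosets_map_def)
        then show ?thesis using W(2) N by (auto simp: PiE_iff)
      next
        case False
        then have "W N = a_rcosets\<^bsub>M\<^esub> N" using N by blast
        then show ?thesis using N xc M.rcosets_coset_of[OF nb_asub[OF N]] by (simp add: cosets_map_def)
      qed
    qed (auto simp: cosets_map_def)
    then have "cosets_map x \<in> cosets_map ` U" using W(3) V(2) cosets_map_in[OF xc] by blast
    then show "x \<in> U" using inj xc Uc by (auto dest: inj_onD)
  qed
  ultimately show ?thesis by blast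
qed

lemma limit_sep:
  assumes hom: "homeomorphic_map TM limit_top cosets_map" and x: "x \<in> carrier M" "\<And>N. N \<in> nb \<Longrightarrow> x \<in> N"
  shows "x = \<zero>\<^bsub>M\<^esub>"
proof -
  have "cosets_map x = cosets_map \<zero>\<^bsub>M\<^esub>"
    unfolding cosets_map_def
    using M.coset_of_eq_iff[OF nb_asub x(1) M.zero_closed] x by (intro restrict_ext) simp
  then show ?thesis using homeomorphic_imp_injective_map[OF hom] x(1) by (auto simp: topspaceM inj_on_def)
qed

text \<open>A compatible family of representatives is a point of the limit, so this is surjectivity
  of the canonical map.\<close>

lemma limit_complete:
  assumes hom: "homeomorphic_map TM limit_top cosets_map" and a: "\<And>N. N \<in> nb \<Longrightarrow> a N \<in> carrier M"
    and compat: "\<And>N N'. N \<in> nb \<Longrightarrow> N' \<in> nb \<Longrightarrow> N \<subseteq> N' \<Longrightarrow> a N \<ominus>\<^bsub>M\<^esub> a N' \<in> N'"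
  shows "\<exists>x\<in>carrier M. \<forall>N\<in>nb. x \<ominus>\<^bsub>M\<^esub> a N \<in> N"
proof -
  let ?c = "\<lambda>N\<in>nb. coset_of M (a N) N"
  have "?c \<in> quotient_limit M nb" unfolding quotient_limit_def
  proof (intro CollectI conjI ballI impI)
    show "?c \<in> (\<Pi>\<^sub>E N\<in>nb. a_rcosets\<^bsub>M\<^esub> N)" using a M.rcosets_coset_of[OF nb_asub] by auto
    fix N N' assume N: "N \<in> nb" "N' \<in> nb" "N \<subseteq> N'"
    have "a N \<in> coset_of M (a N') N'" using compat[OF N] a[OF N(1)] by (simp add: coset_of_def)
    from M.coset_of_eq[OF nb_asub[OF N(2)] a[OF N(2)] this]
    show "?c N \<subseteq> ?c N'" using N M.coset_of_subset[OF N(3)] by auto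
  qed
  moreover have "cosets_map ` carrier M = quotient_limit M nb"
    using homeomorphic_imp_surjective_map[OF hom] by (simp add: topspaceM topspace_limit)
  ultimately have "?c \<in> cosets_map ` carrier M" by (simp only:)
  then obtain x where x: "x \<in> carrier M" "cosets_map x = ?c" by (elim imageE) simp
  have "x \<ominus>\<^bsub>M\<^esub> a N \<in> N" if N: "N \<in> nb" for N
  proof -
    have "coset_of M x N = coset_of M (a N) N" using fun_cong[OF x(2), of N] N by (simp add: cosets_map_def)
    then show ?thesis using M.coset_of_eq_iff[OF nb_asub[OF N] x(1) a[OF N]] by simp
  qed
  then show ?thesis using x(1) by blast
qed

text \<open>Separation gives injectivity, completeness surjectivity. Openness comes from the base,
  as each coset of a member of \<open>nb\<close> is cut out by a single coordinate.\<close>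

lemma limitI:
  assumes base: "\<And>U. openin TM U \<Longrightarrow> \<zero>\<^bsub>M\<^esub> \<in> U \<Longrightarrow> \<exists>N\<in>nb. N \<subseteq> U"
    and sep: "\<And>x. x \<in> carrier M \<Longrightarrow> (\<And>N. N \<in> nb \<Longrightarrow> x \<in> N) \<Longrightarrow> x = \<zero>\<^bsub>M\<^esub>"
    and complete: "\<And>a. (\<And>N. N \<in> nb \<Longrightarrow> a N \<in> carrier M) \<Longrightarrow>
      (\<And>N N'. N \<in> nb \<Longrightarrow> N' \<in> nb \<Longrightarrow> N \<subseteq> N' \<Longrightarrow> a N \<ominus>\<^bsub>M\<^esub> a N' \<in> N') \<Longrightarrow> \<exists>x\<in>carrier M. \<forall>N\<in>nb. x \<ominus>\<^bsub>M\<^esub> a N \<in> N"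
  shows "homeomorphic_map TM limit_top cosets_map"
proof (rule bijective_open_imp_homeomorphic_map)
  have cont: "continuous_map TM (discrete_topology (a_rcosets\<^bsub>M\<^esub> N)) (\<lambda>x. cosets_map x N)" if N: "N \<in> nb" for N
    unfolding continuous_map_def
  proof (intro conjI allI impI)
    show "(\<lambda>x. cosets_map x N) \<in> topspace TM \<rightarrow> topspace (discrete_topology (a_rcosets\<^bsub>M\<^esub> N))"
      using N M.rcosets_coset_of[OF nb_asub[OF N]] by (auto simp: cosets_map_def topspaceM)
    fix S
    show "openin TM {x \<in> topspace TM. cosets_map x N \<in> S}"
    proof (subst openin_subopen, intro ballI)
      fix x assume x: "x \<in> {x \<in> topspace TM. cosets_map x N \<in> S}"
      then have xc: "x \<in> carrier M" by (simp add: topspaceM)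
      have "coset_of M x N \<subseteq> {x \<in> topspace TM. cosets_map x N \<in> S}"
      proof
        fix y assume y: "y \<in> coset_of M x N"
        from M.coset_of_eq[OF nb_asub[OF N] xc y] x N y
        show "y \<in> {x \<in> topspace TM. cosets_map x N \<in> S}" by (auto simp: cosets_map_def topspaceM coset_of_def)
      qed
      then show "\<exists>T. openin TM T \<and> x \<in> T \<and> T \<subseteq> {x \<in> topspace TM. cosets_map x N \<in> S}"
        using coset_open[OF nb_open[OF N] xc] M.coset_of_self[OF nb_asub[OF N] xc] by blast
    qed
  qed
  then show "continuous_map TM limit_top cosets_map"
    unfolding limit_top_def continuous_map_in_subtopology continuous_map_componentwise
    using cosets_map_in by (auto simp: topspaceM cosets_map_def)
  show "inj_on cosets_map (topspace TM)"
  proof (rule inj_onI)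
    fix x y assume "x \<in> topspace TM" "y \<in> topspace TM" and eq: "cosets_map x = cosets_map y"
    then have xy: "x \<in> carrier M" "y \<in> carrier M" by (auto simp: topspaceM)
    have "x \<ominus>\<^bsub>M\<^esub> y \<in> N" if N: "N \<in> nb" for N
      using fun_cong[OF eq, of N] N M.coset_of_eq_iff[OF nb_asub[OF N] xy] by (simp add: cosets_map_def)
    then have "x \<ominus>\<^bsub>M\<^esub> y = \<zero>\<^bsub>M\<^esub>" using sep xy by blast
    moreover have "x = (x \<ominus>\<^bsub>M\<^esub> y) \<oplus>\<^bsub>M\<^esub> y" using xy by (simp add: M.agr)
    ultimately show "x = y" using xy by simp
  qed
  show "cosets_map ` topspace TM = topspace limit_top"
  proof
    show "cosets_map ` topspace TM \<subseteq> topspace limit_top" using cosets_map_in by (auto simp: topspaceM topspace_limit)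
    show "topspace limit_top \<subseteq> cosets_map ` topspace TM"
    proof
      fix c assume "c \<in> topspace limit_top"
      then have "c \<in> quotient_limit M nb" by (simp add: topspace_limit)
      then obtain a where a: "\<And>N. N \<in> nb \<Longrightarrow> a N \<in> carrier M" "c = (\<lambda>N\<in>nb. coset_of M (a N) N)"
        "\<And>N N'. N \<in> nb \<Longrightarrow> N' \<in> nb \<Longrightarrow> N \<subseteq> N' \<Longrightarrow> a N \<ominus>\<^bsub>M\<^esub> a N' \<in> N'" by (rule quotient_limit_rep) blast
      from complete[OF a(1,3)] obtain x where x: "x \<in> carrier M" "\<And>N. N \<in> nb \<Longrightarrow> x \<ominus>\<^bsub>M\<^esub> a N \<in> N" by blast
      have "c = cosets_map x" unfolding a(2) cosets_map_def
        using M.coset_of_eq_iff[OF nb_asub x(1) a(1)] x(2) by (intro restrict_ext) auto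
      then show "c \<in> cosets_map ` topspace TM" using x(1) by (simp add: topspaceM)
    qed
  qed
  show "open_map TM limit_top cosets_map" unfolding open_map_def
  proof (intro allI impI)
    fix U assume U: "openin TM U"
    show "openin limit_top (cosets_map ` U)"
    proof (subst openin_subopen, intro ballI)
      fix c assume "c \<in> cosets_map ` U"
      then obtain x where x: "x \<in> U" "c = cosets_map x" by blast
      have Uc: "U \<subseteq> carrier M" using U openin_subset topspaceM by blast
      then have xc: "x \<in> carrier M" using x by blast
      from open_coset_nb[OF base U x(1)] obtain N where N: "N \<in> nb" "coset_of M x N \<subseteq> U" by blast
      let ?X = "product_topology (\<lambda>N. discrete_topology (a_rcosets\<^bsub>M\<^esub> N)) nb"
      \<comment> \<open>Fixing the coordinate at \<open>N\<close> alone suffices: the points of the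
        limit in \<open>V\<close> are exactly the images of the points of the coset of
        \<open>x\<close> modulo \<open>N\<close>.\<close>
      define V where "V = {d \<in> topspace ?X. d N \<in> {coset_of M x N}}"
      have "openin ?X V" unfolding V_def
        by (rule openin_continuous_map_preimage[OF continuous_map_product_projection[OF N(1)]])
          (use xc M.rcosets_coset_of[OF nb_asub[OF N(1)]] in simp)
      then have "openin limit_top (V \<inter> quotient_limit M nb)" unfolding limit_top_def openin_subtopology by blast
      moreover have "c \<in> V \<inter> quotient_limit M nb"
        using cosets_map_in[OF xc] x(2) N(1) by (auto simp: V_def quotient_limit_def cosets_map_def)
      moreover have "V \<inter> quotient_limit M nb \<subseteq> cosets_map ` U"
      proof
        fix d assume d: "d \<in> V \<inter> quotient_limit M nb"
        then have "d \<in> topspace limit_top" by (simp add: topspace_limit)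
        then obtain y where y: "y \<in> carrier M" "d = cosets_map y"
          using \<open>cosets_map ` topspace TM = topspace limit_top\<close> by (auto simp: topspaceM)
        then have "coset_of M y N = coset_of M x N" using d N(1) by (simp add: V_def cosets_map_def)
        then have "y \<in> coset_of M x N" using M.coset_of_self[OF nb_asub[OF N(1)] y(1)] by simp
        then show "d \<in> cosets_map ` U" using N(2) y(2) by blast
      qed
      ultimately show "\<exists>T. openin limit_top T \<and> c \<in> T \<and> T \<subseteq> cosets_map ` U" by blast
    qed
  qed
qed

end

text \<open>The inverse limit condition unfolded into base, separation and completeness at zero. The
  two results that follow give the equivalence with \<open>pseudocompact_module\<close>; this form
  is the one verified for kernels and powers.\<close>

locale pcmod = tmod +
  assumes nb_base: "openin TM U \<Longrightarrow> \<zero>\<^bsub>M\<^esub> \<in> U \<Longrightarrow> \<exists>N\<in>nb. N \<subseteq> U"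
    and nb_sep: "x \<in> carrier M \<Longrightarrow> (\<And>N. N \<in> nb \<Longrightarrow> x \<in> N) \<Longrightarrow> x = \<zero>\<^bsub>M\<^esub>"
    and nb_complete: "(\<And>N. N \<in> nb \<Longrightarrow> a N \<in> carrier M) \<Longrightarrow>
      (\<And>N N'. N \<in> nb \<Longrightarrow> N' \<in> nb \<Longrightarrow> N \<subseteq> N' \<Longrightarrow> a N \<ominus>\<^bsub>M\<^esub> a N' \<in> N') \<Longrightarrow> \<exists>x\<in>carrier M. \<forall>N\<in>nb. x \<ominus>\<^bsub>M\<^esub> a N \<in> N"

lemma pcmod_pseudocompact:
  assumes "pcmod R L M TL TM"
  shows "pseudocompact_module R L TL M TM"
proof -
  interpret pcmod R L M TL TM by (rule assms)
  show ?thesis unfolding pseudocompact_module_def nb_eq is_limit_iff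
    using topological_module limitI[OF nb_base nb_sep nb_complete] by blast
qed

lemma pseudocompact_pcmod:
  assumes "ralgebra R L" "topspace TL = carrier L" and pc: "pseudocompact_module R L TL M TM"
  shows "pcmod R L M TL TM"
proof -
  have t: "topological_module L TL M TM" using pc by (simp add: pseudocompact_module_def)
  then have "tmod R L M TL TM"
    using assms(1,2) by (auto simp: tmod_def tmod_axioms_def topological_module_def)
  then interpret tmod R L M TL TM .
  have h: "homeomorphic_map TM limit_top cosets_map"
    using pc unfolding pseudocompact_module_def nb_eq is_limit_iff by blast
  show ?thesis
  proof
    show "\<exists>N\<in>nb. N \<subseteq> U" if "openin TM U" "\<zero>\<^bsub>M\<^esub> \<in> U" for U by (rule limit_base[OF h that])
    show "x = \<zero>\<^bsub>M\<^esub>" if "x \<in> carrier M" "\<And>N. N \<in> nb \<Longrightarrow> x \<in> N" for x by (rule limit_sep[OF h that])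
    show "\<exists>x\<in>carrier M. \<forall>N\<in>nb. x \<ominus>\<^bsub>M\<^esub> a N \<in> N" if "\<And>N. N \<in> nb \<Longrightarrow> a N \<in> carrier M"
      "\<And>N N'. N \<in> nb \<Longrightarrow> N' \<in> nb \<Longrightarrow> N \<subseteq> N' \<Longrightarrow> a N \<ominus>\<^bsub>M\<^esub> a N' \<in> N'" for a by (rule limit_complete[OF h that])
  qed
qed

lemma (in pcmod) nb_eqI:
  assumes "x \<in> carrier M" "y \<in> carrier M" "\<And>N. N \<in> nb \<Longrightarrow> x \<ominus>\<^bsub>M\<^esub> y \<in> N"
  shows "x = y"
proof -
  have "x \<ominus>\<^bsub>M\<^esub> y = \<zero>\<^bsub>M\<^esub>" using assms by (intro nb_sep) auto
  moreover have "x = (x \<ominus>\<^bsub>M\<^esub> y) \<oplus>\<^bsub>M\<^esub> y" using assms by (simp add: M.agr)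
  ultimately show ?thesis using assms by simp
qed

section \<open>Continuous homomorphisms\<close>

lemma continuous_hom_closed: "continuous_hom L A TA B TB f \<Longrightarrow> x \<in> carrier A \<Longrightarrow> f x \<in> carrier B"
  and continuous_hom_add: "continuous_hom L A TA B TB f \<Longrightarrow> x \<in> carrier A \<Longrightarrow> y \<in> carrier A
    \<Longrightarrow> f (x \<oplus>\<^bsub>A\<^esub> y) = f x \<oplus>\<^bsub>B\<^esub> f y"
  and continuous_hom_smult: "continuous_hom L A TA B TB f \<Longrightarrow> a \<in> carrier L \<Longrightarrow> x \<in> carrier A
    \<Longrightarrow> f (a \<odot>\<^bsub>A\<^esub> x) = a \<odot>\<^bsub>B\<^esub> f x"
  and continuous_hom_cont: "continuous_hom L A TA B TB f \<Longrightarrow> continuous_map TA TB f"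
  by (auto simp: continuous_hom_def)

lemma continuous_hom_compose:
  "continuous_hom L A TA B TB f \<Longrightarrow> continuous_hom L B TB C TC g \<Longrightarrow> continuous_hom L A TA C TC (\<lambda>x. g (f x))"
  using continuous_map_compose[of TA TB f TC g] by (auto simp: continuous_hom_def Pi_iff o_def)

context tmod
begin

lemma continuous_hom_cong:
  assumes "continuous_hom L M TM B TB f" "\<And>x. x \<in> carrier M \<Longrightarrow> g x = f x"
  shows "continuous_hom L M TM B TB g"
proof -
  have "continuous_map TM TB g"
    by (rule continuous_map_eq[OF continuous_hom_cont[OF assms(1)]]) (simp add: assms(2) topspaceM)
  then show ?thesis using assms smult_closed by (auto simp: continuous_hom_def)
qed

lemma continuous_hom_id: "continuous_hom L M TM M TM (\<lambda>x. x)"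
  by (auto simp: continuous_hom_def)

lemma continuous_hom_diff:
  assumes "tmod R L B TL TB" "continuous_hom L M TM B TB f" "x \<in> carrier M" "y \<in> carrier M"
  shows "f (x \<ominus>\<^bsub>M\<^esub> y) = f x \<ominus>\<^bsub>B\<^esub> f y"
proof -
  interpret B: tmod R L B TL TB by fact
  show ?thesis
    by (rule M.add_map_diff[OF B.M.abelian_group_axioms continuous_hom_closed[OF assms(2)] continuous_hom_add[OF assms(2)] assms(3,4)])
qed

lemma continuous_hom_zero:
  assumes "tmod R L B TL TB" "continuous_hom L M TM B TB f"
  shows "f \<zero>\<^bsub>M\<^esub> = \<zero>\<^bsub>B\<^esub>"
proof -
  interpret B: tmod R L B TL TB by fact
  show ?thesis
    using continuous_hom_diff[OF assms M.zero_closed M.zero_closed] continuous_hom_closed[OF assms(2) M.zero_closed] by simp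
qed

lemma continuous_hom_plus:
  assumes "tmod R L B TL TB" "continuous_hom L M TM B TB f" "continuous_hom L M TM B TB g"
  shows "continuous_hom L M TM B TB (\<lambda>x. f x \<oplus>\<^bsub>B\<^esub> g x)"
proof -
  interpret B: tmod R L B TL TB by fact
  note f = continuous_hom_closed[OF assms(2)] continuous_hom_add[OF assms(2)] continuous_hom_smult[OF assms(2)]
  note g = continuous_hom_closed[OF assms(3)] continuous_hom_add[OF assms(3)] continuous_hom_smult[OF assms(3)]
  have "continuous_map TM TB ((\<lambda>(x, y). x \<oplus>\<^bsub>B\<^esub> y) \<circ> (\<lambda>x. (f x, g x)))"
    by (rule continuous_map_compose[OF _ B.cont_add])
      (intro continuous_map_pairedI continuous_hom_cont[OF assms(2)] continuous_hom_cont[OF assms(3)])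
  then show ?thesis unfolding continuous_hom_def
    using f g by (auto simp: o_def B.M.a_ac B.smult_r_distr)
qed

lemma continuous_hom_uminus:
  assumes "tmod R L B TL TB" "continuous_hom L M TM B TB f"
  shows "continuous_hom L M TM B TB (\<lambda>x. \<ominus>\<^bsub>B\<^esub> f x)"
proof -
  interpret B: tmod R L B TL TB by fact
  note f = continuous_hom_closed[OF assms(2)] continuous_hom_add[OF assms(2)] continuous_hom_smult[OF assms(2)]
  have "continuous_map TM TB ((\<lambda>x. \<ominus>\<^bsub>B\<^esub> x) \<circ> f)"
    by (rule continuous_map_compose[OF continuous_hom_cont[OF assms(2)] B.cont_neg])
  moreover have "a \<odot>\<^bsub>B\<^esub> (\<ominus>\<^bsub>B\<^esub> y) = \<ominus>\<^bsub>B\<^esub> (a \<odot>\<^bsub>B\<^esub> y)" if "a \<in> carrier L" "y \<in> carrier B" for a y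
    using B.smult_diff[OF that(1) B.M.zero_closed that(2)] that B.smult_closed by (simp add: B.M.agr B.smult_zero)
  ultimately show ?thesis unfolding continuous_hom_def
    using f by (auto simp: o_def B.M.minus_add)
qed

lemma continuous_hom_minus:
  assumes "tmod R L B TL TB" "continuous_hom L M TM B TB f" "continuous_hom L M TM B TB g"
  shows "continuous_hom L M TM B TB (\<lambda>x. f x \<ominus>\<^bsub>B\<^esub> g x)"
  unfolding a_minus_def by (intro continuous_hom_plus continuous_hom_uminus assms)

lemma continuous_hom_zero_map:
  assumes "tmod R L B TL TB"
  shows "continuous_hom L M TM B TB (\<lambda>x. \<zero>\<^bsub>B\<^esub>)"
proof -
  interpret B: tmod R L B TL TB by fact
  show ?thesis by (auto simp: continuous_hom_def B.smult_zero B.topspaceM)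
qed

lemma nb_vimage:
  assumes "tmod R L B TL TB" "continuous_hom L M TM B TB f" and K: "K \<in> tmod.nb R L B TB"
  shows "{x \<in> carrier M. f x \<in> K} \<in> nb"
proof -
  interpret B: tmod R L B TL TB by fact
  note f = continuous_hom_closed[OF assms(2)] continuous_hom_add[OF assms(2)] continuous_hom_smult[OF assms(2)]
  have "submodule {x \<in> carrier M. f x \<in> K} L M"
  proof -
    have "asub M {x \<in> carrier M. f x \<in> K}"
      by (rule M.asub_vimage[OF M.asub_carrier B.M.abelian_group_axioms B.nb_asub[OF K]])
        (use f(1) continuous_hom_diff[OF assms(1,2)] in auto)
      then show ?thesis
      using f B.nb_submodule[OF K] by (auto simp: submodule_iff B.submodule_iff smult_closed)
  qed
  moreover have "openin TM {x \<in> carrier M. f x \<in> K}"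
    using openin_continuous_map_preimage[OF continuous_hom_cont[OF assms(2)] B.nb_open[OF K]] by (simp add: topspaceM)
  moreover have "rop.has_length {x \<in> carrier M. f x \<in> K}"
    by (rule op_group_has_length_vimage[OF rop.op_group_axioms B.rop.op_group_axioms f(1,2) _ B.nb_esub[OF K] B.nb_length[OF K]])
      (auto simp: ract_def f scalar_closed)
  ultimately show ?thesis by (simp add: nb_def)
qed

text \<open>For an additive map, continuity at zero spreads to all points by translation, and at
  zero it is tested on the base \<open>nb\<close> of B.\<close>

lemma continuous_homI:
  assumes B: "pcmod R L B TL TB"
    and f: "\<And>x. x \<in> carrier M \<Longrightarrow> f x \<in> carrier B"
    and fa: "\<And>x y. x \<in> carrier M \<Longrightarrow> y \<in> carrier M \<Longrightarrow> f (x \<oplus>\<^bsub>M\<^esub> y) = f x \<oplus>\<^bsub>B\<^esub> f y"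
    and fs: "\<And>a x. a \<in> carrier L \<Longrightarrow> x \<in> carrier M \<Longrightarrow> f (a \<odot>\<^bsub>M\<^esub> x) = a \<odot>\<^bsub>B\<^esub> f x"
    and fc: "\<And>K. K \<in> tmod.nb R L B TB \<Longrightarrow> \<exists>U. openin TM U \<and> \<zero>\<^bsub>M\<^esub> \<in> U \<and> (\<forall>x\<in>U. f x \<in> K)"
  shows "continuous_hom L M TM B TB f"
proof -
  interpret B: pcmod R L B TL TB by fact
  have fd: "f (x \<ominus>\<^bsub>M\<^esub> y) = f x \<ominus>\<^bsub>B\<^esub> f y" if "x \<in> carrier M" "y \<in> carrier M" for x y
    by (rule M.add_map_diff[OF B.M.abelian_group_axioms f fa that])
  have "continuous_map TM TB f" unfolding continuous_map_def
  proof (intro conjI allI impI)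
    show "f \<in> topspace TM \<rightarrow> topspace TB" using f by (auto simp: topspaceM B.topspaceM)
    fix V assume V: "openin TB V"
    show "openin TM {x \<in> topspace TM. f x \<in> V}"
    proof (subst openin_subopen, intro ballI)
      fix x assume x: "x \<in> {x \<in> topspace TM. f x \<in> V}"
      then have xc: "x \<in> carrier M" by (simp add: topspaceM)
      have "\<exists>N\<in>B.nb. coset_of B (f x) N \<subseteq> V" using x by (intro B.open_coset_nb B.nb_base V) auto
      then obtain N where N: "N \<in> B.nb" "coset_of B (f x) N \<subseteq> V" by blast
      from fc[OF N(1)] obtain U where U: "openin TM U" "\<zero>\<^bsub>M\<^esub> \<in> U" "\<And>x. x \<in> U \<Longrightarrow> f x \<in> N" by blast
      have "{y \<in> carrier M. y \<ominus>\<^bsub>M\<^esub> x \<in> U} \<subseteq> {x \<in> topspace TM. f x \<in> V}"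
      proof
        fix y assume y: "y \<in> {y \<in> carrier M. y \<ominus>\<^bsub>M\<^esub> x \<in> U}"
        then have "f y \<ominus>\<^bsub>B\<^esub> f x \<in> N" using U(3)[of "y \<ominus>\<^bsub>M\<^esub> x"] xc by (simp add: fd)
        then have "f y \<in> coset_of B (f x) N" using y f by (simp add: coset_of_def)
        then show "y \<in> {x \<in> topspace TM. f x \<in> V}" using N(2) y by (auto simp: topspaceM)
      qed
      then show "\<exists>T. openin TM T \<and> x \<in> T \<and> T \<subseteq> {x \<in> topspace TM. f x \<in> V}"
        using open_translate[OF U(1) xc] U(2) xc by (intro exI[of _ "{y \<in> carrier M. y \<ominus>\<^bsub>M\<^esub> x \<in> U}"]) auto
    qed
  qed
  then show ?thesis using f fa fs by (auto simp: continuous_hom_def)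
qed

text \<open>Additivity and linearity hold modulo every N, hence exactly. For continuity, the
  preimage of N under \<open>b N\<close> is open and \<open>f\<close> maps it into N. The result
  serves both completeness of Hom(M, Y) and the construction of homomorphisms out of powers.\<close>

lemma continuous_hom_limit:
  assumes B: "pcmod R L B TL TB"
    and b: "\<And>N. N \<in> tmod.nb R L B TB \<Longrightarrow> continuous_hom L M TM B TB (b N)"
    and f: "\<And>x. x \<in> carrier M \<Longrightarrow> f x \<in> carrier B"
    and fb: "\<And>x N. x \<in> carrier M \<Longrightarrow> N \<in> tmod.nb R L B TB \<Longrightarrow> f x \<ominus>\<^bsub>B\<^esub> b N x \<in> N"
  shows "continuous_hom L M TM B TB f"
proof -
  interpret B: pcmod R L B TL TB by fact
  show ?thesis
  proof (rule continuous_homI[OF B f])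
    fix x y assume xy: "x \<in> carrier M" "y \<in> carrier M"
    show "f (x \<oplus>\<^bsub>M\<^esub> y) = f x \<oplus>\<^bsub>B\<^esub> f y"
    proof (rule B.nb_eqI)
      fix N assume N: "N \<in> B.nb"
      note bc = continuous_hom_closed[OF b[OF N]]
      have "(f x \<oplus>\<^bsub>B\<^esub> f y) \<ominus>\<^bsub>B\<^esub> (b N x \<oplus>\<^bsub>B\<^esub> b N y) \<in> N"
        by (rule B.M.diff_add2[OF B.nb_asub[OF N] fb[OF xy(1) N] fb[OF xy(2) N]]) (use xy f bc in auto)
      then have 1: "(b N x \<oplus>\<^bsub>B\<^esub> b N y) \<ominus>\<^bsub>B\<^esub> (f x \<oplus>\<^bsub>B\<^esub> f y) \<in> N"
        by (rule B.M.diff_sym[OF B.nb_asub[OF N]]) (use xy f bc in auto)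
      have 2: "f (x \<oplus>\<^bsub>M\<^esub> y) \<ominus>\<^bsub>B\<^esub> (b N x \<oplus>\<^bsub>B\<^esub> b N y) \<in> N"
        using fb[of "x \<oplus>\<^bsub>M\<^esub> y" N] xy N by (simp add: continuous_hom_add[OF b[OF N]])
      show "f (x \<oplus>\<^bsub>M\<^esub> y) \<ominus>\<^bsub>B\<^esub> (f x \<oplus>\<^bsub>B\<^esub> f y) \<in> N"
        by (rule B.M.diff_trans[OF B.nb_asub[OF N] 2 1]) (use xy f bc in simp_all)
    qed (use xy f in auto)
  next
    fix c x assume c: "c \<in> carrier L" and x: "x \<in> carrier M"
    show "f (c \<odot>\<^bsub>M\<^esub> x) = c \<odot>\<^bsub>B\<^esub> f x"
    proof (rule B.nb_eqI)
      fix N assume N: "N \<in> B.nb"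
      note bc = continuous_hom_closed[OF b[OF N]]
      have "c \<odot>\<^bsub>B\<^esub> (f x \<ominus>\<^bsub>B\<^esub> b N x) \<in> N" using B.nb_submodule[OF N] fb[OF x N] c by (simp add: B.submodule_iff)
      then have "c \<odot>\<^bsub>B\<^esub> f x \<ominus>\<^bsub>B\<^esub> c \<odot>\<^bsub>B\<^esub> b N x \<in> N" using c x f bc by (simp add: B.smult_diff)
      then have 1: "c \<odot>\<^bsub>B\<^esub> b N x \<ominus>\<^bsub>B\<^esub> c \<odot>\<^bsub>B\<^esub> f x \<in> N"
        by (rule B.M.diff_sym[OF B.nb_asub[OF N]]) (use c x f bc B.smult_closed in auto)
      have 2: "f (c \<odot>\<^bsub>M\<^esub> x) \<ominus>\<^bsub>B\<^esub> c \<odot>\<^bsub>B\<^esub> b N x \<in> N"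
        using fb[of "c \<odot>\<^bsub>M\<^esub> x" N] c x N smult_closed by (simp add: continuous_hom_smult[OF b[OF N]])
      show "f (c \<odot>\<^bsub>M\<^esub> x) \<ominus>\<^bsub>B\<^esub> c \<odot>\<^bsub>B\<^esub> f x \<in> N"
        by (rule B.M.diff_trans[OF B.nb_asub[OF N] 2 1])
          (use c x f bc B.smult_closed smult_closed in simp_all)
    qed (use c x f smult_closed B.smult_closed in auto)
  next
    fix N assume N: "N \<in> B.nb"
    let ?U = "{m \<in> carrier M. b N m \<in> N}"
    have U: "?U \<in> nb" by (rule nb_vimage[OF B.tmod_axioms b[OF N] N])
    have "f m \<in> N" if "m \<in> ?U" for m
      using that f fb N by (intro B.M.diff_mem[OF B.nb_asub[OF N], of "f m" "b N m"]) auto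
    then show "\<exists>U. openin TM U \<and> \<zero>\<^bsub>M\<^esub> \<in> U \<and> (\<forall>x\<in>U. f x \<in> N)"
      using nb_open[OF U] nb_zero[OF U] by blast
  qed
qed

end

section \<open>The module of continuous homomorphisms\<close>

text \<open>Extensional functions make equality on M the equality of HOL. A ring record is used
  because \<open>abelian_group\<close> is a locale on ring records.\<close>

definition hom_group :: "('r, 'l) module \<Rightarrow> ('l, 'm) module \<Rightarrow> 'm topology \<Rightarrow> ('l, 'y) module \<Rightarrow> 'y topology
    \<Rightarrow> ('m \<Rightarrow> 'y) ring" where
  "hom_group L M TM Y TY =
     \<lparr>carrier = {f \<in> extensional (carrier M). continuous_hom L M TM Y TY f},
      monoid.mult = undefined, monoid.one = undefined,
      ring.zero = (\<lambda>m\<in>carrier M. \<zero>\<^bsub>Y\<^esub>), ring.add = (\<lambda>f g. \<lambda>m\<in>carrier M. f m \<oplus>\<^bsub>Y\<^esub> g m)\<rparr>"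

text \<open>Precomposition is a right action of End(M). Stability of subgroups refers to single
  operators, so the side plays no part in \<open>op_group\<close>.\<close>

definition hom_act :: "('l, 'm) module \<Rightarrow> ('m \<Rightarrow> 'm) \<Rightarrow> ('m \<Rightarrow> 'y) \<Rightarrow> 'm \<Rightarrow> 'y" where
  "hom_act M e f = (\<lambda>m\<in>carrier M. f (e m))"

definition hom_into :: "('l, 'm) module \<Rightarrow> ('m \<Rightarrow> 'y) set \<Rightarrow> 'y set \<Rightarrow> ('m \<Rightarrow> 'y) set" where
  "hom_into M F N = {f \<in> F. \<forall>m\<in>carrier M. f m \<in> N}"

locale hom_pc = M: pcmod R L M TL TM + Y: pcmod R L Y TL TY
  for R :: "'r ring" and L :: "('r, 'l) module" and M :: "('l, 'm) module" and TL :: "'l topology" and TM :: "'m topology"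
    and Y :: "('l, 'y) module" and TY :: "'y topology" +
  assumes fg: "finitely_generated L M"
begin

abbreviation "H \<equiv> hom_group L M TM Y TY"
abbreviation "E \<equiv> carrier (hom_group L M TM M TM)"
abbreviation "\<W> \<equiv> hom_into M (carrier H) ` Y.nb"

lemma carrier_H: "f \<in> carrier H \<longleftrightarrow> f \<in> extensional (carrier M) \<and> continuous_hom L M TM Y TY f"
  by (simp add: hom_group_def)

lemma carrier_E: "f \<in> E \<longleftrightarrow> f \<in> extensional (carrier M) \<and> continuous_hom L M TM M TM f"
  by (simp add: hom_group_def)

lemma add_H: "f \<oplus>\<^bsub>H\<^esub> g = (\<lambda>m\<in>carrier M. f m \<oplus>\<^bsub>Y\<^esub> g m)"
  by (simp add: hom_group_def)

lemma zero_H: "\<zero>\<^bsub>H\<^esub> = (\<lambda>m\<in>carrier M. \<zero>\<^bsub>Y\<^esub>)"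
  by (simp add: hom_group_def)

lemma H_closed: "f \<in> carrier H \<Longrightarrow> m \<in> carrier M \<Longrightarrow> f m \<in> carrier Y"
  by (auto simp: carrier_H intro: continuous_hom_closed)

lemma H_eqI: "f \<in> carrier H \<Longrightarrow> g \<in> carrier H \<Longrightarrow> (\<And>m. m \<in> carrier M \<Longrightarrow> f m = g m) \<Longrightarrow> f = g"
  by (auto simp: carrier_H intro: extensionalityI)

lemma restrict_H: "continuous_hom L M TM Y TY f \<Longrightarrow> restrict f (carrier M) \<in> carrier H"
  by (auto simp: carrier_H intro: M.continuous_hom_cong)

lemma H_abelian_group: "abelian_group H"
proof (rule abelian_groupI)
  show "f \<oplus>\<^bsub>H\<^esub> g \<in> carrier H" if "f \<in> carrier H" "g \<in> carrier H" for f g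
    unfolding add_H using that by (intro restrict_H M.continuous_hom_plus Y.tmod_axioms) (auto simp: carrier_H)
  show "\<zero>\<^bsub>H\<^esub> \<in> carrier H"
    unfolding zero_H by (intro restrict_H M.continuous_hom_zero_map Y.tmod_axioms)
  then show "\<zero>\<^bsub>H\<^esub> \<oplus>\<^bsub>H\<^esub> f = f" if "f \<in> carrier H" for f
    using that H_closed[OF that] by (auto simp: add_H zero_H carrier_H fun_eq_iff extensional_def)
  show "\<exists>g\<in>carrier H. g \<oplus>\<^bsub>H\<^esub> f = \<zero>\<^bsub>H\<^esub>" if f: "f \<in> carrier H" for f
  proof
    show "(\<lambda>m\<in>carrier M. \<ominus>\<^bsub>Y\<^esub> f m) \<in> carrier H"
      using f by (intro restrict_H M.continuous_hom_uminus Y.tmod_axioms) (auto simp: carrier_H)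
    show "(\<lambda>m\<in>carrier M. \<ominus>\<^bsub>Y\<^esub> f m) \<oplus>\<^bsub>H\<^esub> f = \<zero>\<^bsub>H\<^esub>"
      using H_closed[OF f] by (auto simp: add_H zero_H Y.M.l_neg)
  qed
qed (auto simp: add_H Y.M.a_ac H_closed)

lemma E_maps: "e \<in> E \<Longrightarrow> m \<in> carrier M \<Longrightarrow> e m \<in> carrier M"
  by (auto simp: carrier_E intro: continuous_hom_closed)

lemma H_op_group: "op_group H E (hom_act M)"
proof -
  interpret H: abelian_group H by (rule H_abelian_group)
  show ?thesis
  proof
    fix e f assume e: "e \<in> E" and f: "f \<in> carrier H"
    show "hom_act M e f \<in> carrier H"
      unfolding hom_act_def using e f by (intro restrict_H continuous_hom_compose[of L M TM M TM e Y TY f]) (auto simp: carrier_H carrier_E)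
    show "hom_act M e (f \<oplus>\<^bsub>H\<^esub> g) = hom_act M e f \<oplus>\<^bsub>H\<^esub> hom_act M e g" for g
      using E_maps[OF e] by (auto simp: hom_act_def add_H)
  qed
qed

sublocale H: op_group H E "hom_act M"
  by (rule H_op_group)

lemma diff_H: "f \<in> carrier H \<Longrightarrow> g \<in> carrier H \<Longrightarrow> m \<in> carrier M \<Longrightarrow> (f \<ominus>\<^bsub>H\<^esub> g) m = f m \<ominus>\<^bsub>Y\<^esub> g m"
proof -
  assume f: "f \<in> carrier H" and g: "g \<in> carrier H" and m: "m \<in> carrier M"
  have "f = (f \<ominus>\<^bsub>H\<^esub> g) \<oplus>\<^bsub>H\<^esub> g" using f g by (simp add: H.agr)
  then have "f m = ((f \<ominus>\<^bsub>H\<^esub> g) \<oplus>\<^bsub>H\<^esub> g) m" by (rule arg_cong)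
  then have "f m = (f \<ominus>\<^bsub>H\<^esub> g) m \<oplus>\<^bsub>Y\<^esub> g m" using m by (simp add: add_H)
  moreover have "(f \<ominus>\<^bsub>H\<^esub> g) m \<in> carrier Y" by (rule H_closed[OF H.minus_closed[OF f g] m])
  ultimately show ?thesis using H_closed[OF _ m] f g by (simp add: Y.M.agr)
qed

lemma in_hom_into: "f \<in> hom_into M (carrier H) N \<longleftrightarrow> f \<in> carrier H \<and> (\<forall>m\<in>carrier M. f m \<in> N)"
  by (simp add: hom_into_def)

lemma hom_into_esub: "N \<in> Y.nb \<Longrightarrow> H.esub (hom_into M (carrier H) N)"
  unfolding H.esub_def asub_def
  using Y.nb_zero[of N] Y.M.asub_diff[OF Y.nb_asub[of N]]
    H.zero_closed
  by (auto simp: in_hom_into diff_H H.act_closed) (auto simp: hom_act_def E_maps zero_H)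

text \<open>The image of R in L is central, so scalars act on M by L-endomorphisms. Through them
  every End(M)-submodule of Hom(M, Y) is stable under R, and its sets of values can be measured by
  the R-length of Y/N.\<close>

lemma ract_E: "r \<in> carrier R \<Longrightarrow> (\<lambda>m\<in>carrier M. ract L M r m) \<in> E"
proof -
  assume r: "r \<in> carrier R"
  note rL = M.scalar_closed[OF r]
  have "continuous_map TM TM ((\<lambda>(a, x). a \<odot>\<^bsub>M\<^esub> x) \<circ> (\<lambda>x. (r \<odot>\<^bsub>L\<^esub> \<one>\<^bsub>L\<^esub>, x)))"
    by (rule continuous_map_compose[OF _ M.cont_smult])
      (use rL M.topspaceL in \<open>auto intro!: continuous_map_pairedI\<close>)
  then have c: "continuous_map TM TM (\<lambda>m. ract L M r m)" by (simp add: ract_def o_def)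
  have "continuous_hom L M TM M TM (\<lambda>m. ract L M r m)" unfolding continuous_hom_def
  proof (intro conjI ballI c)
    show "ract L M r \<in> carrier M \<rightarrow> carrier M" using rL M.smult_closed by (auto simp: ract_def)
    show "ract L M r (x \<oplus>\<^bsub>M\<^esub> y) = ract L M r x \<oplus>\<^bsub>M\<^esub> ract L M r y" if "x \<in> carrier M" "y \<in> carrier M" for x y
      using rL that M.smult_r_distr by (simp add: ract_def)
    show "ract L M r (a \<odot>\<^bsub>M\<^esub> x) = a \<odot>\<^bsub>M\<^esub> ract L M r x" if "a \<in> carrier L" "x \<in> carrier M" for a x
      unfolding ract_def
      using M.smult_assoc[OF rL that] M.smult_assoc[OF that(1) rL that(2)] M.scalar_central[OF r that(1)] by metis
  qed
  then have "continuous_hom L M TM M TM (\<lambda>m\<in>carrier M. ract L M r m)" by (rule M.continuous_hom_cong) simp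
  then show ?thesis by (simp add: carrier_E)
qed

text \<open>
  The values at generators \<open>m\<^sub>1, \<dots>, m\<^sub>n\<close> embed \<open>Hom(M, Y/N)\<close> in \<open>(Y/N)\<^sup>n\<close>; filtering by the first
  coordinate that does not vanish gives a length function on submodules.
\<close>

lemma hom_into_length:
  assumes N: "N \<in> Y.nb"
  shows "H.has_length (hom_into M (carrier H) N)"
proof -
  from fg obtain A where A: "finite A" "A \<subseteq> carrier M" "\<And>K. submodule K L M \<Longrightarrow> A \<subseteq> K \<Longrightarrow> K = carrier M"
    unfolding finitely_generated_def by blast
  from finite_list[OF A(1)] obtain ms where ms: "set ms = A" by blast
  let ?n = "length ms"
  have msc: "ms ! j \<in> carrier M" if "j < ?n" for j using that ms A(2) nth_mem by blast
  from Y.nb_length[OF N] obtain len :: "'y set \<Rightarrow> nat"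
    where len: "\<And>A B. Y.rop.esub A \<Longrightarrow> Y.rop.esub B \<Longrightarrow> N \<subseteq> A \<Longrightarrow> A \<subset> B \<Longrightarrow> len A < len B"
    unfolding Y.rop.has_length_def by blast
  have Na: "asub Y N" by (rule Y.nb_asub[OF N])
  \<comment> \<open>Modulo N, the values at the j-th generator of those elements of Z that vanish
    modulo N at all earlier generators.\<close>
  define P where "P Z j = {y \<in> carrier Y. \<exists>f\<in>Z. (\<forall>i<j. f (ms ! i) \<in> N) \<and> y \<ominus>\<^bsub>Y\<^esub> f (ms ! j) \<in> N}" for Z j
  have Zc: "f \<in> carrier H" if "H.esub Z" "f \<in> Z" for Z f
    using that H.asub_subset[OF H.esub_asub] by blast
  have NP: "N \<subseteq> P Z j" if Z: "H.esub Z" and j: "j < ?n" for Z j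
    unfolding P_def using H.asub_zero[OF H.esub_asub[OF Z]] Y.M.asub_subset[OF Na] Y.M.asub_zero[OF Na] msc j
    by (auto simp: zero_H intro!: bexI[of _ "\<zero>\<^bsub>H\<^esub>"])
  have P: "Y.rop.esub (P Z j)" if Z: "H.esub Z" and j: "j < ?n" for Z j
    unfolding Y.rop.esub_def asub_def
  proof (intro conjI ballI)
    show "P Z j \<subseteq> carrier Y" by (auto simp: P_def)
    show "\<zero>\<^bsub>Y\<^esub> \<in> P Z j" using NP[OF that] Y.M.asub_zero[OF Na] by blast
    fix x assume "x \<in> P Z j"
    then obtain f where f: "x \<in> carrier Y" "f \<in> Z" "\<And>i. i < j \<Longrightarrow> f (ms ! i) \<in> N" "x \<ominus>\<^bsub>Y\<^esub> f (ms ! j) \<in> N" by (auto simp: P_def)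
    note fH = Zc[OF Z f(2)]
    { fix y assume "y \<in> P Z j"
      then obtain g where g: "y \<in> carrier Y" "g \<in> Z" "\<And>i. i < j \<Longrightarrow> g (ms ! i) \<in> N" "y \<ominus>\<^bsub>Y\<^esub> g (ms ! j) \<in> N" by (auto simp: P_def)
      note gH = Zc[OF Z g(2)]
      have "(x \<ominus>\<^bsub>Y\<^esub> y) \<ominus>\<^bsub>Y\<^esub> (f \<ominus>\<^bsub>H\<^esub> g) (ms ! j) \<in> N"
        unfolding diff_H[OF fH gH msc[OF j]]
        by (rule Y.M.diff_diff2[OF Na f(4) g(4) f(1) H_closed[OF fH msc[OF j]] g(1) H_closed[OF gH msc[OF j]]])
      moreover have "(f \<ominus>\<^bsub>H\<^esub> g) (ms ! i) \<in> N" if "i < j" for i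
        using Y.M.asub_diff[OF Na f(3)[OF that] g(3)[OF that]] diff_H[OF fH gH msc] that j by simp
      moreover have "f \<ominus>\<^bsub>H\<^esub> g \<in> Z" by (rule H.asub_diff[OF H.esub_asub[OF Z] f(2) g(2)])
      ultimately show "x \<ominus>\<^bsub>Y\<^esub> y \<in> P Z j" using f(1) g(1) by (auto simp: P_def)
    next
      fix r assume r: "r \<in> carrier R"
      let ?g = "hom_act M (\<lambda>m\<in>carrier M. ract L M r m) f"
      have gZ: "?g \<in> Z" by (rule H.esub_act[OF Z ract_E[OF r] f(2)])
      have gv: "?g m = ract L Y r (f m)" if "m \<in> carrier M" for m
      proof -
        have "continuous_hom L M TM Y TY f" using fH by (simp add: carrier_H)
        from continuous_hom_smult[OF this M.scalar_closed[OF r] that] show ?thesis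
          using that by (simp add: hom_act_def ract_def)
      qed
      have "ract L Y r (x \<ominus>\<^bsub>Y\<^esub> f (ms ! j)) \<in> N" by (rule Y.rop.esub_act[OF Y.nb_esub[OF N] r f(4)])
      then have "ract L Y r x \<ominus>\<^bsub>Y\<^esub> ?g (ms ! j) \<in> N"
        using gv[OF msc[OF j]] Y.rop.act_diff[OF r f(1) H_closed[OF fH msc[OF j]]] by simp
      moreover have "?g (ms ! i) \<in> N" if "i < j" for i
        using gv[OF msc] that j Y.rop.esub_act[OF Y.nb_esub[OF N] r f(3)[OF that]] by simp
      ultimately show "ract L Y r x \<in> P Z j" using gZ Y.rop.act_closed[OF r f(1)] by (auto simp: P_def) }
  qed
  define LEN where "LEN Z = (\<Sum>j<?n. len (P Z j))" for Z
  have "LEN U < LEN V"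
    if U: "H.esub U" and V: "H.esub V" and NU: "hom_into M (carrier H) N \<subseteq> U" and UV: "U \<subset> V" for U V
  proof -
    have sub: "P U j \<subseteq> P V j" for j using UV by (auto simp: P_def)
    have le: "len (P U j) \<le> len (P V j)" if "j < ?n" for j
    proof (cases "P U j = P V j")
      case False
      with sub have "P U j \<subset> P V j" by (rule psubsetI)
      then show ?thesis using len[OF P[OF U that] P[OF V that] NP[OF U that]] by simp
    qed simp
    have "\<exists>j<?n. P U j \<noteq> P V j"
    proof (rule ccontr)
      assume "\<not> (\<exists>j<?n. P U j \<noteq> P V j)"
      then have eq: "P U j = P V j" if "j < ?n" for j using that by blast
      have "f \<in> U" if f: "f \<in> V" for f
      proof -
        note fH = Zc[OF V f]
        \<comment> \<open>Elimination along the list of generators: equality of the value sets at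
          the k-th generator supplies a correction in \<open>U\<close> that does not disturb the
          earlier ones.\<close>
        have "\<exists>g\<in>U. \<forall>i<k. (f \<ominus>\<^bsub>H\<^esub> g) (ms ! i) \<in> N" if "k \<le> ?n" for k
          using that
        proof (induction k)
          case 0
          then show ?case using H.asub_zero[OF H.esub_asub[OF U]] by blast
        next
          case (Suc k)
          then obtain g where g: "g \<in> U" "\<And>i. i < k \<Longrightarrow> (f \<ominus>\<^bsub>H\<^esub> g) (ms ! i) \<in> N" by auto
          have k: "k < ?n" using Suc by simp
          note gH = Zc[OF U g(1)]
          have fg: "f \<ominus>\<^bsub>H\<^esub> g \<in> V" using H.asub_diff[OF H.esub_asub[OF V] f] g(1) UV by blast
          note fgH = Zc[OF V fg]
          have "(f \<ominus>\<^bsub>H\<^esub> g) (ms ! k) \<in> P V k"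
            unfolding P_def using fg g(2) H_closed[OF fgH msc[OF k]] Y.M.asub_zero[OF Na]
            by (auto intro!: bexI[of _ "f \<ominus>\<^bsub>H\<^esub> g"])
          then have "(f \<ominus>\<^bsub>H\<^esub> g) (ms ! k) \<in> P U k" by (simp add: eq[OF k])
          then obtain h where h: "h \<in> U" "\<And>i. i < k \<Longrightarrow> h (ms ! i) \<in> N" "(f \<ominus>\<^bsub>H\<^esub> g) (ms ! k) \<ominus>\<^bsub>Y\<^esub> h (ms ! k) \<in> N"
            by (auto simp: P_def)
          note hH = Zc[OF U h(1)]
          have e: "f \<ominus>\<^bsub>H\<^esub> (g \<oplus>\<^bsub>H\<^esub> h) = (f \<ominus>\<^bsub>H\<^esub> g) \<ominus>\<^bsub>H\<^esub> h" using fH gH hH by (simp add: H.agr)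
          have "(f \<ominus>\<^bsub>H\<^esub> (g \<oplus>\<^bsub>H\<^esub> h)) (ms ! i) \<in> N" if "i < Suc k" for i
            unfolding e using that h(3) Y.M.asub_diff[OF Na g(2) h(2)] k msc
            by (cases "i = k") (simp_all add: diff_H[OF fgH hH])
          then show ?case using H.asub_add[OF H.esub_asub[OF U] g(1) h(1)] by blast
        qed
        from this[OF order_refl] obtain g where g: "g \<in> U" "\<And>i. i < ?n \<Longrightarrow> (f \<ominus>\<^bsub>H\<^esub> g) (ms ! i) \<in> N" by blast
        note gH = Zc[OF U g(1)]
        let ?h = "f \<ominus>\<^bsub>H\<^esub> g"
        have hH: "?h \<in> carrier H" using fH gH by simp
        then have hc: "continuous_hom L M TM Y TY ?h" by (simp add: carrier_H)
        \<comment> \<open>This submodule contains the generators, so a homomorphism that vanishes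
          modulo N on them vanishes modulo N on all of M.\<close>
        have "{m \<in> carrier M. ?h m \<in> N} = carrier M"
        proof (rule A(3))
          show "submodule {m \<in> carrier M. ?h m \<in> N} L M"
            by (rule M.nb_submodule[OF M.nb_vimage[OF Y.tmod_axioms hc N]])
          show "A \<subseteq> {m \<in> carrier M. ?h m \<in> N}" using A(2) g(2) ms by (auto simp: in_set_conv_nth)
        qed
        then have "?h \<in> hom_into M (carrier H) N" using hH by (auto simp: in_hom_into)
        then have "?h \<in> U" using NU by blast
        then show "f \<in> U" by (rule H.diff_mem[OF H.esub_asub[OF U] _ g(1) fH])
      qed
      then show False using UV by auto
    qed
    then obtain j where j: "j < ?n" "P U j \<noteq> P V j" by blast
    have "P U j \<subset> P V j" using sub j(2) by (rule psubsetI)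
    then have "len (P U j) < len (P V j)" by (rule len[OF P[OF U j(1)] P[OF V j(1)] NP[OF U j(1)]])
    then show ?thesis unfolding LEN_def using j(1) le by (intro sum_strict_mono_ex1) auto
  qed
  then show ?thesis unfolding H.has_length_def by (intro exI[of _ LEN]) simp
qed

text \<open>Completeness and separation are inherited pointwise from Y, the pointwise limit being a
  continuous homomorphism by \<open>continuous_hom_limit\<close>. Finite colength is
  \<open>hom_into_length\<close>, where finite generation of M is used.\<close>

lemma H_lin_compact: "lin_compact H E (hom_act M) \<W>"
proof
  show "\<W> \<noteq> {}" using Y.nb_carrier by blast
  show "H.esub W" if "W \<in> \<W>" for W using that hom_into_esub by blast
  show "\<exists>W''\<in>\<W>. W'' \<subseteq> W \<inter> W'" if "W \<in> \<W>" "W' \<in> \<W>" for W W'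
  proof -
    from that obtain N N' where N: "N \<in> Y.nb" "N' \<in> Y.nb" "W = hom_into M (carrier H) N" "W' = hom_into M (carrier H) N'" by blast
    have "hom_into M (carrier H) (N \<inter> N') \<subseteq> W \<inter> W'" by (auto simp: N hom_into_def)
    then show ?thesis using Y.nb_Int[OF N(1,2)] by blast
  qed
  show "f = \<zero>\<^bsub>H\<^esub>" if f: "f \<in> carrier H" and *: "\<And>W. W \<in> \<W> \<Longrightarrow> f \<in> W" for f
  proof (rule H_eqI[OF f H.zero_closed])
    fix m assume m: "m \<in> carrier M"
    have "f m = \<zero>\<^bsub>Y\<^esub>"
    proof (rule Y.nb_sep[OF H_closed[OF f m]])
      fix N assume "N \<in> Y.nb"
      then have "f \<in> hom_into M (carrier H) N" using * by blast
      then show "f m \<in> N" using m by (simp add: hom_into_def)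
    qed
    then show "f m = \<zero>\<^bsub>H\<^esub> m" using m by (simp add: zero_H)
  qed
  show "\<exists>len::('m \<Rightarrow> 'y) set \<Rightarrow> nat. \<forall>A B. H.esub A \<and> H.esub B \<and> W \<subseteq> A \<and> A \<subset> B \<longrightarrow> len A < len B" if "W \<in> \<W>" for W
    using that hom_into_length unfolding H.has_length_def by blast
  fix a assume aH: "\<And>W. W \<in> \<W> \<Longrightarrow> a W \<in> carrier H"
    and compat: "\<And>W W'. W \<in> \<W> \<Longrightarrow> W' \<in> \<W> \<Longrightarrow> W \<subseteq> W' \<Longrightarrow> a W \<ominus>\<^bsub>H\<^esub> a W' \<in> W'"
  \<comment> \<open>Different submodules of Y may give the same subgroup of Hom(M, Y); indexing by
    the submodules of Y avoids a choice among them.\<close>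
  define b where "b N = a (hom_into M (carrier H) N)" for N
  have bH: "b N \<in> carrier H" if "N \<in> Y.nb" for N unfolding b_def using that by (intro aH) blast
  have bc: "b N m \<ominus>\<^bsub>Y\<^esub> b N' m \<in> N'" if N: "N \<in> Y.nb" "N' \<in> Y.nb" "N \<subseteq> N'" and m: "m \<in> carrier M" for N N' m
  proof -
    have "b N \<ominus>\<^bsub>H\<^esub> b N' \<in> hom_into M (carrier H) N'"
      unfolding b_def by (rule compat) (use N in \<open>auto simp: hom_into_def\<close>)
    then have "(b N \<ominus>\<^bsub>H\<^esub> b N') m \<in> N'" using m unfolding in_hom_into by blast
    then show ?thesis unfolding diff_H[OF bH[OF N(1)] bH[OF N(2)] m] .
  qed
  have "\<exists>y\<in>carrier Y. \<forall>N\<in>Y.nb. y \<ominus>\<^bsub>Y\<^esub> b N m \<in> N" if m: "m \<in> carrier M" for m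
    by (rule Y.nb_complete) (use bH H_closed m bc in auto)
  then obtain f where f: "\<And>m. m \<in> carrier M \<Longrightarrow> f m \<in> carrier Y"
      "\<And>m N. m \<in> carrier M \<Longrightarrow> N \<in> Y.nb \<Longrightarrow> f m \<ominus>\<^bsub>Y\<^esub> b N m \<in> N" by metis
  have bhom: "continuous_hom L M TM Y TY (b N)" if "N \<in> Y.nb" for N using bH[OF that] by (simp add: carrier_H)
  have "continuous_hom L M TM Y TY f"
    by (rule M.continuous_hom_limit[OF Y.pcmod_axioms bhom f])
  then have fH: "restrict f (carrier M) \<in> carrier H" by (rule restrict_H)
  have "restrict f (carrier M) \<ominus>\<^bsub>H\<^esub> a W \<in> W" if W: "W \<in> \<W>" for W
  proof -
    from W obtain N where N: "N \<in> Y.nb" "W = hom_into M (carrier H) N" by blast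
    then have "a W = b N" by (simp add: b_def)
    then show ?thesis using fH bH[OF N(1)] f(2) N by (auto simp: in_hom_into diff_H)
  qed
  then show "\<exists>x\<in>carrier H. \<forall>W\<in>\<W>. x \<ominus>\<^bsub>H\<^esub> a W \<in> W" using fH by blast
qed

end

section \<open>Summands and powers\<close>

context tmod
begin

lemma sub_left_module:
  assumes S: "submodule S L M"
  shows "left_module L (M\<lparr>carrier := S\<rparr>)"
proof -
  have Sa: "asub M S" by (rule submodule_asub[OF S])
  have Sc: "x \<in> S \<Longrightarrow> x \<in> carrier M" for x by (rule M.asub_subset[OF Sa])
  have "abelian_group (M\<lparr>carrier := S\<rparr>)"
  proof (rule abelian_groupI)
    show "\<exists>y\<in>carrier (M\<lparr>carrier := S\<rparr>). y \<oplus>\<^bsub>M\<lparr>carrier := S\<rparr>\<^esub> x = \<zero>\<^bsub>M\<lparr>carrier := S\<rparr>\<^esub>"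
      if "x \<in> carrier (M\<lparr>carrier := S\<rparr>)" for x
      using that by (intro bexI[of _ "\<ominus>\<^bsub>M\<^esub> x"]) (auto simp: M.l_neg Sc M.asub_neg[OF Sa])
  qed (use M.asub_add[OF Sa] M.asub_zero[OF Sa] Sc in \<open>auto simp: M.a_ac\<close>)
  then show ?thesis
    using S Sc by (auto simp: left_module_def left_module_axioms_def L.ring_axioms submodule_iff
        smult_l_distr smult_r_distr smult_assoc smult_one)
qed

text \<open>Negatives are defined as inverses within the carrier, so they have to be compared once
  the carrier of the record is replaced.\<close>

lemma sub_minus:
  assumes S: "submodule S L M" and x: "x \<in> S" "y \<in> S"
  shows "x \<ominus>\<^bsub>M\<lparr>carrier := S\<rparr>\<^esub> y = x \<ominus>\<^bsub>M\<^esub> y"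
proof -
  interpret S: left_module L "M\<lparr>carrier := S\<rparr>" by (rule sub_left_module[OF S])
  have Sa: "asub M S" by (rule submodule_asub[OF S])
  have Sc: "x \<in> S \<Longrightarrow> x \<in> carrier M" for x by (rule M.asub_subset[OF Sa])
  have "\<ominus>\<^bsub>M\<lparr>carrier := S\<rparr>\<^esub> y = \<ominus>\<^bsub>M\<^esub> y"
    by (rule S.M.minus_equality) (use x Sc M.asub_neg[OF Sa] M.l_neg in auto)
  then show ?thesis by (simp add: a_minus_def)
qed

lemma sub_tmod:
  assumes S: "submodule S L M"
  shows "tmod R L (M\<lparr>carrier := S\<rparr>) TL (subtopology TM S)"
proof -
  interpret S: left_module L "M\<lparr>carrier := S\<rparr>" by (rule sub_left_module[OF S])
  have Sa: "asub M S" by (rule submodule_asub[OF S])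
  have Sc: "x \<in> S \<Longrightarrow> x \<in> carrier M" for x by (rule M.asub_subset[OF Sa])
  have neg: "\<ominus>\<^bsub>M\<lparr>carrier := S\<rparr>\<^esub> y = \<ominus>\<^bsub>M\<^esub> y" if "y \<in> S" for y
    by (rule S.M.minus_equality) (use that Sc M.asub_neg[OF Sa] M.l_neg in auto)
  have ts: "topspace (subtopology TM S) = S" using Sc by (auto simp: topspaceM)
  show ?thesis
  proof
    show "topspace TL = carrier L" by (rule topspaceL)
    show "topspace (subtopology TM S) = carrier (M\<lparr>carrier := S\<rparr>)" using ts by simp
    show "continuous_map (prod_topology (subtopology TM S) (subtopology TM S)) (subtopology TM S)
        (\<lambda>(x, y). x \<oplus>\<^bsub>M\<lparr>carrier := S\<rparr>\<^esub> y)"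
      unfolding subtopology_Times[symmetric] continuous_map_in_subtopology
      using continuous_map_from_subtopology[OF cont_add] M.asub_add[OF Sa] by auto
    have "continuous_map (subtopology TM S) TM (\<lambda>x. \<ominus>\<^bsub>M\<lparr>carrier := S\<rparr>\<^esub> x)"
      by (rule continuous_map_eq[OF continuous_map_from_subtopology[OF cont_neg]]) (simp add: neg)
    then show "continuous_map (subtopology TM S) (subtopology TM S) (\<lambda>x. \<ominus>\<^bsub>M\<lparr>carrier := S\<rparr>\<^esub> x)"
      unfolding continuous_map_in_subtopology using neg M.asub_neg[OF Sa] by auto
    have "prod_topology TL (subtopology TM S) = subtopology (prod_topology TL TM) (carrier L \<times> S)"
      by (simp add: subtopology_Times flip: topspaceL)
    then show "continuous_map (prod_topology TL (subtopology TM S)) (subtopology TM S)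
        (\<lambda>(a, x). a \<odot>\<^bsub>M\<lparr>carrier := S\<rparr>\<^esub> x)"
      unfolding continuous_map_in_subtopology
      using continuous_map_from_subtopology[OF cont_smult] S by (auto simp: submodule_iff)
  qed
qed

lemma sub_incl_hom: "submodule S L M \<Longrightarrow> continuous_hom L (M\<lparr>carrier := S\<rparr>) (subtopology TM S) M TM (\<lambda>x. x)"
  using M.asub_subset[OF submodule_asub] by (auto simp: continuous_hom_def continuous_map_from_subtopology)

lemma continuous_hom_into_sub:
  assumes "submodule S L M" "continuous_hom L A TA M TM f" "topspace TA = carrier A" "\<And>x. x \<in> carrier A \<Longrightarrow> f x \<in> S"
  shows "continuous_hom L A TA (M\<lparr>carrier := S\<rparr>) (subtopology TM S) f"
  using assms by (auto simp: continuous_hom_def continuous_map_in_subtopology)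

end

context pcmod
begin

text \<open>The premise \<open>closed\<close> says that S contains its closure. A compatible family
  in S has a limit in M by completeness, and this limit is approximated by elements of S.\<close>

lemma sub_pcmod:
  assumes S: "submodule S L M"
    and closed: "\<And>x. x \<in> carrier M \<Longrightarrow> (\<And>N. N \<in> nb \<Longrightarrow> \<exists>s\<in>S. x \<ominus>\<^bsub>M\<^esub> s \<in> N) \<Longrightarrow> x \<in> S"
  shows "pcmod R L (M\<lparr>carrier := S\<rparr>) TL (subtopology TM S)"
proof -
  interpret S: tmod R L "M\<lparr>carrier := S\<rparr>" TL "subtopology TM S" by (rule sub_tmod[OF S])
  have Sa: "asub M S" by (rule submodule_asub[OF S])
  have Sc: "x \<in> S \<Longrightarrow> x \<in> carrier M" for x by (rule M.asub_subset[OF Sa])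
  have nbS: "{x \<in> S. x \<in> N} \<in> S.nb" if "N \<in> nb" for N
    using S.nb_vimage[OF tmod_axioms sub_incl_hom[OF S] that] by simp
  have base: "\<exists>N\<in>nb. {x \<in> S. x \<in> N} \<subseteq> U" if U: "openin (subtopology TM S) U" "\<zero>\<^bsub>M\<^esub> \<in> U" for U
  proof -
    from U(1) obtain V where V: "openin TM V" "U = V \<inter> S" by (auto simp: openin_subtopology)
    with U(2) nb_base[OF V(1)] obtain N where "N \<in> nb" "N \<subseteq> V" by blast
    then show ?thesis using V by blast
  qed
  show ?thesis
  proof
    show "\<exists>N\<in>S.nb. N \<subseteq> U" if "openin (subtopology TM S) U" "\<zero>\<^bsub>M\<lparr>carrier := S\<rparr>\<^esub> \<in> U" for U
      using base[OF that(1)] that(2) nbS by auto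
    show "x = \<zero>\<^bsub>M\<lparr>carrier := S\<rparr>\<^esub>" if x: "x \<in> carrier (M\<lparr>carrier := S\<rparr>)" "\<And>N. N \<in> S.nb \<Longrightarrow> x \<in> N" for x
    proof -
      have "x = \<zero>\<^bsub>M\<^esub>" by (rule nb_sep) (use x Sc nbS in auto)
      then show ?thesis by simp
    qed
    fix a assume a: "\<And>N. N \<in> S.nb \<Longrightarrow> a N \<in> carrier (M\<lparr>carrier := S\<rparr>)"
      and compat: "\<And>N N'. N \<in> S.nb \<Longrightarrow> N' \<in> S.nb \<Longrightarrow> N \<subseteq> N' \<Longrightarrow> a N \<ominus>\<^bsub>M\<lparr>carrier := S\<rparr>\<^esub> a N' \<in> N'"
    have aS: "a N \<in> S" if "N \<in> S.nb" for N using a[OF that] by simp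
    have compat': "a N \<ominus>\<^bsub>M\<^esub> a N' \<in> N'" if "N \<in> S.nb" "N' \<in> S.nb" "N \<subseteq> N'" for N N'
      using compat[OF that] sub_minus[OF S aS[OF that(1)] aS[OF that(2)]] by simp
    \<comment> \<open>The traces on S of members of \<open>nb\<close> are cofinal in
      \<open>S.nb\<close>, so the values of \<open>a\<close> at the traces determine the
      limit.\<close>
    let ?b = "\<lambda>N. a {x \<in> S. x \<in> N}"
    have "\<exists>x\<in>carrier M. \<forall>N\<in>nb. x \<ominus>\<^bsub>M\<^esub> ?b N \<in> N"
    proof (rule nb_complete)
      show "?b N \<in> carrier M" if "N \<in> nb" for N using aS[OF nbS[OF that]] Sc by blast
      show "?b N \<ominus>\<^bsub>M\<^esub> ?b N' \<in> N'" if N: "N \<in> nb" "N' \<in> nb" "N \<subseteq> N'" for N N'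
        using compat'[OF nbS[OF N(1)] nbS[OF N(2)]] N(3) by auto
    qed
    then obtain x where x: "x \<in> carrier M" "\<And>N. N \<in> nb \<Longrightarrow> x \<ominus>\<^bsub>M\<^esub> ?b N \<in> N" by blast
    have xS: "x \<in> S" by (rule closed[OF x(1)]) (use x(2) aS[OF nbS] in blast)
    have "x \<ominus>\<^bsub>M\<^esub> a K \<in> K" if K: "K \<in> S.nb" for K
    proof -
      have "\<zero>\<^bsub>M\<^esub> \<in> K" using S.nb_zero[OF K] by simp
      from base[OF S.nb_open[OF K] this] obtain N where N: "N \<in> nb" "{x \<in> S. x \<in> N} \<subseteq> K" by blast
      have "x \<ominus>\<^bsub>M\<^esub> ?b N \<in> K"
        using x(2)[OF N(1)] M.asub_diff[OF Sa xS aS[OF nbS[OF N(1)]]] N(2) by blast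
      moreover have "?b N \<ominus>\<^bsub>M\<^esub> a K \<in> K" by (rule compat'[OF nbS[OF N(1)] K N(2)])
      moreover have "asub M K"
        using S.nb_asub[OF K] sub_minus[OF S] by (auto simp: asub_def Sc subset_iff)
      ultimately show ?thesis
        using M.diff_trans[of K x "?b N" "a K"] x(1) aS[OF K] aS[OF nbS[OF N(1)]] Sc by blast
    qed
    then show "\<exists>x\<in>carrier (M\<lparr>carrier := S\<rparr>). \<forall>N\<in>S.nb. x \<ominus>\<^bsub>M\<lparr>carrier := S\<rparr>\<^esub> a N \<in> N"
      using xS sub_minus[OF S xS aS] by (intro bexI[of _ x]) auto
  qed
qed

text \<open>Kernels are closed, and both parts of a decomposition by an idempotent e are kernels:
  the summand that of 1 - e, its complement that of e.\<close>

lemma kernel_pcmod: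
  assumes f: "continuous_hom L M TM M TM f"
  defines "S \<equiv> {x \<in> carrier M. f x = \<zero>\<^bsub>M\<^esub>}"
  shows "submodule S L M" and "pcmod R L (M\<lparr>carrier := S\<rparr>) TL (subtopology TM S)"
proof -
  have "asub M {x \<in> carrier M. f x \<in> {\<zero>\<^bsub>M\<^esub>}}"
    by (rule M.asub_vimage[OF M.asub_carrier M.abelian_group_axioms M.asub_singleton])
      (use continuous_hom_closed[OF f] continuous_hom_diff[OF tmod_axioms f] in auto)
  then show S: "submodule S L M"
    using continuous_hom_smult[OF f] by (auto simp: submodule_iff S_def smult_closed smult_zero)
  show "pcmod R L (M\<lparr>carrier := S\<rparr>) TL (subtopology TM S)"
  proof (rule sub_pcmod[OF S])
    fix x assume x: "x \<in> carrier M" and *: "\<And>N. N \<in> nb \<Longrightarrow> \<exists>s\<in>S. x \<ominus>\<^bsub>M\<^esub> s \<in> N"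
    have "f x = \<zero>\<^bsub>M\<^esub>"
    proof (rule nb_sep[OF continuous_hom_closed[OF f x]])
      fix N assume N: "N \<in> nb"
      from *[OF nb_vimage[OF tmod_axioms f N]] obtain s where s: "s \<in> S" "f (x \<ominus>\<^bsub>M\<^esub> s) \<in> N" by auto
      then have "f x \<ominus>\<^bsub>M\<^esub> f s \<in> N" using x by (simp add: continuous_hom_diff[OF tmod_axioms f] S_def)
      then show "f x \<in> N" using s(1) continuous_hom_closed[OF f x] by (simp add: S_def)
    qed
    then show "x \<in> S" using x by (simp add: S_def)
  qed
qed

end

section \<open>Powers of M and homomorphisms out of them\<close>

definition pinj :: "('l, 'm) module \<Rightarrow> 'i set \<Rightarrow> 'i \<Rightarrow> 'm \<Rightarrow> 'i \<Rightarrow> 'm" where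
  "pinj M I i m = (\<lambda>j\<in>I. if j = i then m else \<zero>\<^bsub>M\<^esub>)"

definition ptrunc :: "('l, 'm) module \<Rightarrow> 'i set \<Rightarrow> 'i set \<Rightarrow> ('i \<Rightarrow> 'm) \<Rightarrow> 'i \<Rightarrow> 'm" where
  "ptrunc M I F x = (\<lambda>j\<in>I. if j \<in> F then x j else \<zero>\<^bsub>M\<^esub>)"

locale power_pc = M: pcmod R L M TL TM
  for R :: "'r ring" and L :: "('r, 'l) module" and M :: "('l, 'm) module" and TL :: "'l topology" and TM :: "'m topology" +
  fixes I :: "'i set"
begin

abbreviation "P \<equiv> power_module I M"
abbreviation "TP \<equiv> product_topology (\<lambda>_. TM) I"

lemma carrier_P: "carrier P = (\<Pi>\<^sub>E i\<in>I. carrier M)"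
  and zero_P: "\<zero>\<^bsub>P\<^esub> = (\<lambda>i\<in>I. \<zero>\<^bsub>M\<^esub>)"
  and add_P: "x \<oplus>\<^bsub>P\<^esub> y = (\<lambda>i\<in>I. x i \<oplus>\<^bsub>M\<^esub> y i)"
  and smult_P: "a \<odot>\<^bsub>P\<^esub> x = (\<lambda>i\<in>I. a \<odot>\<^bsub>M\<^esub> x i)"
  by (simp_all add: power_module_def)

lemma P_closed: "x \<in> carrier P \<Longrightarrow> i \<in> I \<Longrightarrow> x i \<in> carrier M"
  by (auto simp: carrier_P)

lemma P_eqI: "x \<in> carrier P \<Longrightarrow> y \<in> carrier P \<Longrightarrow> (\<And>i. i \<in> I \<Longrightarrow> x i = y i) \<Longrightarrow> x = y"
  by (auto simp: carrier_P intro: PiE_ext)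

lemma P_abelian_group: "abelian_group P"
proof (rule abelian_groupI)
  show "\<zero>\<^bsub>P\<^esub> \<oplus>\<^bsub>P\<^esub> x = x" if "x \<in> carrier P" for x
    by (rule P_eqI) (use that P_closed[OF that] in \<open>auto simp: carrier_P zero_P add_P\<close>)
  show "\<exists>y\<in>carrier P. y \<oplus>\<^bsub>P\<^esub> x = \<zero>\<^bsub>P\<^esub>" if x: "x \<in> carrier P" for x
    using P_closed[OF x] by (intro bexI[of _ "\<lambda>i\<in>I. \<ominus>\<^bsub>M\<^esub> x i"]) (auto simp: carrier_P zero_P add_P M.M.l_neg)
qed (auto simp: carrier_P zero_P add_P M.M.a_ac P_closed)

lemma P_left_module: "left_module L P"
proof -
  interpret P: abelian_group P by (rule P_abelian_group)
  show ?thesis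
  proof
    show "\<one>\<^bsub>L\<^esub> \<odot>\<^bsub>P\<^esub> x = x" if "x \<in> carrier P" for x
      by (rule P_eqI) (use that P_closed[OF that] M.smult_one M.smult_closed in \<open>auto simp: carrier_P smult_P\<close>)
  qed (auto simp: carrier_P smult_P add_P M.smult_closed M.smult_l_distr M.smult_r_distr M.smult_assoc P_closed)
qed

lemma topspace_P: "topspace TP = carrier P"
  by (simp add: carrier_P M.topspaceM)

lemma P_tmod: "tmod R L P TL TP"
proof -
  interpret P: left_module L P by (rule P_left_module)
  have neg: "\<ominus>\<^bsub>P\<^esub> x = (\<lambda>i\<in>I. \<ominus>\<^bsub>M\<^esub> x i)" if x: "x \<in> carrier P" for x
    by (rule P.M.minus_equality) (use x P_closed[OF x] in \<open>auto simp: carrier_P zero_P add_P M.M.l_neg\<close>)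
  have pr: "continuous_map TP TM (\<lambda>x. x k)" if "k \<in> I" for k by (rule continuous_map_product_projection[OF that])
  show ?thesis
  proof
    show "topspace TL = carrier L" by (rule M.topspaceL)
    show "topspace TP = carrier P" by (rule topspace_P)
    show "continuous_map (prod_topology TP TP) TP (\<lambda>(x, y). x \<oplus>\<^bsub>P\<^esub> y)"
      unfolding continuous_map_componentwise
    proof (intro conjI ballI)
      fix k assume k: "k \<in> I"
      have "continuous_map (prod_topology TP TP) TM ((\<lambda>(x, y). x \<oplus>\<^bsub>M\<^esub> y) \<circ> (\<lambda>p. (fst p k, snd p k)))"
        by (rule continuous_map_compose[OF _ M.cont_add])
          (intro continuous_map_pairedI continuous_map_compose[OF continuous_map_fst pr[OF k], unfolded o_def]
            continuous_map_compose[OF continuous_map_snd pr[OF k], unfolded o_def])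
      then show "continuous_map (prod_topology TP TP) TM (\<lambda>p. (case p of (x, y) \<Rightarrow> x \<oplus>\<^bsub>P\<^esub> y) k)"
        by (rule continuous_map_eq) (auto simp: add_P k)
    qed (auto simp: add_P)
    show "continuous_map TP TP (\<lambda>x. \<ominus>\<^bsub>P\<^esub> x)"
      unfolding continuous_map_componentwise
    proof (intro conjI ballI)
      fix k assume k: "k \<in> I"
      have "continuous_map TP TM ((\<lambda>x. \<ominus>\<^bsub>M\<^esub> x) \<circ> (\<lambda>p. p k))"
        by (rule continuous_map_compose[OF pr[OF k] M.cont_neg])
      then show "continuous_map TP TM (\<lambda>p. (\<ominus>\<^bsub>P\<^esub> p) k)"
        by (rule continuous_map_eq) (simp add: topspace_P neg k del: topspace_product_topology)
    qed (auto simp: topspace_P neg simp del: topspace_product_topology)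
    show "continuous_map (prod_topology TL TP) TP (\<lambda>(a, x). a \<odot>\<^bsub>P\<^esub> x)"
      unfolding continuous_map_componentwise
    proof (intro conjI ballI)
      fix k assume k: "k \<in> I"
      have "continuous_map (prod_topology TL TP) TM ((\<lambda>(x, y). x \<odot>\<^bsub>M\<^esub> y) \<circ> (\<lambda>p. (fst p, snd p k)))"
        by (rule continuous_map_compose[OF _ M.cont_smult])
          (intro continuous_map_pairedI continuous_map_fst continuous_map_compose[OF continuous_map_snd pr[OF k], unfolded o_def])
      then show "continuous_map (prod_topology TL TP) TM (\<lambda>p. (case p of (x, y) \<Rightarrow> x \<odot>\<^bsub>P\<^esub> y) k)"
        by (rule continuous_map_eq) (auto simp: smult_P k)
    qed (auto simp: smult_P)
  qed
qed

sublocale P: tmod R L P TL TP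
  by (rule P_tmod)

lemma minus_P: "x \<in> carrier P \<Longrightarrow> y \<in> carrier P \<Longrightarrow> i \<in> I \<Longrightarrow> (x \<ominus>\<^bsub>P\<^esub> y) i = x i \<ominus>\<^bsub>M\<^esub> y i"
proof -
  assume x: "x \<in> carrier P" and y: "y \<in> carrier P" and i: "i \<in> I"
  have "x = (x \<ominus>\<^bsub>P\<^esub> y) \<oplus>\<^bsub>P\<^esub> y" using x y by (simp add: P.M.agr)
  then have "x i = ((x \<ominus>\<^bsub>P\<^esub> y) \<oplus>\<^bsub>P\<^esub> y) i" by (rule arg_cong)
  then have "x i = (x \<ominus>\<^bsub>P\<^esub> y) i \<oplus>\<^bsub>M\<^esub> y i" using i by (simp add: add_P)
  moreover have "(x \<ominus>\<^bsub>P\<^esub> y) i \<in> carrier M" by (rule P_closed[OF P.M.minus_closed[OF x y] i])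
  ultimately show ?thesis using P_closed[OF y i] by (simp add: M.M.agr)
qed

lemma proj_hom: "i \<in> I \<Longrightarrow> continuous_hom L P TP M TM (\<lambda>x. x i)"
  using continuous_map_product_projection[of i I "\<lambda>_. TM"]
  by (auto simp: continuous_hom_def P_closed add_P smult_P)

lemma cyl_nb: "i \<in> I \<Longrightarrow> N \<in> M.nb \<Longrightarrow> {x \<in> carrier P. x i \<in> N} \<in> P.nb"
  by (rule P.nb_vimage[OF M.tmod_axioms proj_hom])

lemma P_base:
  assumes U: "openin TP U" "\<zero>\<^bsub>P\<^esub> \<in> U"
  obtains F N where "finite F" "F \<subseteq> I" "\<And>i. i \<in> F \<Longrightarrow> N i \<in> M.nb" "{x \<in> carrier P. \<forall>i\<in>F. x i \<in> N i} \<subseteq> U"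
proof -
  have "\<exists>W. finite {i \<in> I. W i \<noteq> topspace TM} \<and> (\<forall>i\<in>I. openin TM (W i)) \<and> \<zero>\<^bsub>P\<^esub> \<in> Pi\<^sub>E I W \<and> Pi\<^sub>E I W \<subseteq> U"
    using U(1) unfolding openin_product_topology_alt by (rule bspec[OF _ U(2)])
  then obtain W where W: "finite {i \<in> I. W i \<noteq> topspace TM}" "\<And>i. i \<in> I \<Longrightarrow> openin TM (W i)"
    "\<zero>\<^bsub>P\<^esub> \<in> Pi\<^sub>E I W" "Pi\<^sub>E I W \<subseteq> U" by (elim exE conjE) blast
  have "\<exists>N\<in>M.nb. N \<subseteq> W i" if "i \<in> I" for i
    by (rule M.nb_base[OF W(2)[OF that]]) (use W(3) that in \<open>auto simp: zero_P PiE_iff\<close>)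
  then obtain N where N: "\<And>i. i \<in> I \<Longrightarrow> N i \<in> M.nb" "\<And>i. i \<in> I \<Longrightarrow> N i \<subseteq> W i" by metis
  show thesis
  proof (rule that[of "{i \<in> I. W i \<noteq> topspace TM}" N, OF W(1)])
    have "x \<in> Pi\<^sub>E I W" if x: "x \<in> carrier P" "\<forall>i\<in>{i \<in> I. W i \<noteq> topspace TM}. x i \<in> N i" for x
    proof (rule PiE_I)
      show "x i \<in> W i" if i: "i \<in> I" for i
        using x N(2)[OF i] P_closed[OF x(1) i] i M.topspaceM by (cases "W i = topspace TM") auto
    qed (use x in \<open>auto simp: carrier_P\<close>)
    then show "{x \<in> carrier P. \<forall>i\<in>{i \<in> I. W i \<noteq> topspace TM}. x i \<in> N i} \<subseteq> U" using W(4) by blast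
  qed (use N in auto)
qed

lemma cyls_nb:
  assumes "finite F" "F \<subseteq> I" "\<And>i. i \<in> F \<Longrightarrow> N i \<in> M.nb"
  shows "{x \<in> carrier P. \<forall>i\<in>F. x i \<in> N i} \<in> P.nb"
proof -
  have "carrier P \<inter> \<Inter>((\<lambda>i. {x \<in> carrier P. x i \<in> N i}) ` F) \<in> P.nb"
    using assms by (intro P.nb_Inter) (auto intro!: cyl_nb)
  moreover have "carrier P \<inter> \<Inter>((\<lambda>i. {x \<in> carrier P. x i \<in> N i}) ` F) = {x \<in> carrier P. \<forall>i\<in>F. x i \<in> N i}" by auto
  ultimately show ?thesis by simp
qed

text \<open>Limits are taken coordinatewise, reading coordinate i modulo N from the member of the
  family at the cylinder over N. This is the limit modulo any K because K contains a finite
  intersection of cylinders.\<close>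

lemma P_pcmod: "pcmod R L P TL TP"
proof
  show "\<exists>N\<in>P.nb. N \<subseteq> U" if U: "openin TP U" "\<zero>\<^bsub>P\<^esub> \<in> U" for U
  proof -
    obtain F N where F: "finite F" "F \<subseteq> I" "\<And>i. i \<in> F \<Longrightarrow> N i \<in> M.nb" "{x \<in> carrier P. \<forall>i\<in>F. x i \<in> N i} \<subseteq> U"
      by (rule P_base[OF U]) (rule that; assumption)
    show ?thesis by (intro bexI[of _ "{x \<in> carrier P. \<forall>i\<in>F. x i \<in> N i}"] F(4) cyls_nb F(1,2,3))
  qed
  show "x = \<zero>\<^bsub>P\<^esub>" if x: "x \<in> carrier P" "\<And>N. N \<in> P.nb \<Longrightarrow> x \<in> N" for x
  proof (rule P_eqI[OF x(1) P.M.zero_closed])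
    fix i assume i: "i \<in> I"
    have "x i = \<zero>\<^bsub>M\<^esub>" by (rule M.nb_sep[OF P_closed[OF x(1) i]]) (use x(2)[OF cyl_nb[OF i]] in blast)
    then show "x i = \<zero>\<^bsub>P\<^esub> i" using i by (simp add: zero_P)
  qed
  fix a assume a: "\<And>N. N \<in> P.nb \<Longrightarrow> a N \<in> carrier P"
    and compat: "\<And>N N'. N \<in> P.nb \<Longrightarrow> N' \<in> P.nb \<Longrightarrow> N \<subseteq> N' \<Longrightarrow> a N \<ominus>\<^bsub>P\<^esub> a N' \<in> N'"
  let ?V = "\<lambda>i N. {x \<in> carrier P. x i \<in> N}"
  have ai: "a K i \<ominus>\<^bsub>M\<^esub> a (?V i N) i \<in> N" if "K \<in> P.nb" "i \<in> I" "N \<in> M.nb" "K \<subseteq> ?V i N" for K i N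
  proof -
    have "a K \<ominus>\<^bsub>P\<^esub> a (?V i N) \<in> ?V i N" by (rule compat[OF that(1) cyl_nb[OF that(2,3)] that(4)])
    then show ?thesis using minus_P[OF a[OF that(1)] a[OF cyl_nb[OF that(2,3)]] that(2)] by simp
  qed
  have "\<exists>y\<in>carrier M. \<forall>N\<in>M.nb. y \<ominus>\<^bsub>M\<^esub> a (?V i N) i \<in> N" if i: "i \<in> I" for i
  proof (rule M.nb_complete)
    show "a (?V i N) i \<in> carrier M" if "N \<in> M.nb" for N by (rule P_closed[OF a[OF cyl_nb[OF i that]] i])
    show "a (?V i N) i \<ominus>\<^bsub>M\<^esub> a (?V i N') i \<in> N'" if N: "N \<in> M.nb" "N' \<in> M.nb" "N \<subseteq> N'" for N N'
      by (rule ai[OF cyl_nb[OF i N(1)] i N(2)]) (use N(3) in blast)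
  qed
  then have "\<forall>i\<in>I. \<exists>y. y \<in> carrier M \<and> (\<forall>N\<in>M.nb. y \<ominus>\<^bsub>M\<^esub> a (?V i N) i \<in> N)" unfolding Bex_def by (intro ballI)
  from bchoice[OF this] obtain y where "\<forall>i\<in>I. y i \<in> carrier M \<and> (\<forall>N\<in>M.nb. y i \<ominus>\<^bsub>M\<^esub> a (?V i N) i \<in> N)" ..
  then have y: "\<And>i. i \<in> I \<Longrightarrow> y i \<in> carrier M" "\<And>i N. i \<in> I \<Longrightarrow> N \<in> M.nb \<Longrightarrow> y i \<ominus>\<^bsub>M\<^esub> a (?V i N) i \<in> N" by simp_all
  define z where "z = (\<lambda>i\<in>I. y i)"
  have z: "z \<in> carrier P" using y(1) by (auto simp: z_def carrier_P)
  have "z \<ominus>\<^bsub>P\<^esub> a K \<in> K" if K: "K \<in> P.nb" for K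
  proof -
    obtain F N where
      F: "finite F" "F \<subseteq> I" "\<And>i. i \<in> F \<Longrightarrow> N i \<in> M.nb" "{x \<in> carrier P. \<forall>i\<in>F. x i \<in> N i} \<subseteq> K" by (rule P_base[OF P.nb_open[OF K] P.nb_zero[OF K]]) (rule that; assumption)
    let ?D = "{x \<in> carrier P. \<forall>i\<in>F. x i \<in> N i}"
    have D: "?D \<in> P.nb" by (rule cyls_nb[OF F(1,2,3)])
    have "(z \<ominus>\<^bsub>P\<^esub> a ?D) i \<in> N i" if i: "i \<in> F" for i
    proof -
      have iI: "i \<in> I" using i F(2) by blast
      have sub: "?D \<subseteq> ?V i (N i)" using i by blast
      have c: "y i \<in> carrier M" "a ?D i \<in> carrier M" "a (?V i (N i)) i \<in> carrier M"
        using y(1)[OF iI] P_closed[OF a[OF D] iI] P_closed[OF a[OF cyl_nb[OF iI F(3)[OF i]]] iI] by auto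
      have "a (?V i (N i)) i \<ominus>\<^bsub>M\<^esub> a ?D i \<in> N i"
        by (rule M.M.diff_sym[OF M.nb_asub[OF F(3)[OF i]] ai[OF D iI F(3)[OF i] sub] c(2,3)])
      from M.M.diff_trans[OF M.nb_asub[OF F(3)[OF i]] y(2)[OF iI F(3)[OF i]] this c(1,3,2)]
      show ?thesis using minus_P[OF z a[OF D] iI] iI by (simp add: z_def)
    qed
    then have "z \<ominus>\<^bsub>P\<^esub> a ?D \<in> K" using F(4) P.M.minus_closed[OF z a[OF D]] by blast
    moreover have "a ?D \<ominus>\<^bsub>P\<^esub> a K \<in> K" by (rule compat[OF D K F(4)])
    ultimately show ?thesis by (rule P.M.diff_trans[OF P.nb_asub[OF K] _ _ z a[OF D] a[OF K]])
  qed
  then show "\<exists>x\<in>carrier P. \<forall>N\<in>P.nb. x \<ominus>\<^bsub>P\<^esub> a N \<in> N" using z by blast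
qed

sublocale P: pcmod R L P TL TP
  by (rule P_pcmod)

abbreviation "\<iota> \<equiv> pinj M I"

lemma inj_hom: "i \<in> I \<Longrightarrow> continuous_hom L M TM P TP (\<iota> i)"
proof -
  assume i: "i \<in> I"
  have c: "continuous_map TM TM (\<lambda>m. \<iota> i m k)" if "k \<in> I" for k
    using that M.topspaceM by (cases "k = i") (auto simp: pinj_def)
  show ?thesis unfolding continuous_hom_def continuous_map_componentwise
    using c M.smult_zero by (auto simp: pinj_def carrier_P add_P smult_P fun_eq_iff)
qed

lemma inj_closed: "i \<in> I \<Longrightarrow> m \<in> carrier M \<Longrightarrow> \<iota> i m \<in> carrier P"
  by (rule continuous_hom_closed[OF inj_hom])

lemma trunc_closed: "x \<in> carrier P \<Longrightarrow> ptrunc M I F x \<in> carrier P"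
  by (auto simp: ptrunc_def carrier_P)

lemma trunc_insert: "x \<in> carrier P \<Longrightarrow> i \<in> I \<Longrightarrow> i \<notin> F \<Longrightarrow> ptrunc M I (insert i F) x = ptrunc M I F x \<oplus>\<^bsub>P\<^esub> \<iota> i (x i)"
  using P_closed by (auto simp: ptrunc_def pinj_def add_P fun_eq_iff)

text \<open>A neighbourhood of zero restricts only finitely many coordinates, so elements of finite
  support are dense and a point vanishing at these coordinates lies in it.\<close>

lemma approx:
  assumes K: "K \<in> P.nb"
  obtains F where "finite F" "F \<subseteq> I" "\<And>x. x \<in> carrier P \<Longrightarrow> x \<ominus>\<^bsub>P\<^esub> ptrunc M I F x \<in> K"
    "\<And>x. x \<in> carrier P \<Longrightarrow> (\<And>i. i \<in> F \<Longrightarrow> x i = \<zero>\<^bsub>M\<^esub>) \<Longrightarrow> x \<in> K"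
proof -
  obtain F N where
    F: "finite F" "F \<subseteq> I" "\<And>i. i \<in> F \<Longrightarrow> N i \<in> M.nb" "{x \<in> carrier P. \<forall>i\<in>F. x i \<in> N i} \<subseteq> K" by (rule P_base[OF P.nb_open[OF K] P.nb_zero[OF K]]) (rule that; assumption)
  have *: "x \<in> K" if "x \<in> carrier P" "\<And>i. i \<in> F \<Longrightarrow> x i = \<zero>\<^bsub>M\<^esub>" for x
    using F(4) that M.nb_zero[OF F(3)] by auto
  show thesis
  proof (rule that[OF F(1,2) _ *])
    fix x assume x: "x \<in> carrier P"
    show "x \<ominus>\<^bsub>P\<^esub> ptrunc M I F x \<in> K"
    proof (rule *)
      show "(x \<ominus>\<^bsub>P\<^esub> ptrunc M I F x) i = \<zero>\<^bsub>M\<^esub>" if "i \<in> F" for i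
      proof -
        have "i \<in> I" using that F(2) by blast
        then show ?thesis using minus_P[OF x trunc_closed[OF x]] that P_closed[OF x] by (simp add: ptrunc_def)
      qed
    qed (use x trunc_closed in auto)
  qed
qed

text \<open>Induction principle for truncations, seen as finite sums of coordinate
  inclusions.\<close>

lemma trunc_in:
  assumes "finite F" "F \<subseteq> I" "x \<in> carrier P" "Q \<zero>\<^bsub>P\<^esub>" "\<And>y i. Q y \<Longrightarrow> y \<in> carrier P \<Longrightarrow> i \<in> I \<Longrightarrow> Q (y \<oplus>\<^bsub>P\<^esub> \<iota> i (x i))"
  shows "Q (ptrunc M I F x)"
  using assms(1,2)
proof (induction F rule: finite_induct)
  case empty
  have "ptrunc M I {} x = \<zero>\<^bsub>P\<^esub>" by (auto simp: ptrunc_def zero_P)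
  then show ?case using assms by simp
next
  case (insert i F)
  then show ?case using assms trunc_insert[OF assms(3)] trunc_closed[OF assms(3)] by simp
qed

lemma inj_dense:
  assumes K: "K \<in> P.nb" and inj: "\<And>i m. i \<in> I \<Longrightarrow> m \<in> carrier M \<Longrightarrow> \<iota> i m \<in> K" and x: "x \<in> carrier P"
  shows "x \<in> K"
proof -
  obtain F where F: "finite F" "F \<subseteq> I" "\<And>x. x \<in> carrier P \<Longrightarrow> x \<ominus>\<^bsub>P\<^esub> ptrunc M I F x \<in> K"
    by (rule approx[OF K]) (rule that; assumption)
  have "ptrunc M I F x \<in> K"
    using F(1,2) x by (rule trunc_in[where Q="\<lambda>y. y \<in> K"])
      (use P.nb_zero[OF K] inj P_closed[OF x] P.M.asub_add[OF P.nb_asub[OF K]] in auto)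
  with F(3)[OF x] show ?thesis by (rule P.M.diff_mem[OF P.nb_asub[OF K] _ _ x])
qed

text \<open>The coordinate inclusions generate a dense submodule, and modulo each N the difference
  of \<open>f\<close> and \<open>g\<close> vanishes on it.\<close>

lemma hom_ext:
  assumes "pcmod R L Y TL TY" "continuous_hom L P TP Y TY f" "continuous_hom L P TP Y TY g"
    and eq: "\<And>i m. i \<in> I \<Longrightarrow> m \<in> carrier M \<Longrightarrow> f (\<iota> i m) = g (\<iota> i m)" and x: "x \<in> carrier P"
  shows "f x = g x"
proof -
  interpret Y: pcmod R L Y TL TY by fact
  note d = P.continuous_hom_minus[OF Y.tmod_axioms assms(2,3)]
  show ?thesis
  proof (rule Y.nb_eqI)
    fix N assume N: "N \<in> Y.nb"
    have "x \<in> {x \<in> carrier P. f x \<ominus>\<^bsub>Y\<^esub> g x \<in> N}"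
      by (rule inj_dense[OF P.nb_vimage[OF Y.tmod_axioms d N] _ x])
        (use eq inj_closed continuous_hom_closed[OF assms(3)] Y.nb_zero[OF N] in auto)
    then show "f x \<ominus>\<^bsub>Y\<^esub> g x \<in> N" by simp
  qed (use x continuous_hom_closed[OF assms(2)] continuous_hom_closed[OF assms(3)] in auto)
qed

text \<open>The preimage of N restricts finitely many coordinates only, and every other coordinate
  inclusion maps into it.\<close>

lemma hom_null:
  assumes "tmod R L Y TL TY" "continuous_hom L P TP Y TY f" "N \<in> tmod.nb R L Y TY"
  shows "finite {i \<in> I. \<not> (\<forall>m\<in>carrier M. f (\<iota> i m) \<in> N)}"
proof -
  obtain F where F: "finite F" "F \<subseteq> I"
    "\<And>x. x \<in> carrier P \<Longrightarrow> (\<And>i. i \<in> F \<Longrightarrow> x i = \<zero>\<^bsub>M\<^esub>) \<Longrightarrow> x \<in> {x \<in> carrier P. f x \<in> N}"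
    by (rule approx[OF P.nb_vimage[OF assms]]) (rule that; blast)
  have "f (\<iota> i m) \<in> N" if i: "i \<in> I" "i \<notin> F" and m: "m \<in> carrier M" for i m
  proof -
    have "\<iota> i m j = \<zero>\<^bsub>M\<^esub>" if "j \<in> F" for j
      using that F(2) i(2) by (auto simp: pinj_def)
    from F(3)[OF inj_closed[OF i(1) m] this] show ?thesis by simp
  qed
  then have "{i \<in> I. \<not> (\<forall>m\<in>carrier M. f (\<iota> i m) \<in> N)} \<subseteq> F" by blast
  then show ?thesis using F(1) finite_subset by blast
qed

lemma finite_hom:
  assumes "tmod R L Y TL TY" "finite F" "F \<subseteq> I" "\<And>i. i \<in> I \<Longrightarrow> continuous_hom L M TM Y TY (f i)"
  shows "\<exists>b. continuous_hom L P TP Y TY b \<and>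
    (\<forall>i\<in>I. \<forall>m\<in>carrier M. b (\<iota> i m) = (if i \<in> F then f i m else \<zero>\<^bsub>Y\<^esub>))"
  using assms(2,3)
proof (induction F rule: finite_induct)
  case empty
  then show ?case using P.continuous_hom_zero_map[OF assms(1)] by auto
next
  case (insert k F)
  interpret Y: tmod R L Y TL TY by fact
  from insert obtain b where b: "continuous_hom L P TP Y TY b"
    "\<And>i m. i \<in> I \<Longrightarrow> m \<in> carrier M \<Longrightarrow> b (\<iota> i m) = (if i \<in> F then f i m else \<zero>\<^bsub>Y\<^esub>)" by auto
  have k: "k \<in> I" using insert by auto
  have "continuous_hom L P TP Y TY (\<lambda>x. b x \<oplus>\<^bsub>Y\<^esub> f k (x k))"
    by (rule P.continuous_hom_plus[OF assms(1) b(1) continuous_hom_compose[OF proj_hom[OF k] assms(4)[OF k]]])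
  moreover have "b (\<iota> i m) \<oplus>\<^bsub>Y\<^esub> f k (\<iota> i m k) = (if i \<in> insert k F then f i m else \<zero>\<^bsub>Y\<^esub>)"
    if i: "i \<in> I" and m: "m \<in> carrier M" for i m
    using b(2)[OF i m] insert(2) k continuous_hom_closed[OF assms(4)[OF i] m]
      M.continuous_hom_zero[OF assms(1) assms(4)[OF k]]
    by (cases "i = k") (auto simp: pinj_def)
  ultimately show ?case by (intro exI[of _ "\<lambda>x. b x \<oplus>\<^bsub>Y\<^esub> f k (x k)"] conjI ballI)
qed

text \<open>Converse of \<open>hom_null\<close>. Modulo N only finitely many \<open>f i\<close>
  matter, and their sum, composed with projections, is \<open>b N\<close> from
  \<open>finite_hom\<close>. By density these maps are compatible, and their pointwise limit is the
  required homomorphism.\<close>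

lemma hom_exists:
  assumes "pcmod R L Y TL TY" "\<And>i. i \<in> I \<Longrightarrow> continuous_hom L M TM Y TY (f i)"
    and null: "\<And>N. N \<in> tmod.nb R L Y TY \<Longrightarrow> finite {i \<in> I. \<not> (\<forall>m\<in>carrier M. f i m \<in> N)}"
  shows "\<exists>b. continuous_hom L P TP Y TY b \<and> (\<forall>i\<in>I. \<forall>m\<in>carrier M. b (\<iota> i m) = f i m)"
proof -
  interpret Y: pcmod R L Y TL TY by fact
  let ?F = "\<lambda>N. {i \<in> I. \<not> (\<forall>m\<in>carrier M. f i m \<in> N)}"
  have "\<forall>N\<in>Y.nb. \<exists>b. continuous_hom L P TP Y TY b \<and>
    (\<forall>i\<in>I. \<forall>m\<in>carrier M. b (\<iota> i m) = (if i \<in> ?F N then f i m else \<zero>\<^bsub>Y\<^esub>))"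
    by (intro ballI finite_hom[OF Y.tmod_axioms null _ assms(2)]) auto
  from bchoice[OF this] obtain b where "\<forall>N\<in>Y.nb. continuous_hom L P TP Y TY (b N) \<and>
    (\<forall>i\<in>I. \<forall>m\<in>carrier M. b N (\<iota> i m) = (if i \<in> ?F N then f i m else \<zero>\<^bsub>Y\<^esub>))" ..
  then have b: "\<And>N. N \<in> Y.nb \<Longrightarrow> continuous_hom L P TP Y TY (b N)"
    "\<And>N i m. N \<in> Y.nb \<Longrightarrow> i \<in> I \<Longrightarrow> m \<in> carrier M \<Longrightarrow> b N (\<iota> i m) = (if i \<in> ?F N then f i m else \<zero>\<^bsub>Y\<^esub>)" by simp_all
  have fc: "f i m \<in> carrier Y" if "i \<in> I" "m \<in> carrier M" for i m using continuous_hom_closed[OF assms(2)] that by blast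
  have close: "f i m \<ominus>\<^bsub>Y\<^esub> b N (\<iota> i m) \<in> N" if "N \<in> Y.nb" "i \<in> I" "m \<in> carrier M" for N i m
    using b(2)[OF that] that Y.nb_zero[OF that(1)] fc[OF that(2,3)] by auto
  have bP: "b N x \<in> carrier Y" if "N \<in> Y.nb" "x \<in> carrier P" for N x by (rule continuous_hom_closed[OF b(1)[OF that(1)] that(2)])
  have compat: "b N x \<ominus>\<^bsub>Y\<^esub> b N' x \<in> N'" if N: "N \<in> Y.nb" "N' \<in> Y.nb" "N \<subseteq> N'" and x: "x \<in> carrier P" for N N' x
  proof -
    have "x \<in> {x \<in> carrier P. b N x \<ominus>\<^bsub>Y\<^esub> b N' x \<in> N'}"
    proof (rule inj_dense[OF P.nb_vimage[OF Y.tmod_axioms P.continuous_hom_minus[OF Y.tmod_axioms b(1)[OF N(1)] b(1)[OF N(2)]] N(2)] _ x])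
      fix i m assume i: "i \<in> I" and m: "m \<in> carrier M"
      have p: "\<iota> i m \<in> carrier P" by (rule inj_closed[OF i m])
      have "f i m \<ominus>\<^bsub>Y\<^esub> b N (\<iota> i m) \<in> N'" using close[OF N(1) i m] N(3) by blast
      then have "b N (\<iota> i m) \<ominus>\<^bsub>Y\<^esub> f i m \<in> N'"
        by (rule Y.M.diff_sym[OF Y.nb_asub[OF N(2)] _ fc[OF i m] bP[OF N(1) p]])
      from Y.M.diff_trans[OF Y.nb_asub[OF N(2)] this close[OF N(2) i m] bP[OF N(1) p] fc[OF i m] bP[OF N(2) p]]
      show "\<iota> i m \<in> {x \<in> carrier P. b N x \<ominus>\<^bsub>Y\<^esub> b N' x \<in> N'}" using p by simp
    qed
    then show ?thesis by simp
  qed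
  have "\<exists>y\<in>carrier Y. \<forall>N\<in>Y.nb. y \<ominus>\<^bsub>Y\<^esub> b N x \<in> N" if x: "x \<in> carrier P" for x
    by (rule Y.nb_complete) (use bP compat x in auto)
  then obtain g where g: "\<And>x. x \<in> carrier P \<Longrightarrow> g x \<in> carrier Y"
    "\<And>x N. x \<in> carrier P \<Longrightarrow> N \<in> Y.nb \<Longrightarrow> g x \<ominus>\<^bsub>Y\<^esub> b N x \<in> N" by metis
  have "continuous_hom L P TP Y TY g" by (rule P.continuous_hom_limit[OF Y.pcmod_axioms b(1) g])
  moreover have "g (\<iota> i m) = f i m" if i: "i \<in> I" and m: "m \<in> carrier M" for i m
  proof (rule Y.nb_eqI[OF g(1)[OF inj_closed[OF i m]] fc[OF i m]])
    fix N assume N: "N \<in> Y.nb"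
    have p: "\<iota> i m \<in> carrier P" by (rule inj_closed[OF i m])
    have "b N (\<iota> i m) \<ominus>\<^bsub>Y\<^esub> f i m \<in> N"
      by (rule Y.M.diff_sym[OF Y.nb_asub[OF N] close[OF N i m] fc[OF i m] bP[OF N p]])
    from Y.M.diff_trans[OF Y.nb_asub[OF N] g(2)[OF p N] this g(1)[OF p] bP[OF N p] fc[OF i m]]
    show "g (\<iota> i m) \<ominus>\<^bsub>Y\<^esub> f i m \<in> N" .
  qed
  ultimately show ?thesis by blast
qed

end

section \<open>Covers\<close>

sublocale hom_pc \<subseteq> H: lin_compact H E "hom_act M" \<W>
  by (rule H_lin_compact)

text \<open>The functor Hom(M, -) on morphisms, restricted to the carrier so that the result stays
  extensional.\<close>

definition push :: "('l, 'm) module \<Rightarrow> ('a \<Rightarrow> 'b) \<Rightarrow> ('m \<Rightarrow> 'a) \<Rightarrow> 'm \<Rightarrow> 'b" where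
  "push M g f = (\<lambda>m\<in>carrier M. g (f m))"

lemma push_lin_compact_hom:
  assumes A: "hom_pc R L M TL TM A TA" and B: "hom_pc R L M TL TM B TB" and g: "continuous_hom L A TA B TB g"
  shows "lin_compact_hom (hom_group L M TM A TA) (carrier (hom_group L M TM M TM)) (hom_act M)
      (hom_into M (carrier (hom_group L M TM A TA)) ` tmod.nb R L A TA)
      (hom_group L M TM B TB) (hom_act M) (hom_into M (carrier (hom_group L M TM B TB)) ` tmod.nb R L B TB) (push M g)"
proof -
  interpret A: hom_pc R L M TL TM A TA by (rule A)
  interpret B: hom_pc R L M TL TM B TB by (rule B)
  have gc: "push M g f \<in> carrier B.H" if "f \<in> carrier A.H" for f
    unfolding push_def using that g by (intro B.restrict_H continuous_hom_compose[of L M TM A TA f B TB g]) (auto simp: A.carrier_H)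
  show ?thesis
  proof
    show "push M g f \<in> carrier B.H" if "f \<in> carrier A.H" for f by (rule gc[OF that])
    show "push M g (f \<oplus>\<^bsub>A.H\<^esub> f') = push M g f \<oplus>\<^bsub>B.H\<^esub> push M g f'" if "f \<in> carrier A.H" "f' \<in> carrier A.H" for f f'
      using A.H_closed[OF that(1)] A.H_closed[OF that(2)]
      by (auto simp: push_def A.add_H B.add_H continuous_hom_add[OF g])
    show "push M g (hom_act M e f) = hom_act M e (push M g f)" if "e \<in> A.E" "f \<in> carrier A.H" for e f
      using A.E_maps[OF that(1)] by (auto simp: push_def hom_act_def)
    fix W' assume "W' \<in> B.\<W>"
    then obtain N where N: "N \<in> B.Y.nb" "W' = hom_into M (carrier B.H) N" by blast
    have "{x \<in> carrier A. g x \<in> N} \<in> A.Y.nb" by (rule A.Y.nb_vimage[OF B.Y.tmod_axioms g N(1)])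
    moreover have "push M g ` hom_into M (carrier A.H) {x \<in> carrier A. g x \<in> N} \<subseteq> W'"
      using gc by (auto simp: N(2) A.in_hom_into B.in_hom_into) (auto simp: push_def)
    ultimately show "\<exists>W\<in>A.\<W>. push M g ` W \<subseteq> W'" by blast
  qed
qed

lemma (in hom_pc) null_iff:
  assumes "\<And>i. i \<in> J \<Longrightarrow> f i \<in> carrier H"
  shows "H.null {\<zero>\<^bsub>H\<^esub>} J f \<longleftrightarrow> (\<forall>N\<in>Y.nb. finite {i \<in> J. \<not> (\<forall>m\<in>carrier M. f i m \<in> N)})"
proof -
  have eq: "{i \<in> J. f i \<notin> hom_into M (carrier H) N} = {i \<in> J. \<not> (\<forall>m\<in>carrier M. f i m \<in> N)}" for N
    using assms by (auto simp: in_hom_into)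
  show ?thesis
  proof
    assume "H.null {\<zero>\<^bsub>H\<^esub>} J f"
    then show "\<forall>N\<in>Y.nb. finite {i \<in> J. \<not> (\<forall>m\<in>carrier M. f i m \<in> N)}"
      using H.null_zeroD[OF _ H.W_opn] unfolding eq[symmetric] by blast
  next
    assume "\<forall>N\<in>Y.nb. finite {i \<in> J. \<not> (\<forall>m\<in>carrier M. f i m \<in> N)}"
    then show "H.null {\<zero>\<^bsub>H\<^esub>} J f"
      by (intro H.null_zeroI assms) (auto simp: eq)
  qed
qed

locale power_hom = power_pc R L M TL TM I
  for R :: "'r ring" and L :: "('r, 'l) module" and M :: "('l, 'm) module" and TL :: "'l topology" and TM :: "'m topology"
    and I :: "'i set" +
  assumes fg: "finitely_generated L M"

sublocale power_hom \<subseteq> HP: hom_pc R L M TL TM "power_module I M" "product_topology (\<lambda>_. TM) I"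
  by unfold_locales (rule fg)

context power_hom
begin

text \<open>The coordinate inclusion made extensional, so that it is an element of Hom(M,
  P).\<close>

definition rinj :: "'i \<Rightarrow> 'm \<Rightarrow> 'i \<Rightarrow> 'm" where
  "rinj i = restrict (\<iota> i) (carrier M)"

lemma rinj_H: "i \<in> I \<Longrightarrow> rinj i \<in> carrier HP.H"
  unfolding rinj_def by (rule HP.restrict_H[OF inj_hom])

lemma rinj_null: "HP.H.null {\<zero>\<^bsub>HP.H\<^esub>} I rinj"
  using hom_null[OF P.tmod_axioms P.continuous_hom_id]
  by (subst HP.null_iff) (auto simp: rinj_H, simp add: rinj_def)

text \<open>A truncation of \<open>a\<close> is a finite sum of coordinate inclusions precomposed
  with the endomorphisms m \<mapsto> a m i of M, hence lies in Z; truncations approximate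
  \<open>a\<close>.\<close>

lemma rinj_generate:
  assumes Z: "HP.H.clsd Z" and inj: "\<And>i. i \<in> I \<Longrightarrow> rinj i \<in> Z"
  shows "Z = carrier HP.H"
proof
  have Za: "asub HP.H Z" by (rule HP.H.clsd_asub[OF Z])
  show "Z \<subseteq> carrier HP.H" using HP.H.asub_subset[OF Za] by blast
  show "carrier HP.H \<subseteq> Z"
  proof
    fix a assume a: "a \<in> carrier HP.H"
    let ?t = "\<lambda>F. \<lambda>m\<in>carrier M. ptrunc M I F (a m)"
    have t: "?t F \<in> Z" if "finite F" "F \<subseteq> I" for F
      using that
    proof (induction F rule: finite_induct)
      case empty
      have "?t {} = \<zero>\<^bsub>HP.H\<^esub>" by (auto simp: HP.zero_H ptrunc_def zero_P)
      then show ?case using HP.H.asub_zero[OF Za] by simp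
    next
      case (insert i F)
      then have i: "i \<in> I" by simp
      let ?e = "\<lambda>m\<in>carrier M. a m i"
      have "continuous_hom L M TM M TM (\<lambda>m. a m i)"
        using a by (intro continuous_hom_compose[OF _ proj_hom[OF i]]) (simp add: HP.carrier_H)
      then have e: "?e \<in> HP.E" by (auto simp: HP.carrier_E intro: M.continuous_hom_cong)
      have eq: "?t (insert i F) = ?t F \<oplus>\<^bsub>HP.H\<^esub> hom_act M ?e (rinj i)"
        using insert(2) HP.E_maps[OF e] trunc_insert[OF HP.H_closed[OF a] i]
        by (auto simp: HP.add_H hom_act_def rinj_def)
      have "?t F \<in> Z" using insert by blast
      then show ?case unfolding eq
        by (rule HP.H.asub_add[OF Za _ HP.H.esub_act[OF HP.H.clsd_esub[OF Z] e inj[OF i]]])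
    qed
    show "a \<in> Z"
    proof (rule HP.H.clsdD[OF Z a])
      fix W assume "W \<in> HP.\<W>"
      then obtain N where N: "N \<in> P.nb" "W = hom_into M (carrier HP.H) N" by blast
      obtain F where F: "finite F" "F \<subseteq> I" "\<And>x. x \<in> carrier P \<Longrightarrow> x \<ominus>\<^bsub>P\<^esub> ptrunc M I F x \<in> N"
        by (rule approx[OF N(1)]) (rule that; assumption)
      have tH: "?t F \<in> carrier HP.H" by (rule HP.H.asub_subset[OF Za t[OF F(1,2)]])
      have "a \<ominus>\<^bsub>HP.H\<^esub> ?t F \<in> W"
        using a tH F(3) HP.H_closed[OF a] by (auto simp: N(2) HP.in_hom_into HP.diff_H)
      then show "a \<in> ssum HP.H Z W" using a t[OF F(1,2)] by (auto simp: ssum_def)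
    qed
  qed
qed

end

text \<open>\<open>X\<close> is also instantiated with a power, which yields endomorphisms, and
  \<open>I\<close> with index sets of other types, so the dictionary between null families and
  homomorphisms is set up once.\<close>

locale power_cover = power_hom R L M TL TM I + X: pcmod R L X TL TX
  for R :: "'r ring" and L :: "('r, 'l) module" and M :: "('l, 'm) module" and TL :: "'l topology" and TM :: "'m topology"
    and I :: "'i set" and X :: "('l, 'x) module" and TX :: "'x topology"

sublocale power_cover \<subseteq> HX: hom_pc R L M TL TM X TX
  by unfold_locales (rule fg)

context power_cover
begin

lemma null_hom_exists:
  assumes "HX.H.null {\<zero>\<^bsub>HX.H\<^esub>} I f"
  shows "\<exists>b. continuous_hom L P TP X TX b \<and> (\<forall>i\<in>I. \<forall>m\<in>carrier M. b (\<iota> i m) = f i m)"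
proof (rule hom_exists[OF X.pcmod_axioms])
  have f: "f i \<in> carrier HX.H" if "i \<in> I" for i by (rule HX.H.null_carrier[OF assms that])
  show "continuous_hom L M TM X TX (f i)" if "i \<in> I" for i using f[OF that] by (simp add: HX.carrier_H)
  show "finite {i \<in> I. \<not> (\<forall>m\<in>carrier M. f i m \<in> N)}" if "N \<in> X.nb" for N
    using assms that HX.null_iff[of I f] f by blast
qed

lemma hom_null_family:
  assumes "continuous_hom L P TP X TX b"
  shows "HX.H.null {\<zero>\<^bsub>HX.H\<^esub>} I (\<lambda>i. push M b (rinj i))"
proof -
  have "push M b (rinj i) \<in> carrier HX.H" if "i \<in> I" for i
    by (rule lin_compact_hom.q_closed[OF push_lin_compact_hom[OF HP.hom_pc_axioms HX.hom_pc_axioms assms] rinj_H[OF that]])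
  then show ?thesis
    using hom_null[OF X.tmod_axioms assms] by (subst HX.null_iff) (auto simp: push_def rinj_def)
qed

end

text \<open>
  \<open>\<rho>\<close> is assumed to be onto after applying \<open>Hom(M, -)\<close>, which makes it a precover.
\<close>

locale power_precover = power_cover R L M TL TM I X TX
  for R :: "'r ring" and L :: "('r, 'l) module" and M :: "('l, 'm) module" and TL :: "'l topology" and TM :: "'m topology"
    and I :: "'i set" and X :: "('l, 'x) module" and TX :: "'x topology" +
  fixes \<rho> :: "('i \<Rightarrow> 'm) \<Rightarrow> 'x"
  assumes rho: "continuous_hom L (power_module I M) (product_topology (\<lambda>_. TM) I) X TX \<rho>"
    and rho_surj: "push M \<rho> ` carrier (hom_group L M TM (power_module I M) (product_topology (\<lambda>_. TM) I))
      = carrier (hom_group L M TM X TX)"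

sublocale power_precover \<subseteq> q: lin_compact_hom HP.H HP.E "hom_act M" HP.\<W> HX.H "hom_act M" HX.\<W> "push M \<rho>"
  by (rule push_lin_compact_hom[OF HP.hom_pc_axioms HX.hom_pc_axioms rho])

section \<open>The minimal summand of a precover\<close>

context power_precover
begin

lemma endo_lin_compact_hom: "continuous_hom L P TP P TP g \<Longrightarrow>
    lin_compact_hom HP.H HP.E (hom_act M) HP.\<W> HP.H (hom_act M) HP.\<W> (push M g)"
  by (rule push_lin_compact_hom[OF HP.hom_pc_axioms HP.hom_pc_axioms])

lemma null_endo_exists:
  assumes "HP.H.null {\<zero>\<^bsub>HP.H\<^esub>} I f"
  shows "\<exists>b. continuous_hom L P TP P TP b \<and> (\<forall>i\<in>I. \<forall>m\<in>carrier M. b (\<iota> i m) = f i m)"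
proof -
  interpret P: power_cover R L M TL TM I P TP by unfold_locales
  show ?thesis by (rule P.null_hom_exists[OF assms])
qed

lemma push_rinj:
  assumes "continuous_hom L P TP P TP b" "\<And>m. m \<in> carrier M \<Longrightarrow> b (\<iota> i m) = f m" "f \<in> carrier HP.H" "i \<in> I"
  shows "push M b (rinj i) = f"
  using assms HP.H_eqI[OF lin_compact_hom.q_closed[OF endo_lin_compact_hom[OF assms(1)] rinj_H[OF assms(4)]] assms(3)]
  by (simp add: push_def rinj_def)

text \<open>\<open>U\<close> stays in the conclusion beside \<open>e\<close>: the last conjunct
  identifies it with the homomorphisms into the summand, and its minimality is what later inverts
  endomorphisms of that summand.\<close>

lemma ex_idempotent:
  "\<exists>e U. continuous_hom L P TP P TP e \<and> HP.H.clsd U \<and> push M \<rho> ` U = carrier HX.H \<and>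
     (\<forall>Z. HP.H.clsd Z \<and> Z \<subseteq> U \<and> push M \<rho> ` Z = carrier HX.H \<longrightarrow> Z = U) \<and>
     (\<forall>x\<in>carrier P. e (e x) = e x) \<and> (\<forall>x\<in>carrier P. \<rho> (e x) = \<rho> x) \<and>
     (\<forall>a\<in>carrier HP.H. a \<in> U \<longleftrightarrow> push M e a = a)"
proof -
  have imq: "q.im U {\<zero>\<^bsub>HX.H\<^esub>} = push M \<rho> ` U" if "HP.H.clsd U" for U
    using HP.H.asub_subset[OF HP.H.clsd_asub[OF that]] by (intro q.im_zero) blast
  have "q.im (carrier HP.H) {\<zero>\<^bsub>HX.H\<^esub>} = carrier HX.H" using imq[OF HP.H.clsd_carrier] rho_surj by simp
  note minU = q.ex_minimal[OF HP.H.clsd_carrier HX.H.clsd_singleton this]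
  obtain U where U: "HP.H.clsd U" "q.im U {\<zero>\<^bsub>HX.H\<^esub>} = carrier HX.H"
    "\<And>Z. HP.H.clsd Z \<Longrightarrow> Z \<subseteq> U \<Longrightarrow> q.im Z {\<zero>\<^bsub>HX.H\<^esub>} = carrier HX.H \<Longrightarrow> Z = U"
    by (rule minU) (rule that; assumption)
  have Ua: "asub HP.H U" by (rule HP.H.clsd_asub[OF U(1)])
  have Uc: "u \<in> U \<Longrightarrow> u \<in> carrier HP.H" for u by (rule HP.H.asub_subset[OF Ua])
  define K0 where "K0 = {f \<in> carrier HP.H. push M \<rho> f \<in> {\<zero>\<^bsub>HX.H\<^esub>}}"
  have K0: "HP.H.clsd K0" unfolding K0_def by (rule q.clsd_vimage[OF HP.H.clsd_carrier HX.H.clsd_singleton])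
  interpret d1: lin_compact_hom HP.H HP.E "hom_act M" HP.\<W> HP.H "hom_act M" HP.\<W> "\<lambda>x. x" by (rule HP.H.id_hom)
  have "ssum HP.H K0 U = carrier HP.H"
  proof
    show "ssum HP.H K0 U \<subseteq> carrier HP.H" by (auto simp: ssum_def)
    show "carrier HP.H \<subseteq> ssum HP.H K0 U"
    proof
      fix f assume f: "f \<in> carrier HP.H"
      then have "push M \<rho> f \<in> push M \<rho> ` U" using U(2) imq[OF U(1)] q.q_closed by blast
      then obtain u where u: "u \<in> U" "push M \<rho> f = push M \<rho> u" by blast
      have "f \<ominus>\<^bsub>HP.H\<^esub> u \<in> K0" using f u Uc q.q_closed by (simp add: K0_def q.q_diff)
      moreover have "f \<ominus>\<^bsub>HP.H\<^esub> (f \<ominus>\<^bsub>HP.H\<^esub> u) = u" using f Uc[OF u(1)] by (simp add: HP.H.agr)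
      ultimately show "f \<in> ssum HP.H K0 U" using f u(1) by (auto simp: ssum_def intro!: bexI[of _ "f \<ominus>\<^bsub>HP.H\<^esub> u"])
    qed
  qed
  then have "d1.im K0 U = carrier HP.H" by (simp add: HP.H.im_id)
  note minV = d1.ex_minimal[OF K0 U(1) this, unfolded HP.H.im_id]
  obtain V where V: "HP.H.clsd V" "V \<subseteq> K0" "ssum HP.H V U = carrier HP.H"
    "\<And>Z. HP.H.clsd Z \<Longrightarrow> Z \<subseteq> V \<Longrightarrow> ssum HP.H Z U = carrier HP.H \<Longrightarrow> Z = V"
    by (rule minV) (rule that; assumption)
  have Vc: "v \<in> V \<Longrightarrow> v \<in> carrier HP.H" for v by (rule HP.H.asub_subset[OF HP.H.clsd_asub[OF V(1)]])
  have "rinj i \<in> d1.im U V" if i: "i \<in> I" for i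
  proof -
    have "rinj i \<in> ssum HP.H V U" using V(3) rinj_H[OF i] by simp
    then obtain v where v: "v \<in> V" "rinj i \<ominus>\<^bsub>HP.H\<^esub> v \<in> U" by (auto simp: ssum_def)
    have "rinj i \<ominus>\<^bsub>HP.H\<^esub> (rinj i \<ominus>\<^bsub>HP.H\<^esub> v) = v" using rinj_H[OF i] Vc[OF v(1)] by (simp add: HP.H.agr)
    then show ?thesis using v rinj_H[OF i] by (auto simp: d1.im_def intro!: bexI[of _ "rinj i \<ominus>\<^bsub>HP.H\<^esub> v"])
  qed
  from d1.null_lift_im[OF U(1) V(1) rinj_null this] obtain u where
    u: "HP.H.null {\<zero>\<^bsub>HP.H\<^esub>} I u" "\<And>i. i \<in> I \<Longrightarrow> u i \<in> U" "\<And>i. i \<in> I \<Longrightarrow> rinj i \<ominus>\<^bsub>HP.H\<^esub> u i \<in> V" by blast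
  from null_endo_exists[OF u(1)] obtain e where
    e: "continuous_hom L P TP P TP e" "\<And>i m. i \<in> I \<Longrightarrow> m \<in> carrier M \<Longrightarrow> e (\<iota> i m) = u i m" by blast
  interpret d: lin_compact_hom HP.H HP.E "hom_act M" HP.\<W> HP.H "hom_act M" HP.\<W> "push M e" by (rule endo_lin_compact_hom[OF e(1)])
  have du: "push M e (rinj i) = u i" if "i \<in> I" for i
    by (rule push_rinj[OF e(1) e(2)[OF that] Uc[OF u(2)[OF that]] that])
  have "{a \<in> carrier HP.H. push M e a \<in> U} = carrier HP.H"
    by (rule rinj_generate[OF d.clsd_vimage[OF HP.H.clsd_carrier U(1)]]) (use rinj_H du u(2) in auto)
  then have dU: "push M e a \<in> U" if "a \<in> carrier HP.H" for a using that by blast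
  \<comment> \<open>To see that 1 - e maps Hom(M, P) into \<open>V\<close>, it is treated as an
    endomorphism in its own right: the elements mapped into \<open>V\<close> form a closed
    submodule, so the coordinate inclusions decide. The same was done for \<open>e\<close> and
    \<open>U\<close>.\<close>
  let ?c = "\<lambda>x. x \<ominus>\<^bsub>P\<^esub> e x"
  have c: "continuous_hom L P TP P TP ?c"
    by (rule P.continuous_hom_minus[OF P.tmod_axioms P.continuous_hom_id e(1)])
  interpret c: lin_compact_hom HP.H HP.E "hom_act M" HP.\<W> HP.H "hom_act M" HP.\<W> "push M ?c" by (rule endo_lin_compact_hom[OF c])
  have pc: "push M ?c a = a \<ominus>\<^bsub>HP.H\<^esub> push M e a" if a: "a \<in> carrier HP.H" for a
    by (rule HP.H_eqI[OF c.q_closed[OF a]]) (use a d.q_closed[OF a] in \<open>auto simp: HP.diff_H push_def\<close>)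
  have cV: "{a \<in> carrier HP.H. push M ?c a \<in> V} = carrier HP.H"
    by (rule rinj_generate[OF c.clsd_vimage[OF HP.H.clsd_carrier V(1)]]) (use rinj_H pc du u(3) in auto)
  have dV: "a \<ominus>\<^bsub>HP.H\<^esub> push M e a \<in> V" if "a \<in> carrier HP.H" for a
  proof -
    have "push M ?c a \<in> V" using that cV by blast
    then show ?thesis unfolding pc[OF that] .
  qed
  have Vq: "push M \<rho> v = \<zero>\<^bsub>HX.H\<^esub>" if "v \<in> V" for v using that V(2) by (auto simp: K0_def)
  have idem1: "push M e (push M e a) = push M e a" if "a \<in> carrier HP.H" for a
    by (rule q.idempotent(1)[where U=U and V=V and d="push M e" and x=a]) (rule U(1), erule (2) U(3), rule V(1), erule (2) V(4),
      rule U(2), erule Vq, rule d.lin_compact_hom_axioms, erule dU, erule dV, rule that)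
  have idem2: "push M e ` U = U"
    by (rule q.idempotent(2)[where U=U and V=V and d="push M e"]) (rule U(1), erule (2) U(3), rule V(1), erule (2) V(4),
      rule U(2), erule Vq, rule d.lin_compact_hom_axioms, erule dU, erule dV)
  have ee: "e (e x) = e x" if x: "x \<in> carrier P" for x
  proof (rule hom_ext[OF P.pcmod_axioms continuous_hom_compose[OF e(1) e(1)] e(1) _ x])
    fix i m assume i: "i \<in> I" and m: "m \<in> carrier M"
    have "push M e (push M e (rinj i)) m = push M e (rinj i) m" using idem1[OF rinj_H[OF i]] by simp
    then show "e (e (\<iota> i m)) = e (\<iota> i m)" using m by (simp add: push_def rinj_def)
  qed
  have re: "\<rho> (e x) = \<rho> x" if x: "x \<in> carrier P" for x
  proof (rule hom_ext[OF X.pcmod_axioms continuous_hom_compose[OF e(1) rho] rho _ x])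
    fix i m assume i: "i \<in> I" and m: "m \<in> carrier M"
    have uc: "u i \<in> carrier HP.H" by (rule Uc[OF u(2)[OF i]])
    have "push M \<rho> (rinj i) \<ominus>\<^bsub>HX.H\<^esub> push M \<rho> (u i) = \<zero>\<^bsub>HX.H\<^esub>"
      using Vq[OF u(3)[OF i]] by (simp add: q.q_diff[OF rinj_H[OF i] uc])
    then have "(push M \<rho> (rinj i) \<ominus>\<^bsub>HX.H\<^esub> push M \<rho> (u i)) m = \<zero>\<^bsub>HX.H\<^esub> m" by simp
    then have 1: "\<rho> (\<iota> i m) \<ominus>\<^bsub>X\<^esub> \<rho> (u i m) = \<zero>\<^bsub>X\<^esub>"
      using m HX.diff_H[OF q.q_closed[OF rinj_H[OF i]] q.q_closed[OF uc] m] by (simp add: push_def rinj_def HX.zero_H)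
    have rc: "\<rho> (\<iota> i m) \<in> carrier X" "\<rho> (u i m) \<in> carrier X"
      using continuous_hom_closed[OF rho] inj_closed[OF i m] HP.H_closed[OF uc m] by auto
    have "\<rho> (u i m) = \<rho> (\<iota> i m)"
    proof (rule X.nb_eqI[OF rc(2,1)])
      fix N assume N: "N \<in> X.nb"
      have "\<rho> (\<iota> i m) \<ominus>\<^bsub>X\<^esub> \<rho> (u i m) \<in> N" using 1 X.nb_zero[OF N] by simp
      then show "\<rho> (u i m) \<ominus>\<^bsub>X\<^esub> \<rho> (\<iota> i m) \<in> N" by (rule X.M.diff_sym[OF X.nb_asub[OF N] _ rc])
    qed
    then show "\<rho> (e (\<iota> i m)) = \<rho> (\<iota> i m)" using e(2)[OF i m] by simp
  qed
  have Ue: "a \<in> U \<longleftrightarrow> push M e a = a" if a: "a \<in> carrier HP.H" for a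
  proof
    assume "a \<in> U"
    then obtain b where "b \<in> U" "a = push M e b" using idem2 by blast
    then show "push M e a = a" using idem1[OF Uc] by simp
  next
    assume "push M e a = a"
    then show "a \<in> U" using dU[OF a] by simp
  qed
  have Umin: "Z = U" if "HP.H.clsd Z" "Z \<subseteq> U" "push M \<rho> ` Z = carrier HX.H" for Z
    using U(3)[OF that(1,2)] that(3) imq[OF that(1)] by simp
  have Usurj: "push M \<rho> ` U = carrier HX.H" using U(2) imq[OF U(1)] by simp
  show ?thesis
    by (intro exI[of _ e] exI[of _ U] conjI allI impI ballI e(1) U(1) Usurj ee re Ue)
      (use Umin in blast)
qed

text \<open>An endomorphism of the summand is represented by g on P with g = e g = g e, and its
  inverse by h with g h = h g = e, so the argument stays within the one module P.\<close>

lemma ex_minimal_summand: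
  "\<exists>e. continuous_hom L P TP P TP e \<and> (\<forall>x\<in>carrier P. e (e x) = e x) \<and> (\<forall>x\<in>carrier P. \<rho> (e x) = \<rho> x) \<and>
    (\<forall>g. continuous_hom L P TP P TP g \<and> (\<forall>x\<in>carrier P. e (g x) = g x) \<and> (\<forall>x\<in>carrier P. g (e x) = g x) \<and>
        (\<forall>x\<in>carrier P. \<rho> (g x) = \<rho> x) \<longrightarrow>
      (\<exists>h. continuous_hom L P TP P TP h \<and> (\<forall>x\<in>carrier P. e (h x) = h x) \<and>
        (\<forall>x\<in>carrier P. g (h x) = e x) \<and> (\<forall>x\<in>carrier P. h (g x) = e x)))"
proof -
  from ex_idempotent obtain e U where e: "continuous_hom L P TP P TP e" and U: "HP.H.clsd U"
    and Uim: "push M \<rho> ` U = carrier HX.H"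
    and Umin0: "\<forall>Z. HP.H.clsd Z \<and> Z \<subseteq> U \<and> push M \<rho> ` Z = carrier HX.H \<longrightarrow> Z = U"
    and ee: "\<forall>x\<in>carrier P. e (e x) = e x" and re: "\<forall>x\<in>carrier P. \<rho> (e x) = \<rho> x"
    and Ue0: "\<forall>a\<in>carrier HP.H. a \<in> U \<longleftrightarrow> push M e a = a" by (elim exE conjE)
  have Umin: "Z = U" if "HP.H.clsd Z" "Z \<subseteq> U" "push M \<rho> ` Z = carrier HX.H" for Z
    using Umin0 that by simp
  have Ue: "a \<in> U \<longleftrightarrow> push M e a = a" if "a \<in> carrier HP.H" for a using Ue0 that by simp
  have Uc: "u \<in> U \<Longrightarrow> u \<in> carrier HP.H" for u by (rule HP.H.asub_subset[OF HP.H.clsd_asub[OF U]])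
  have Uv: "e (a m) = a m" if "a \<in> U" "m \<in> carrier M" for a m
  proof -
    have "push M e a = a" using Ue[OF Uc[OF that(1)]] that(1) by blast
    then have "push M e a m = a m" by (rule fun_cong)
    then show ?thesis using that(2) by (simp add: push_def)
  qed
  have surj: "push M k ` U = U"
    if k: "continuous_hom L P TP P TP k" and ek: "\<And>x. x \<in> carrier P \<Longrightarrow> e (k x) = k x"
      and rk: "\<And>x. x \<in> carrier P \<Longrightarrow> \<rho> (k x) = \<rho> x" for k
  proof (rule Umin)
    interpret k: lin_compact_hom HP.H HP.E "hom_act M" HP.\<W> HP.H "hom_act M" HP.\<W> "push M k" by (rule endo_lin_compact_hom[OF k])
    have "U \<subseteq> carrier HP.H" using Uc by blast
    then show "HP.H.clsd (push M k ` U)" using k.clsd_im[OF U HP.H.clsd_singleton] k.im_zero by simp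
    have kH: "push M k a \<in> carrier HP.H" if "a \<in> U" for a by (rule k.q_closed[OF Uc[OF that]])
    show "push M k ` U \<subseteq> U"
    proof
      fix b assume "b \<in> push M k ` U"
      then obtain a where a: "a \<in> U" "b = push M k a" by blast
      have "push M e b = b" using ek HP.H_closed[OF Uc[OF a(1)]] unfolding a(2) by (auto simp: push_def)
      then show "b \<in> U" using Ue[OF kH[OF a(1)]] a(2) by simp
    qed
    have "push M \<rho> (push M k a) = push M \<rho> a" if "a \<in> U" for a
      using rk HP.H_closed[OF Uc[OF that]] by (auto simp: push_def)
    then have "push M \<rho> ` push M k ` U = push M \<rho> ` U" by (simp add: image_image)
    then show "push M \<rho> ` push M k ` U = carrier HX.H" using Uim by simp
  qed
  have "\<exists>h. continuous_hom L P TP P TP h \<and> (\<forall>x\<in>carrier P. e (h x) = h x) \<and>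
        (\<forall>x\<in>carrier P. g (h x) = e x) \<and> (\<forall>x\<in>carrier P. h (g x) = e x)"
    if g: "continuous_hom L P TP P TP g" and eg: "\<forall>x\<in>carrier P. e (g x) = g x" and ge: "\<forall>x\<in>carrier P. g (e x) = g x"
      and rg: "\<forall>x\<in>carrier P. \<rho> (g x) = \<rho> x" for g
  proof -
    interpret g: lin_compact_hom HP.H HP.E "hom_act M" HP.\<W> HP.H "hom_act M" HP.\<W> "push M g" by (rule endo_lin_compact_hom[OF g])
    interpret PP: power_cover R L M TL TM I P TP by unfold_locales
    define u where "u i = push M e (rinj i)" for i
    have uv: "u i m = e (\<iota> i m)" if "m \<in> carrier M" for i m using that by (simp add: u_def push_def rinj_def)
    have un: "HP.H.null {\<zero>\<^bsub>HP.H\<^esub>} I u" using PP.hom_null_family[OF e] by (simp add: u_def[abs_def])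
    have uU: "u i \<in> U" if i: "i \<in> I" for i
    proof -
      have "u i \<in> carrier HP.H" by (rule HP.H.null_carrier[OF un i])
      moreover have "push M e (u i) = u i" using ee inj_closed[OF i] by (auto simp: u_def push_def rinj_def)
      ultimately show ?thesis using Ue by blast
    qed
    have gU: "push M g ` U = U" using surj[OF g] eg rg by blast
    have img: "g.im U {\<zero>\<^bsub>HP.H\<^esub>} = U" using g.im_zero[of U] Uc gU by blast
    from g.null_lift_im[OF U HP.H.clsd_singleton un] uU img obtain w where
      w: "HP.H.null {\<zero>\<^bsub>HP.H\<^esub>} I w" "\<And>i. i \<in> I \<Longrightarrow> w i \<in> U" "\<And>i. i \<in> I \<Longrightarrow> u i \<ominus>\<^bsub>HP.H\<^esub> push M g (w i) \<in> {\<zero>\<^bsub>HP.H\<^esub>}" by blast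
    have gw: "g (w i m) = u i m" if i: "i \<in> I" and m: "m \<in> carrier M" for i m
    proof -
      have c: "u i \<in> carrier HP.H" "push M g (w i) \<in> carrier HP.H" using uU w(2) i Uc g.q_closed by auto
      have "u i = (u i \<ominus>\<^bsub>HP.H\<^esub> push M g (w i)) \<oplus>\<^bsub>HP.H\<^esub> push M g (w i)" using c by (simp add: HP.H.agr)
      then have "u i = push M g (w i)" using w(3)[OF i] c by simp
      then have "u i m = push M g (w i) m" by (rule fun_cong)
      then show ?thesis using m by (simp add: push_def)
    qed
    from null_endo_exists[OF w(1)] obtain h where
      h: "continuous_hom L P TP P TP h" "\<And>i m. i \<in> I \<Longrightarrow> m \<in> carrier M \<Longrightarrow> h (\<iota> i m) = w i m" by blast
    have eh: "e (h x) = h x" if "x \<in> carrier P" for x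
      by (rule hom_ext[OF P.pcmod_axioms continuous_hom_compose[OF h(1) e] h(1) _ that])
        (use h(2) Uv w(2) in auto)
    have gh: "g (h x) = e x" if "x \<in> carrier P" for x
      by (rule hom_ext[OF P.pcmod_axioms continuous_hom_compose[OF h(1) g] e _ that])
        (use h(2) gw uv in auto)
    have rh: "\<rho> (h x) = \<rho> x" if x: "x \<in> carrier P" for x
    proof -
      have "\<rho> (h x) = \<rho> (g (h x))" using rg continuous_hom_closed[OF h(1) x] by simp
      then show ?thesis using gh[OF x] re x by simp
    qed
    \<comment> \<open>\<open>h\<close> fulfils the same conditions as \<open>g\<close> and is
      therefore onto \<open>U\<close> as well; this turns the right inverse into a two-sided
      one.\<close>
    have hU: "push M h ` U = U" by (rule surj[OF h(1) eh rh])
    have hg: "h (g x) = e x" if "x \<in> carrier P" for x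
    proof (rule hom_ext[OF P.pcmod_axioms continuous_hom_compose[OF g h(1)] e _ that])
      fix i m assume i: "i \<in> I" and m: "m \<in> carrier M"
      from uU[OF i] hU obtain v where v: "v \<in> U" "u i = push M h v" by blast
      have vm: "v m \<in> carrier P" by (rule HP.H_closed[OF Uc[OF v(1)] m])
      have um: "u i m = h (v m)" using v(2) m by (simp add: push_def)
      have "g (u i m) = v m" using gh[OF vm] Uv[OF v(1) m] um by simp
      then have "h (g (e (\<iota> i m))) = e (\<iota> i m)" using um uv[OF m] by simp
      then show "h (g (\<iota> i m)) = e (\<iota> i m)" using ge inj_closed[OF i m] by simp
    qed
    show ?thesis using h(1) eh gh hg by blast
  qed
  then show ?thesis using e ee re by blast
qed

end

section \<open>Membership in Add(M), and lifting in arbitrary types\<close>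

lemma (in power_pc) in_Add_summand:
  assumes e: "continuous_hom L P TP P TP e" and ee: "\<And>x. x \<in> carrier P \<Longrightarrow> e (e x) = e x"
  defines "S \<equiv> {x \<in> carrier P. e x = x}"
  shows "submodule S L P"
    and "in_Add TYPE('i) R L TL M TM (P\<lparr>carrier := S\<rparr>) (subtopology TP S)"
proof -
  let ?c = "\<lambda>x. x \<ominus>\<^bsub>P\<^esub> e x"
  have ec: "e x \<in> carrier P" if "x \<in> carrier P" for x by (rule continuous_hom_closed[OF e that])
  have c: "continuous_hom L P TP P TP ?c"
    by (rule P.continuous_hom_minus[OF P.tmod_axioms P.continuous_hom_id e])
  have "x \<ominus>\<^bsub>P\<^esub> e x = \<zero>\<^bsub>P\<^esub> \<longleftrightarrow> e x = x" if "x \<in> carrier P" for x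
  proof
    assume "x \<ominus>\<^bsub>P\<^esub> e x = \<zero>\<^bsub>P\<^esub>"
    moreover have "x = (x \<ominus>\<^bsub>P\<^esub> e x) \<oplus>\<^bsub>P\<^esub> e x" using that ec by (simp add: P.M.agr)
    ultimately show "e x = x" using ec[OF that] by simp
  qed (use that in simp)
  then have S_eq: "{x \<in> carrier P. x \<ominus>\<^bsub>P\<^esub> e x = \<zero>\<^bsub>P\<^esub>} = S" by (auto simp: S_def)
  define C where "C = {x \<in> carrier P. e x = \<zero>\<^bsub>P\<^esub>}"
  note kS = P.kernel_pcmod[OF c, unfolded S_eq]
  note kC = P.kernel_pcmod[OF e, folded C_def]
  show "submodule S L P" by (rule kS(1))
  have Sc: "S \<subseteq> carrier P" "C \<subseteq> carrier P" by (auto simp: S_def C_def)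
  let ?SS = "P\<lparr>carrier := S\<rparr>" and ?CC = "P\<lparr>carrier := C\<rparr>"
  let ?TS = "subtopology TP S" and ?TC = "subtopology TP C"
  have \<phi>: "continuous_hom L (module_sum ?SS ?CC) (prod_topology ?TS ?TC) P TP (\<lambda>(s, c). s \<oplus>\<^bsub>P\<^esub> c)"
    unfolding continuous_hom_def
  proof (intro conjI)
    show "continuous_map (prod_topology ?TS ?TC) TP (\<lambda>(s, c). s \<oplus>\<^bsub>P\<^esub> c)"
      unfolding subtopology_Times[symmetric] by (rule continuous_map_from_subtopology[OF P.cont_add])
    show "(\<lambda>(s, c). s \<oplus>\<^bsub>P\<^esub> c) \<in> carrier (module_sum ?SS ?CC) \<rightarrow> carrier P"
      using Sc by (auto simp: module_sum_def)
    show "\<forall>x\<in>carrier (module_sum ?SS ?CC). \<forall>y\<in>carrier (module_sum ?SS ?CC).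
        (case x \<oplus>\<^bsub>module_sum ?SS ?CC\<^esub> y of (s, c) \<Rightarrow> s \<oplus>\<^bsub>P\<^esub> c) = (case x of (s, c) \<Rightarrow> s \<oplus>\<^bsub>P\<^esub> c) \<oplus>\<^bsub>P\<^esub> (case y of (s, c) \<Rightarrow> s \<oplus>\<^bsub>P\<^esub> c)"
      using subsetD[OF Sc(1)] subsetD[OF Sc(2)] by (auto simp: module_sum_def P.M.a_ac)
    show "\<forall>a\<in>carrier L. \<forall>x\<in>carrier (module_sum ?SS ?CC).
        (case a \<odot>\<^bsub>module_sum ?SS ?CC\<^esub> x of (s, c) \<Rightarrow> s \<oplus>\<^bsub>P\<^esub> c) = a \<odot>\<^bsub>P\<^esub> (case x of (s, c) \<Rightarrow> s \<oplus>\<^bsub>P\<^esub> c)"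
      using subsetD[OF Sc(1)] subsetD[OF Sc(2)] by (auto simp: module_sum_def P.smult_r_distr)
  qed
  have eS: "e x \<in> S" and cC: "x \<ominus>\<^bsub>P\<^esub> e x \<in> C" if "x \<in> carrier P" for x
    using that ee ec by (auto simp: S_def C_def P.continuous_hom_diff[OF P.tmod_axioms e])
  have \<psi>: "continuous_hom L P TP (module_sum ?SS ?CC) (prod_topology ?TS ?TC) (\<lambda>x. (e x, x \<ominus>\<^bsub>P\<^esub> e x))"
    unfolding continuous_hom_def
  proof (intro conjI)
    show "continuous_map TP (prod_topology ?TS ?TC) (\<lambda>x. (e x, x \<ominus>\<^bsub>P\<^esub> e x))"
      by (intro continuous_map_pairedI)
        (use eS cC continuous_hom_cont[OF e] continuous_hom_cont[OF c] topspace_P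
          in \<open>auto simp: continuous_map_in_subtopology simp del: topspace_product_topology\<close>)
  qed (use eS cC continuous_hom_add[OF e] continuous_hom_smult[OF e] continuous_hom_add[OF c] continuous_hom_smult[OF c]
      in \<open>auto simp: module_sum_def\<close>)
  have "topological_iso L (module_sum ?SS ?CC) (prod_topology ?TS ?TC) P TP (\<lambda>(s, c). s \<oplus>\<^bsub>P\<^esub> c)"
    unfolding topological_iso_def
  proof (intro conjI exI[of _ "\<lambda>x. (e x, x \<ominus>\<^bsub>P\<^esub> e x)"] \<phi> \<psi> ballI)
    fix p assume "p \<in> carrier (module_sum ?SS ?CC)"
    then obtain s d where p: "p = (s, d)" "s \<in> S" "d \<in> C" by (auto simp: module_sum_def)
    have sd: "s \<in> carrier P" "d \<in> carrier P" using p Sc by auto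
    have "e (s \<oplus>\<^bsub>P\<^esub> d) = s" using p sd by (simp add: continuous_hom_add[OF e sd] S_def C_def)
    moreover have "(s \<oplus>\<^bsub>P\<^esub> d) \<ominus>\<^bsub>P\<^esub> s = d" using sd by (simp add: P.M.agr)
    ultimately show "(e (case p of (s, c) \<Rightarrow> s \<oplus>\<^bsub>P\<^esub> c), (case p of (s, c) \<Rightarrow> s \<oplus>\<^bsub>P\<^esub> c) \<ominus>\<^bsub>P\<^esub> e (case p of (s, c) \<Rightarrow> s \<oplus>\<^bsub>P\<^esub> c)) = p"
      by (simp add: p)
  next
    fix x assume x: "x \<in> carrier P"
    then show "(case (e x, x \<ominus>\<^bsub>P\<^esub> e x) of (s, c) \<Rightarrow> s \<oplus>\<^bsub>P\<^esub> c) = x" using ec[OF x] by (simp add: P.M.agr)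
  qed
  then show "in_Add TYPE('i) R L TL M TM ?SS ?TS"
    unfolding in_Add_def using pcmod_pseudocompact[OF kS(2)] pcmod_pseudocompact[OF kC(2)] by blast
qed

text \<open>The case e = 1, whose complement is zero.\<close>

lemma (in power_pc) in_Add_power: "in_Add TYPE('i) R L TL M TM P TP"
proof -
  have "in_Add TYPE('i) R L TL M TM (P\<lparr>carrier := {x \<in> carrier P. x = x}\<rparr>) (subtopology TP {x \<in> carrier P. x = x})"
    by (rule in_Add_summand(2)[OF P.continuous_hom_id]) simp
  moreover have "P\<lparr>carrier := {x \<in> carrier P. x = x}\<rparr> = P" by (simp add: power_module_def)
  moreover have "subtopology TP {x \<in> carrier P. x = x} = TP"
    using subtopology_topspace[of TP] by (simp only: topspace_P) simp
  ultimately show ?thesis by simp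
qed

text \<open>A summand is a retract: \<alpha> is composed with the projection from the power, lifted
  there and restricted again. Hence a precover has to be tested against powers only.\<close>

lemma in_Add_lift:
  fixes L :: "('r, 'l) module" and M :: "('l, 'm) module"
  assumes alg: "ralgebra R L" and topL: "topspace TL = carrier L" and S: "in_Add (ti :: 'i itself) R L TL M TM S TS"
    and \<alpha>: "continuous_hom L S TS X TX \<alpha>"
    and lift: "\<And>(J :: 'i set) \<beta>. continuous_hom L (power_module J M) (product_topology (\<lambda>_. TM) J) X TX \<beta> \<Longrightarrow>
      \<exists>\<gamma>. continuous_hom L (power_module J M) (product_topology (\<lambda>_. TM) J) Q TQ \<gamma> \<and>
        (\<forall>x\<in>carrier (power_module J M). \<rho> (\<gamma> x) = \<beta> x)"
  shows "\<exists>\<gamma>. continuous_hom L S TS Q TQ \<gamma> \<and> (\<forall>s\<in>carrier S. \<rho> (\<gamma> s) = \<alpha> s)"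
proof -
  from S obtain J :: "'i set" and C :: "('l, 'i \<Rightarrow> 'm) module" and TC \<phi> where pS: "pseudocompact_module R L TL S TS"
    and pC: "pseudocompact_module R L TL C TC"
    and iso: "topological_iso L (module_sum S C) (prod_topology TS TC) (power_module J M) (product_topology (\<lambda>_. TM) J) \<phi>"
    unfolding in_Add_def by blast
  interpret S: pcmod R L S TL TS by (rule pseudocompact_pcmod[OF alg topL pS])
  interpret C: pcmod R L C TL TC by (rule pseudocompact_pcmod[OF alg topL pC])
  let ?P = "power_module J M" and ?TP = "product_topology (\<lambda>_. TM) J"
  let ?SC = "module_sum S C" and ?TSC = "prod_topology TS TC"
  from iso obtain \<psi> where \<phi>: "continuous_hom L ?SC ?TSC ?P ?TP \<phi>" and \<psi>: "continuous_hom L ?P ?TP ?SC ?TSC \<psi>"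
    and \<psi>\<phi>: "\<And>x. x \<in> carrier ?SC \<Longrightarrow> \<psi> (\<phi> x) = x" unfolding topological_iso_def by blast
  have fst: "continuous_hom L ?SC ?TSC S TS fst"
    by (auto simp: continuous_hom_def module_sum_def continuous_map_fst)
  have "continuous_hom L S TS ?SC ?TSC (\<lambda>s. (s, \<zero>\<^bsub>C\<^esub>))"
    unfolding continuous_hom_def
    by (auto simp: module_sum_def C.smult_zero C.topspaceM intro!: continuous_map_pairedI)
  note inj = continuous_hom_compose[OF this \<phi>]
  from lift[OF continuous_hom_compose[OF continuous_hom_compose[OF \<psi> fst] \<alpha>]] obtain \<gamma> where
    \<gamma>: "continuous_hom L ?P ?TP Q TQ \<gamma>" "\<And>x. x \<in> carrier ?P \<Longrightarrow> \<rho> (\<gamma> x) = \<alpha> (fst (\<psi> x))" by blast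
  have "\<rho> (\<gamma> (\<phi> (s, \<zero>\<^bsub>C\<^esub>))) = \<alpha> s" if s: "s \<in> carrier S" for s
  proof -
    have sc: "(s, \<zero>\<^bsub>C\<^esub>) \<in> carrier ?SC" using s by (simp add: module_sum_def)
    show ?thesis using \<gamma>(2)[OF continuous_hom_closed[OF \<phi> sc]] \<psi>\<phi>[OF sc] by simp
  qed
  then show ?thesis using continuous_hom_compose[OF inj \<gamma>(1)] by blast
qed

text \<open>The components of \<beta> form a null family in Hom(M, X). \<open>null_lift_im\<close>
  lifts it to a null family in Hom(M, P), which assembles to \<gamma>. The index type of J is
  arbitrary.\<close>

lemma (in power_precover) power_lift:
  fixes J :: "'j set"
  assumes \<beta>: "continuous_hom L (power_module J M) (product_topology (\<lambda>_. TM) J) X TX \<beta>"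
  shows "\<exists>\<gamma>. continuous_hom L (power_module J M) (product_topology (\<lambda>_. TM) J) P TP \<gamma> \<and>
    (\<forall>x\<in>carrier (power_module J M). \<rho> (\<gamma> x) = \<beta> x)"
proof -
  interpret J: power_cover R L M TL TM J X TX by unfold_locales
  interpret JP: power_cover R L M TL TM J P TP by unfold_locales
  have "q.im (carrier HP.H) {\<zero>\<^bsub>HX.H\<^esub>} = carrier HX.H" using q.im_zero[OF order_refl] rho_surj by simp
  then have im: "push M \<beta> (J.rinj j) \<in> q.im (carrier HP.H) {\<zero>\<^bsub>HX.H\<^esub>}" if "j \<in> J" for j
    using HX.H.null_carrier[OF J.hom_null_family[OF \<beta>] that] by simp
  from q.null_lift_im[OF HP.H.clsd_carrier HX.H.clsd_singleton J.hom_null_family[OF \<beta>] im] obtain u where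
    u: "HP.H.null {\<zero>\<^bsub>HP.H\<^esub>} J u" "\<And>j. j \<in> J \<Longrightarrow> push M \<beta> (J.rinj j) \<ominus>\<^bsub>HX.H\<^esub> push M \<rho> (u j) \<in> {\<zero>\<^bsub>HX.H\<^esub>}" by blast
  from JP.null_hom_exists[OF u(1)] obtain \<gamma> where
    \<gamma>: "continuous_hom L J.P J.TP P TP \<gamma>" "\<And>j m. j \<in> J \<Longrightarrow> m \<in> carrier M \<Longrightarrow> \<gamma> (pinj M J j m) = u j m" by blast
  have "\<rho> (\<gamma> x) = \<beta> x" if x: "x \<in> carrier J.P" for x
  proof (rule J.hom_ext[OF X.pcmod_axioms continuous_hom_compose[OF \<gamma>(1) rho] \<beta> _ x])
    fix j m assume j: "j \<in> J" and m: "m \<in> carrier M"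
    have c: "push M \<beta> (J.rinj j) \<in> carrier HX.H" "push M \<rho> (u j) \<in> carrier HX.H"
      using HX.H.null_carrier[OF J.hom_null_family[OF \<beta>] j] q.q_closed[OF HP.H.null_carrier[OF u(1) j]] by auto
    have "push M \<beta> (J.rinj j) = (push M \<beta> (J.rinj j) \<ominus>\<^bsub>HX.H\<^esub> push M \<rho> (u j)) \<oplus>\<^bsub>HX.H\<^esub> push M \<rho> (u j)"
      using c by (simp add: HX.H.agr)
    also have "\<dots> = push M \<rho> (u j)" using u(2)[OF j] c by simp
    finally have "push M \<beta> (J.rinj j) m = push M \<rho> (u j) m" by (rule fun_cong)
    then show "\<rho> (\<gamma> (pinj M J j m)) = \<beta> (pinj M J j m)"
      using m \<gamma>(2)[OF j m] by (simp add: push_def J.rinj_def)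
  qed
  then show ?thesis using \<gamma>(1) by blast
qed

text \<open>
  Only finitely many members of a null family agree with a given nonzero one, so the nonzero members
  can be relabelled by \<open>nat \<times> Hom(M, X)\<close>.
\<close>

lemma (in power_cover) reindex:
  assumes \<beta>: "continuous_hom L P TP X TX \<beta>"
  obtains K :: "('m, 'x) cover_index set" and \<theta> \<beta>' where
    "continuous_hom L P TP (power_module K M) (product_topology (\<lambda>_. TM) K) \<theta>"
    "continuous_hom L (power_module K M) (product_topology (\<lambda>_. TM) K) X TX \<beta>'"
    "\<And>x. x \<in> carrier P \<Longrightarrow> \<beta>' (\<theta> x) = \<beta> x"
proof -
  define f where "f i = push M \<beta> (rinj i)" for i
  have fn: "HX.H.null {\<zero>\<^bsub>HX.H\<^esub>} I f" using hom_null_family[OF \<beta>] by (simp add: f_def[abs_def])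
  have fH: "f i \<in> carrier HX.H" if "i \<in> I" for i by (rule HX.H.null_carrier[OF fn that])
  have fv: "f i m = \<beta> (\<iota> i m)" if "m \<in> carrier M" for i m using that by (simp add: f_def push_def rinj_def)
  define I0 where "I0 = {i \<in> I. f i \<noteq> \<zero>\<^bsub>HX.H\<^esub>}"
  have fib: "finite {k \<in> I0. f k = f i}" if i: "i \<in> I0" for i
  proof -
    obtain W where W: "W \<in> HX.\<W>" "f i \<notin> W" using HX.H.W_sep[of "f i"] i fH by (auto simp: I0_def)
    have "{k \<in> I0. f k = f i} \<subseteq> {k \<in> I. f k \<notin> W}" using W(2) by (auto simp: I0_def)
    then show ?thesis using HX.H.null_zeroD[OF fn HX.H.W_opn[OF W(1)]] finite_subset by blast
  qed
  \<comment> \<open>The first component numbers the finite fibre of \<open>f\<close> through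
    \<open>i\<close>, the second records the homomorphism. The singleton turns the pair into an
    element of \<open>cover_index\<close>.\<close>
  define \<kappa> where "\<kappa> i = {(to_nat_on {k \<in> I0. f k = f i} i, f i)}" for i
  have \<kappa>: "inj_on \<kappa> I0"
  proof (rule inj_onI)
    fix i j assume i: "i \<in> I0" and j: "j \<in> I0" and eq: "\<kappa> i = \<kappa> j"
    then have fij: "f i = f j" and "to_nat_on {k \<in> I0. f k = f i} i = to_nat_on {k \<in> I0. f k = f i} j" by (auto simp: \<kappa>_def)
    then show "i = j"
      using inj_on_to_nat_on[OF countable_finite[OF fib[OF i]]] i j by (auto dest: inj_onD)
  qed
  define K where "K = \<kappa> ` I0"
  define \<nu> where "\<nu> = the_inv_into I0 \<kappa>"
  have \<nu>: "\<nu> (\<kappa> i) = i" if "i \<in> I0" for i unfolding \<nu>_def by (rule the_inv_into_f_f[OF \<kappa> that])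
  have \<nu>K: "\<nu> k \<in> I0" "\<kappa> (\<nu> k) = k" if "k \<in> K" for k using that \<nu> by (auto simp: K_def)
  have \<nu>I: "\<nu> k \<in> I" if "k \<in> K" for k using \<nu>K(1)[OF that] by (simp add: I0_def)
  interpret K: power_cover R L M TL TM K X TX by unfold_locales
  have "HX.H.null {\<zero>\<^bsub>HX.H\<^esub>} K (\<lambda>k. f (\<nu> k))"
  proof (rule HX.H.null_zeroI)
    show "f (\<nu> k) \<in> carrier HX.H" if "k \<in> K" for k by (rule fH[OF \<nu>I[OF that]])
    fix W assume W: "W \<in> HX.\<W>"
    have "{k \<in> K. f (\<nu> k) \<notin> W} \<subseteq> \<kappa> ` {i \<in> I. f i \<notin> W}"
    proof
      fix k assume k: "k \<in> {k \<in> K. f (\<nu> k) \<notin> W}"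
      then have "\<nu> k \<in> {i \<in> I. f i \<notin> W}" "k = \<kappa> (\<nu> k)" using \<nu>I \<nu>K(2) by auto
      then show "k \<in> \<kappa> ` {i \<in> I. f i \<notin> W}" by (rule rev_image_eqI)
    qed
    then show "finite {k \<in> K. f (\<nu> k) \<notin> W}"
      using HX.H.null_zeroD[OF fn HX.H.W_opn[OF W]] finite_subset by blast
  qed
  from K.null_hom_exists[OF this] obtain \<beta>' where
    \<beta>': "continuous_hom L K.P K.TP X TX \<beta>'" "\<And>k m. k \<in> K \<Longrightarrow> m \<in> carrier M \<Longrightarrow> \<beta>' (pinj M K k m) = f (\<nu> k) m" by blast
  \<comment> \<open>Coordinates outside \<open>I0\<close> are dropped; \<beta> vanishes on the
    corresponding coordinate inclusions, so it still factors through \<theta>.\<close>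
  define \<theta> where "\<theta> x = (\<lambda>k\<in>K. x (\<nu> k))" for x :: "'i \<Rightarrow> 'm"
  have \<theta>: "continuous_hom L P TP K.P K.TP \<theta>"
    unfolding continuous_hom_def continuous_map_componentwise
  proof (intro conjI ballI)
    show "\<theta> \<in> carrier P \<rightarrow> carrier K.P" using \<nu>I by (auto simp: \<theta>_def carrier_P K.carrier_P)
    show "\<theta> (x \<oplus>\<^bsub>P\<^esub> y) = \<theta> x \<oplus>\<^bsub>K.P\<^esub> \<theta> y" for x y using \<nu>I by (auto simp: \<theta>_def add_P K.add_P)
    show "\<theta> (a \<odot>\<^bsub>P\<^esub> x) = a \<odot>\<^bsub>K.P\<^esub> \<theta> x" for a x using \<nu>I by (auto simp: \<theta>_def smult_P K.smult_P)
    show "\<theta> ` topspace TP \<subseteq> extensional K" by (auto simp: \<theta>_def)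
    show "continuous_map TP TM (\<lambda>x. \<theta> x k)" if "k \<in> K" for k
      using that continuous_map_product_projection[OF \<nu>I[OF that], of "\<lambda>_. TM"] by (simp add: \<theta>_def)
  qed
  have "\<beta>' (\<theta> x) = \<beta> x" if x: "x \<in> carrier P" for x
  proof (rule hom_ext[OF X.pcmod_axioms continuous_hom_compose[OF \<theta> \<beta>'(1)] \<beta> _ x])
    fix i m assume i: "i \<in> I" and m: "m \<in> carrier M"
    show "\<beta>' (\<theta> (\<iota> i m)) = \<beta> (\<iota> i m)"
    proof (cases "i \<in> I0")
      case True
      have "\<theta> (\<iota> i m) = pinj M K (\<kappa> i) m"
      proof
        fix k show "\<theta> (\<iota> i m) k = pinj M K (\<kappa> i) m k"
          using \<nu>I[of k] \<nu>[OF True] \<nu>K(2)[of k] by (auto simp: \<theta>_def pinj_def)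
      qed
      moreover have "\<kappa> i \<in> K" using True by (simp add: K_def)
      ultimately show ?thesis using \<beta>'(2)[of "\<kappa> i" m] m \<nu>[OF True] fv[OF m] by simp
    next
      case False
      have "\<theta> (\<iota> i m) = \<zero>\<^bsub>K.P\<^esub>"
      proof
        fix k show "\<theta> (\<iota> i m) k = \<zero>\<^bsub>K.P\<^esub> k"
          using \<nu>I[of k] \<nu>K(1)[of k] False by (auto simp: \<theta>_def pinj_def K.zero_P)
      qed
      moreover have "f i m = \<zero>\<^bsub>X\<^esub>" using False i m by (simp add: I0_def HX.zero_H)
      ultimately show ?thesis using K.P.continuous_hom_zero[OF X.tmod_axioms \<beta>'(1)] fv[OF m] by simp
    qed
  qed
  then show thesis using that \<theta> \<beta>'(1) by blast
qed

text \<open>The automorphism condition does not involve the test types. For the precover condition,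
  test modules reduce to powers of M, and by \<open>reindex\<close> a homomorphism from any power
  factors through a power indexed within \<open>cover_index\<close>, which is among the modules
  already tested.\<close>

lemma Add_cover_change_types:
  fixes M :: "('l, 'm) module" and X :: "('l, 'x) module"
  assumes alg: "ralgebra R L" and topL: "topspace TL = carrier L"
    and M: "pcmod R L M TL TM" and fg: "finitely_generated L M" and X: "pcmod R L X TL TX"
    and cover: "Add_cover TYPE(('m, 'x) cover_index) TYPE(('m, 'x) cover_elem) TYPE(('m, 'x) cover_index)
      R L TL M TM X TX Q TQ \<rho>"
  shows "Add_cover TYPE(('m, 'x) cover_index) TYPE('s) TYPE('i) R L TL M TM X TX Q TQ \<rho>"
proof -
  interpret M: pcmod R L M TL TM by (rule M)
  interpret X: pcmod R L X TL TX by (rule X)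
  have lift: "\<exists>\<gamma>. continuous_hom L (power_module J M) (product_topology (\<lambda>_. TM) J) Q TQ \<gamma> \<and>
        (\<forall>x\<in>carrier (power_module J M). \<rho> (\<gamma> x) = \<beta> x)"
    if \<beta>: "continuous_hom L (power_module J M) (product_topology (\<lambda>_. TM) J) X TX \<beta>" for J :: "'i set" and \<beta>
  proof -
    interpret J: power_cover R L M TL TM J X TX by unfold_locales (rule fg)
    obtain K :: "('m, 'x) cover_index set" and \<theta> \<beta>' where
      \<theta>: "continuous_hom L J.P J.TP (power_module K M) (product_topology (\<lambda>_. TM) K) \<theta>"
      and \<beta>': "continuous_hom L (power_module K M) (product_topology (\<lambda>_. TM) K) X TX \<beta>'"
      and eq: "\<And>x. x \<in> carrier J.P \<Longrightarrow> \<beta>' (\<theta> x) = \<beta> x" using J.reindex[OF \<beta>] by metis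
    interpret K: power_pc R L M TL TM K by unfold_locales
    have "\<exists>\<gamma>. continuous_hom L K.P K.TP Q TQ \<gamma> \<and> (\<forall>s\<in>carrier K.P. \<rho> (\<gamma> s) = \<beta>' s)"
      using cover K.in_Add_power \<beta>' unfolding Add_cover_def Add_precover_def by blast
    then obtain \<gamma> where \<gamma>: "continuous_hom L K.P K.TP Q TQ \<gamma>" "\<And>s. s \<in> carrier K.P \<Longrightarrow> \<rho> (\<gamma> s) = \<beta>' s" by blast
    have "\<rho> (\<gamma> (\<theta> x)) = \<beta> x" if "x \<in> carrier J.P" for x
      using \<gamma>(2)[OF continuous_hom_closed[OF \<theta> that]] eq[OF that] by simp
    then show ?thesis using continuous_hom_compose[OF \<theta> \<gamma>(1)] by blast
  qed
  have "\<exists>\<gamma>. continuous_hom L S TS Q TQ \<gamma> \<and> (\<forall>s\<in>carrier S. \<rho> (\<gamma> s) = \<alpha> s)"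
    if "in_Add TYPE('i) R L TL M TM S TS" "continuous_hom L S TS X TX \<alpha>" for S :: "('l, 's) module" and TS \<alpha>
    by (rule in_Add_lift[OF alg topL that lift])
  then show ?thesis using cover unfolding Add_cover_def Add_precover_def by blast
qed

text \<open>The cover is \<rho> restricted to the minimal summand. Lifts into P become lifts into
  the summand after applying e, as \<rho> e = \<rho>.\<close>

lemma (in power_precover) ex_Add_cover:
  "\<exists>(Q :: ('l, 'i \<Rightarrow> 'm) module) TQ. Add_cover TYPE('i) TYPE('s) TYPE('j) R L TL M TM X TX Q TQ \<rho>"
proof -
  from ex_minimal_summand obtain e where e: "continuous_hom L P TP P TP e"
    and ee: "\<forall>x\<in>carrier P. e (e x) = e x" and re: "\<forall>x\<in>carrier P. \<rho> (e x) = \<rho> x"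
    and inv: "\<forall>g. continuous_hom L P TP P TP g \<and> (\<forall>x\<in>carrier P. e (g x) = g x) \<and> (\<forall>x\<in>carrier P. g (e x) = g x) \<and>
        (\<forall>x\<in>carrier P. \<rho> (g x) = \<rho> x) \<longrightarrow>
      (\<exists>h. continuous_hom L P TP P TP h \<and> (\<forall>x\<in>carrier P. e (h x) = h x) \<and>
        (\<forall>x\<in>carrier P. g (h x) = e x) \<and> (\<forall>x\<in>carrier P. h (g x) = e x))" by (elim exE conjE)
  have ec: "e x \<in> carrier P" if "x \<in> carrier P" for x by (rule continuous_hom_closed[OF e that])
  define S where "S = {x \<in> carrier P. e x = x}"
  have S: "submodule S L P" and Q_Add: "in_Add TYPE('i) R L TL M TM (P\<lparr>carrier := S\<rparr>) (subtopology TP S)"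
    unfolding S_def by (rule in_Add_summand[OF e]; use ee in blast)+
  let ?Q = "P\<lparr>carrier := S\<rparr>" and ?TQ = "subtopology TP S"
  interpret Q: tmod R L ?Q TL ?TQ by (rule P.sub_tmod[OF S])
  have S_iff: "x \<in> S \<longleftrightarrow> x \<in> carrier P \<and> e x = x" for x by (simp add: S_def)
  have incl: "continuous_hom L ?Q ?TQ P TP (\<lambda>x. x)" by (rule P.sub_incl_hom[OF S])
  have eQ: "continuous_hom L P TP ?Q ?TQ e"
    by (rule P.continuous_hom_into_sub[OF S e topspace_P]) (use ee ec in \<open>auto simp: S_def\<close>)
  have rQ: "continuous_hom L ?Q ?TQ X TX \<rho>" by (rule continuous_hom_compose[OF incl rho])
  have lift: "\<exists>\<gamma>. continuous_hom L (power_module J M) (product_topology (\<lambda>_. TM) J) ?Q ?TQ \<gamma> \<and>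
        (\<forall>x\<in>carrier (power_module J M). \<rho> (\<gamma> x) = \<beta> x)"
    if \<beta>: "continuous_hom L (power_module J M) (product_topology (\<lambda>_. TM) J) X TX \<beta>" for J :: "'j set" and \<beta>
  proof -
    from power_lift[OF \<beta>] obtain \<gamma> where \<gamma>: "continuous_hom L (power_module J M) (product_topology (\<lambda>_. TM) J) P TP \<gamma>"
      "\<And>x. x \<in> carrier (power_module J M) \<Longrightarrow> \<rho> (\<gamma> x) = \<beta> x" by blast
    have "\<rho> (e (\<gamma> x)) = \<beta> x" if "x \<in> carrier (power_module J M)" for x
      using re continuous_hom_closed[OF \<gamma>(1) that] \<gamma>(2)[OF that] by simp
    then show ?thesis using continuous_hom_compose[OF \<gamma>(1) eQ] by blast
  qed
  have topL: "topspace TL = carrier L" by (rule M.topspaceL)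
  have "\<exists>\<gamma>. continuous_hom L T TT ?Q ?TQ \<gamma> \<and> (\<forall>s\<in>carrier T. \<rho> (\<gamma> s) = \<alpha> s)"
    if "in_Add TYPE('j) R L TL M TM T TT" "continuous_hom L T TT X TX \<alpha>" for T :: "('l, 's) module" and TT \<alpha>
    by (rule in_Add_lift[OF M.ralgebra_axioms topL that lift])
  then have pre: "Add_precover TYPE('i) TYPE('s) TYPE('j) R L TL M TM X TX ?Q ?TQ \<rho>"
    unfolding Add_precover_def using Q_Add rQ by blast
  have iso: "topological_iso L ?Q ?TQ ?Q ?TQ g"
    if g: "continuous_hom L ?Q ?TQ ?Q ?TQ g" and rg: "\<forall>p\<in>carrier ?Q. \<rho> (g p) = \<rho> p" for g
  proof -
    \<comment> \<open>\<open>g\<close> is relevant on the summand only; composing with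
      \<open>e\<close> extends it to P and gives the relations e g = g = g e that \<open>inv\<close>
      expects.\<close>
    let ?g = "\<lambda>x. g (e x)"
    have gS: "g x \<in> S" if "x \<in> S" for x using continuous_hom_closed[OF g, of x] that by simp
    have eS: "e x \<in> S" if "x \<in> carrier P" for x using that ec ee by (simp add: S_def)
    have g': "continuous_hom L P TP P TP ?g"
      by (rule continuous_hom_compose[OF continuous_hom_compose[OF eQ g] incl])
    have "e (?g x) = ?g x" "?g (e x) = ?g x" "\<rho> (?g x) = \<rho> x" if "x \<in> carrier P" for x
      using gS[OF eS[OF that]] that ee re rg eS[OF that] by (auto simp: S_iff)
    then obtain h where h: "continuous_hom L P TP P TP h" "\<And>x. x \<in> carrier P \<Longrightarrow> e (h x) = h x"
        "\<And>x. x \<in> carrier P \<Longrightarrow> ?g (h x) = e x" "\<And>x. x \<in> carrier P \<Longrightarrow> h (?g x) = e x"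
      using inv[rule_format, of ?g] g' by blast
    have hS: "h x \<in> S" if "x \<in> carrier P" for x using h(2)[OF that] continuous_hom_closed[OF h(1) that] by (simp add: S_def)
    have hQ: "continuous_hom L ?Q ?TQ ?Q ?TQ h"
      by (rule P.continuous_hom_into_sub[OF S continuous_hom_compose[OF incl h(1)] Q.topspaceM]) (use hS in \<open>auto simp: S_def\<close>)
    show ?thesis unfolding topological_iso_def
    proof (intro conjI exI[of _ h] g hQ ballI)
      fix x assume "x \<in> carrier ?Q"
      then have x: "x \<in> carrier P" "e x = x" by (auto simp: S_def)
      show "h (g x) = x" using h(4)[OF x(1)] x(2) by simp
      show "g (h x) = x" using h(3)[OF x(1)] h(2)[OF x(1)] x(2) by simp
    qed
  qed
  show ?thesis unfolding Add_cover_def using pre iso by blast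
qed

text \<open>The image of Hom(M, P) in Hom(M, X) is closed by \<open>clsd_im\<close> and contains a
  generating null family, so it is everything.\<close>

lemma ex_power_precover:
  fixes M :: "('l, 'm) module" and X :: "('l, 'x) module"
  assumes M: "pcmod R L M TL TM" and fg: "finitely_generated L M" and X: "pcmod R L X TL TX"
  shows "\<exists>(I :: ('m, 'x) cover_index set) \<rho>. power_precover R L M TL TM I X TX \<rho>"
proof -
  interpret M: pcmod R L M TL TM by (rule M)
  interpret X: pcmod R L X TL TX by (rule X)
  interpret HX: hom_pc R L M TL TM X TX by unfold_locales (rule fg)
  from HX.H.ex_null_generators obtain u :: "('m \<Rightarrow> 'x) set \<Rightarrow> 'm \<Rightarrow> 'x" where
    u: "HX.H.null {\<zero>\<^bsub>HX.H\<^esub>} UNIV u" "\<And>Z. HX.H.clsd Z \<Longrightarrow> range u \<subseteq> Z \<Longrightarrow> Z = carrier HX.H" by blast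
  \<comment> \<open>The generators are indexed by sets of homomorphisms. Tagging each element with 0
    embeds these sets in \<open>cover_index\<close>, and \<open>snd\<close> recovers them.\<close>
  define lab where "lab S = {0::nat} \<times> S" for S :: "('m \<Rightarrow> 'x) set"
  define I where "I = range lab"
  define f where "f i = u (snd ` i)" for i :: "('m, 'x) cover_index"
  have f_lab: "f (lab S) = u S" for S by (simp add: f_def lab_def)
  interpret power_cover R L M TL TM I X TX by unfold_locales (rule fg)
  have fn: "HX.H.null {\<zero>\<^bsub>HX.H\<^esub>} I f"
  proof (rule HX.H.null_zeroI)
    show "f i \<in> carrier HX.H" if "i \<in> I" for i using HX.H.null_carrier[OF u(1)] by (simp add: f_def)
    fix W assume W: "W \<in> HX.\<W>"
    have "{i \<in> I. f i \<notin> W} = lab ` {S \<in> UNIV. u S \<notin> W}" by (auto simp: I_def f_lab)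
    then show "finite {i \<in> I. f i \<notin> W}" using HX.H.null_zeroD[OF u(1) HX.H.W_opn[OF W]] by simp
  qed
  from null_hom_exists[OF fn] obtain \<rho> where
    \<rho>: "continuous_hom L P TP X TX \<rho>" "\<And>i m. i \<in> I \<Longrightarrow> m \<in> carrier M \<Longrightarrow> \<rho> (\<iota> i m) = f i m" by blast
  interpret q: lin_compact_hom HP.H HP.E "hom_act M" HP.\<W> HX.H "hom_act M" HX.\<W> "push M \<rho>"
    by (rule push_lin_compact_hom[OF HP.hom_pc_axioms HX.hom_pc_axioms \<rho>(1)])
  have "push M \<rho> ` carrier HP.H = carrier HX.H"
  proof (rule u(2))
    show "HX.H.clsd (push M \<rho> ` carrier HP.H)"
      using q.clsd_im[OF HP.H.clsd_carrier HX.H.clsd_singleton] q.im_zero[OF order_refl] by simp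
    show "range u \<subseteq> push M \<rho> ` carrier HP.H"
    proof
      fix a assume "a \<in> range u"
      then obtain S where S: "a = u S" by blast
      have i: "lab S \<in> I" by (simp add: I_def)
      have "push M \<rho> (rinj (lab S)) = f (lab S)"
        by (rule HX.H_eqI[OF q.q_closed[OF rinj_H[OF i]] HX.H.null_carrier[OF fn i]])
          (use \<rho>(2)[OF i] in \<open>simp add: push_def rinj_def\<close>)
      then show "a \<in> push M \<rho> ` carrier HP.H" using rinj_H[OF i] S f_lab by (metis imageI)
    qed
  qed
  then have "power_precover R L M TL TM I X TX \<rho>" using \<rho>(1) by unfold_locales
  then show ?thesis by blast
qed

theorem theorem6p2:
  fixes R :: "'r ring" and TR :: "'r topology"
    and L :: "('r, 'l) module" and TL :: "'l topology"
    and M :: "('l, 'm) module" and TM :: "'m topology"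
    and X :: "('l, 'x) module" and TX :: "'x topology"
  assumes "comm_pseudocompact_ring R TR"
    and "pseudocompact_algebra R L TL"
    and "pseudocompact_module R L TL M TM"
    and "finitely_generated L M"
    and "pseudocompact_module R L TL X TX"
  shows "(\<exists>(P :: ('l, ('m, 'x) cover_elem) module) TP \<rho>.
            Add_cover TYPE(('m, 'x) cover_index) TYPE(('m, 'x) cover_elem) TYPE(('m, 'x) cover_index)
              R L TL M TM X TX P TP \<rho>)
       \<and> (\<forall>(P :: ('l, ('m, 'x) cover_elem) module) TP \<rho>.
            Add_cover TYPE(('m, 'x) cover_index) TYPE(('m, 'x) cover_elem) TYPE(('m, 'x) cover_index)
              R L TL M TM X TX P TP \<rho> \<longrightarrow>
            Add_cover TYPE(('m, 'x) cover_index) TYPE('s) TYPE('i)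
              R L TL M TM X TX P TP \<rho>)"
proof -
  have alg: "ralgebra R L" and topL: "topspace TL = carrier L"
    using assms(2) by (auto simp: pseudocompact_algebra_def ralgebra_def topological_ring_def)
  note M = pseudocompact_pcmod[OF alg topL assms(3)]
  note X = pseudocompact_pcmod[OF alg topL assms(5)]
  from ex_power_precover[OF M assms(4) X] obtain I :: "('m, 'x) cover_index set" and \<rho>
    where "power_precover R L M TL TM I X TX \<rho>" by blast
  then have "\<exists>(P :: ('l, ('m, 'x) cover_elem) module) TP.
      Add_cover TYPE(('m, 'x) cover_index) TYPE(('m, 'x) cover_elem) TYPE(('m, 'x) cover_index)
        R L TL M TM X TX P TP \<rho>" by (rule power_precover.ex_Add_cover)
  then show ?thesis using Add_cover_change_types[OF alg topL M assms(4) X] by blast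
qed

end
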